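(* Let $K$ be a field of characteristic $0$ and let $Q$ be a connected quiver. Let $F:\mathrm{rep}(Q)\to\mathrm{rep}(Q)$ be any tensor functor. Then $F$ commutes with the Schur functors: for every partition $\mu$ there is an isomorphism of functors $$F\circ S^{\mu}\cong S^{\mu}\circ F .$$
   Context: A quiver $Q=(Q_0,Q_1,t,h)$ has a finite vertex set $Q_0$, a finite arrow set $Q_1$, and tail and head maps $t,h:Q_1\to Q_0$; oriented cycles are allowed. $\mathrm{rep}(Q)$ is the category of finite dimensional representations of $Q$ over $K$: a representation $V$ consists of finite dimensional $K$-vector spaces $V_x$ ($x\in Q_0$) and linear maps $V_a:V_{ta}\to V_{ha}$ ($a\in Q_1$); a morphism $V\to W$ is a family of linear maps $\varphi_x:V_x\to W_x$ with $\varphi_{ha}\circ V_a=W_a\circ\varphi_{ta}$ for all arrows $a$. The tensor product is pointwise: $(V\otimes W)_x=V_x\otimes W_x$, $(V\otimes W)_a=V_a\otimes W_a$. The identity representation $\mathbf 1_Q$ has $(\mathbf 1_Q)_x=K$ for every vertex and $(\mathbf 1_Q)_a=\mathrm{id}_K$ for every arrow. Let $\phi_{X,Y,Z}:X\otimes(Y\otimes Z)\to(X\otimes Y)\otimes Z$ and $\psi_{X,Y}:X\otimes Y\to Y\otimes X$ be the standard associativity and commutativity isomorphisms, defined pointwise. A tensor functor $\mathrm{rep}(Q)\to\mathrm{rep}(Q')$ is a pair $(F,c)$ where $F$ is an additive functor and $c_{X,Y}:F(X)\otimes F(Y)\to F(X\otimes Y)$ is a functorial isomorphism such that: $c$ is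 compatible with associativity, i.e. $F(\phi_{X,Y,Z})\circ c_{X,Y\otimes Z}\circ(\mathrm{id}\otimes c_{Y,Z})=c_{X\otimes Y,Z}\circ(c_{X,Y}\otimes\mathrm{id})\circ\phi_{F(X),F(Y),F(Z)}$; $c$ is compatible with commutativity, i.e. $c_{Y,X}\circ\psi_{F(X),F(Y)}=F(\psi_{X,Y})\circ c_{X,Y}$; and $F(\mathbf 1_Q)\cong\mathbf 1_{Q'}$. The functor $F$ may be covariant or contravariant (in the contravariant case $F(\phi)$ and $F(\psi)$ are replaced by their inverses in these conditions). For a partition $\mu$, the Schur functor $S^\mu$ on finite dimensional vector spaces is the usual one ($S^\mu(U)$ is the image of the Young symmetrizer of $\mu$ acting on $U^{\otimes|\mu|}$). It acts on quiver representations pointwise: $(S^\mu V)_x=S^\mu(V_x)$ for $x\in Q_0$ and $(S^\mu V)_a=S^\mu(V_a)$ for $a\in Q_1$, defining a functor $S^\mu:\mathrm{rep}(Q)\to\mathrm{rep}(Q)$. *)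

theory Defs
  imports
    "Jordan_Normal_Form.VS_Connect"
    "Graph_Theory.Digraph_Component"
    "HOL-Combinatorics.Permutations"
    "HOL-Library.FuncSet"
begin

section \<open>Finite dimensional vector spaces and their tensor products\<close>

text \<open>
  The ground field is a type \<open>'k\<close> of class \<^class>\<open>field_char_0\<close> in the final statement.
  Vector spaces are records of the algebra library whose carrier is any subset of a type \<open>'u\<close>,
  which plays the role of the universe of sets; it is left arbitrary.
\<close>

definition fd_space :: "('k::field, 'u) module \<Rightarrow> bool" where
  "fd_space V \<longleftrightarrow> vectorspace class_ring V \<and> vectorspace.fin_dim class_ring V"

text \<open>Maps are extensional (fixed to be \<^const>\<open>undefined\<close> off the carrier), so that equality of
  functions is equality of linear maps.\<close>

definition lin_maps :: "('k::field, 'u) module \<Rightarrow> ('k, 'u) module \<Rightarrow> ('u \<Rightarrow> 'u) set" where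
  "lin_maps V W = LinearCombinations.module_hom class_ring V W \<inter> extensional (carrier V)"

definition bilinear_map ::
  "('k::field, 'u) module \<Rightarrow> ('k, 'u) module \<Rightarrow> ('k, 'u) module \<Rightarrow> ('u \<Rightarrow> 'u \<Rightarrow> 'u) \<Rightarrow> bool" where
  "bilinear_map V W X b \<longleftrightarrow>
     (\<forall>v\<in>carrier V. b v \<in> LinearCombinations.module_hom class_ring W X) \<and>
     (\<forall>w\<in>carrier W. (\<lambda>v. b v w) \<in> LinearCombinations.module_hom class_ring V X)"

definition is_tensor_product ::
  "('k::field, 'u) module \<Rightarrow> ('k, 'u) module \<Rightarrow> ('k, 'u) module \<Rightarrow> ('u \<Rightarrow> 'u \<Rightarrow> 'u) \<Rightarrow> bool" where
  "is_tensor_product V W P t \<longleftrightarrow>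
     vectorspace class_ring P \<and> bilinear_map V W P t \<and>
     (\<forall>X b. vectorspace class_ring X \<and> bilinear_map V W X b \<longrightarrow>
        (\<exists>!h. h \<in> lin_maps P X \<and> (\<forall>v\<in>carrier V. \<forall>w\<in>carrier W. h (t v w) = b v w)))"

text \<open>
  The tensor product of two vector spaces is only determined up to unique isomorphism, and the field
  \<open>'k\<close> is in general not a subset of \<open>'u\<close>. We therefore work relative to an arbitrary choice of
  a tensor product \<open>(tspace V W, tvec V W)\<close>, \<open>tvec V W v w\<close> being \<open>v \<otimes> w\<close>, for each pair of
  spaces, and of a copy \<open>line\<close> of the one-dimensional space \<open>'k\<close>, identified with \<open>'k\<close> by
  \<open>scal\<close>. Such choices exist, e.g. for \<open>'u = nat \<Rightarrow> 'k\<close>; see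
  \<open>tensor_choice_exists\<close> at the end of this section. Since \<open>line\<close> embeds the infinite field
  \<open>'k\<close> into \<open>'u\<close>, every finite dimensional space has an isomorphic copy in \<open>'u\<close>, so that
  testing the universal property on targets in \<open>'u\<close> is no restriction.
\<close>

record ('k, 'u) tensor_data =
  tspace :: "('k, 'u) module \<Rightarrow> ('k, 'u) module \<Rightarrow> ('k, 'u) module"
  tvec   :: "('k, 'u) module \<Rightarrow> ('k, 'u) module \<Rightarrow> 'u \<Rightarrow> 'u \<Rightarrow> 'u"
  line   :: "('k, 'u) module"
  scal   :: "'k \<Rightarrow> 'u"

locale tensor_choice =
  fixes T :: "('k::field, 'u) tensor_data"
  assumes fd_tspace: "fd_space V \<Longrightarrow> fd_space W \<Longrightarrow> fd_space (tspace T V W)"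
    and tensor: "fd_space V \<Longrightarrow> fd_space W \<Longrightarrow>
      is_tensor_product V W (tspace T V W) (tvec T V W)"
    and fd_line: "fd_space (line T)"
    and scal_bij: "bij_betw (scal T) UNIV (carrier (line T))"
    and scal_add: "scal T (a + b) = scal T a \<oplus>\<^bsub>line T\<^esub> scal T b"
    and scal_mult: "scal T (a * b) = a \<odot>\<^bsub>line T\<^esub> scal T b"

text \<open>\<open>f \<otimes> g : V \<otimes> W \<rightarrow> V' \<otimes> W'\<close> for \<open>f : V \<rightarrow> V'\<close> and \<open>g : W \<rightarrow> W'\<close>.\<close>

definition tensor_map ::
  "('k::field, 'u) tensor_data \<Rightarrow> ('k, 'u) module \<Rightarrow> ('k, 'u) module \<Rightarrow>
   ('k, 'u) module \<Rightarrow> ('k, 'u) module \<Rightarrow> ('u \<Rightarrow> 'u) \<Rightarrow> ('u \<Rightarrow> 'u) \<Rightarrow> 'u \<Rightarrow> 'u" where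
  "tensor_map T V W V' W' f g =
     (THE h. h \<in> lin_maps (tspace T V W) (tspace T V' W') \<and>
        (\<forall>v\<in>carrier V. \<forall>w\<in>carrier W. h (tvec T V W v w) = tvec T V' W' (f v) (g w)))"

definition assoc_map ::
  "('k::field, 'u) tensor_data \<Rightarrow> ('k, 'u) module \<Rightarrow> ('k, 'u) module \<Rightarrow> ('k, 'u) module \<Rightarrow> 'u \<Rightarrow> 'u"
where
  "assoc_map T U V W =
     (THE h. h \<in> lin_maps (tspace T U (tspace T V W)) (tspace T (tspace T U V) W) \<and>
        (\<forall>u\<in>carrier U. \<forall>v\<in>carrier V. \<forall>w\<in>carrier W.
           h (tvec T U (tspace T V W) u (tvec T V W v w)) =
           tvec T (tspace T U V) W (tvec T U V u v) w))"

definition braid_map ::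
  "('k::field, 'u) tensor_data \<Rightarrow> ('k, 'u) module \<Rightarrow> ('k, 'u) module \<Rightarrow> 'u \<Rightarrow> 'u" where
  "braid_map T V W =
     (THE h. h \<in> lin_maps (tspace T V W) (tspace T W V) \<and>
        (\<forall>v\<in>carrier V. \<forall>w\<in>carrier W. h (tvec T V W v w) = tvec T W V w v))"

subsection \<open>Existence of a choice of tensor products\<close>

definition coord_space :: "nat \<Rightarrow> ('k::field, nat \<Rightarrow> 'k) module" where
  "coord_space n = \<lparr> carrier = {f. \<forall>i\<ge>n. f i = 0}, monoid.mult = undefined, one = undefined,
     zero = (\<lambda>_. 0), add = (\<lambda>f g i. f i + g i), smult = (\<lambda>a f i. a * f i) \<rparr>"

definition coord_unit :: "nat \<Rightarrow> nat \<Rightarrow> 'k::field" where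
  "coord_unit j = (\<lambda>i. if i = j then 1 else 0)"

lemma module_hom_classI:
  fixes V :: "('k::field, 'u) module" and W :: "('k, 'w) module"
  assumes "\<And>v. v \<in> carrier V \<Longrightarrow> f v \<in> carrier W"
    and "\<And>v w. v \<in> carrier V \<Longrightarrow> w \<in> carrier V \<Longrightarrow> f (v \<oplus>\<^bsub>V\<^esub> w) = f v \<oplus>\<^bsub>W\<^esub> f w"
    and "\<And>a v. v \<in> carrier V \<Longrightarrow> f (a \<odot>\<^bsub>V\<^esub> v) = a \<odot>\<^bsub>W\<^esub> f v"
  shows "f \<in> LinearCombinations.module_hom class_ring V W"
  using assms by (auto simp: LinearCombinations.module_hom_def)

lemma module_hom_classD:
  fixes V :: "('k::field, 'u) module" and W :: "('k, 'w) module"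
  assumes "f \<in> LinearCombinations.module_hom class_ring V W"
  shows "\<And>v. v \<in> carrier V \<Longrightarrow> f v \<in> carrier W"
    and "\<And>v w. v \<in> carrier V \<Longrightarrow> w \<in> carrier V \<Longrightarrow> f (v \<oplus>\<^bsub>V\<^esub> w) = f v \<oplus>\<^bsub>W\<^esub> f w"
    and "\<And>a v. v \<in> carrier V \<Longrightarrow> f (a \<odot>\<^bsub>V\<^esub> v) = a \<odot>\<^bsub>W\<^esub> f v"
  using assms by (auto simp: LinearCombinations.module_hom_def)

lemma module_hom_comp:
  fixes V :: "('k::field, 'u) module" and W :: "('k, 'w) module" and X :: "('k, 'x) module"
  assumes f: "f \<in> LinearCombinations.module_hom class_ring V W"
    and g: "g \<in> LinearCombinations.module_hom class_ring W X"
  shows "(\<lambda>v. g (f v)) \<in> LinearCombinations.module_hom class_ring V X"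
  using module_hom_classD[OF f] module_hom_classD[OF g] by (intro module_hom_classI) simp_all

lemma coord_space_simps [simp]:
  "f \<in> carrier (coord_space n) \<longleftrightarrow> (\<forall>i\<ge>n. f i = 0)"
  "f \<oplus>\<^bsub>coord_space n\<^esub> g = (\<lambda>i. f i + g i)"
  "a \<odot>\<^bsub>coord_space n\<^esub> f = (\<lambda>i. a * f i)"
  "\<zero>\<^bsub>coord_space n\<^esub> = (\<lambda>_. 0)"
  by (auto simp: coord_space_def)

lemma vectorspace_coord_space:
  "vectorspace class_ring (coord_space n :: ('k::field, nat \<Rightarrow> 'k) module)"
proof -
  have fld: "field (class_ring :: 'k ring)" by (rule class_field.field_axioms)
  then have cr: "cring (class_ring :: 'k ring)" by (rule fieldE)
  have "abelian_group (coord_space n :: ('k, nat \<Rightarrow> 'k) module)"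
  proof (rule abelian_groupI)
    fix f assume "f \<in> carrier (coord_space n :: ('k, nat \<Rightarrow> 'k) module)"
    then show "\<exists>g\<in>carrier (coord_space n). g \<oplus>\<^bsub>coord_space n\<^esub> f = \<zero>\<^bsub>coord_space n\<^esub>"
      by (intro bexI[of _ "\<lambda>i. - f i"]) auto
  qed (auto simp: add_ac)
  then have "Module.module class_ring (coord_space n :: ('k, nat \<Rightarrow> 'k) module)"
    by (intro Module.module.intro cr Module.module_axioms.intro) (auto simp: algebra_simps)
  then show ?thesis using fld by (rule vectorspace.intro)
qed

lemma module_class: "vectorspace class_ring X \<Longrightarrow> Module.module class_ring X"
  by (simp add: vectorspace_def)

lemma coord_sum_hom:
  fixes X :: "('k::field, 'u) module"
  assumes X: "vectorspace class_ring X" and x: "x \<in> {..<n} \<rightarrow> carrier X"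
  shows "(\<lambda>f. \<Oplus>\<^bsub>X\<^esub>i\<in>{..<n}. f i \<odot>\<^bsub>X\<^esub> x i)
           \<in> LinearCombinations.module_hom class_ring (coord_space n) X"
proof -
  interpret X: Module.module class_ring X by (rule module_class[OF X])
  have sm: "a \<odot>\<^bsub>X\<^esub> x i \<in> carrier X" if "i < n" for a i
    using x that by (intro X.smult_closed) auto
  show ?thesis
  proof (rule module_hom_classI)
    fix f g :: "nat \<Rightarrow> 'k"
    show "(\<Oplus>\<^bsub>X\<^esub>i\<in>{..<n}. f i \<odot>\<^bsub>X\<^esub> x i) \<in> carrier X"
      by (rule X.finsum_closed) (auto intro: sm)
    have "(\<Oplus>\<^bsub>X\<^esub>i\<in>{..<n}. (f i + g i) \<odot>\<^bsub>X\<^esub> x i)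
        = (\<Oplus>\<^bsub>X\<^esub>i\<in>{..<n}. f i \<odot>\<^bsub>X\<^esub> x i \<oplus>\<^bsub>X\<^esub> g i \<odot>\<^bsub>X\<^esub> x i)"
      using x X.smult_l_distr by (intro X.finsum_cong') (auto intro!: sm)
    also have "\<dots> = (\<Oplus>\<^bsub>X\<^esub>i\<in>{..<n}. f i \<odot>\<^bsub>X\<^esub> x i) \<oplus>\<^bsub>X\<^esub> (\<Oplus>\<^bsub>X\<^esub>i\<in>{..<n}. g i \<odot>\<^bsub>X\<^esub> x i)"
      by (rule X.finsum_addf) (auto intro: sm)
    finally show "(\<Oplus>\<^bsub>X\<^esub>i\<in>{..<n}. (f \<oplus>\<^bsub>coord_space n\<^esub> g) i \<odot>\<^bsub>X\<^esub> x i) = \<dots>" by simp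
    fix a :: 'k
    have "(\<Oplus>\<^bsub>X\<^esub>i\<in>{..<n}. (a * f i) \<odot>\<^bsub>X\<^esub> x i)
        = (\<Oplus>\<^bsub>X\<^esub>i\<in>{..<n}. a \<odot>\<^bsub>X\<^esub> (f i \<odot>\<^bsub>X\<^esub> x i))"
      using x X.smult_assoc1 by (intro X.finsum_cong') (auto intro!: sm)
    also have "\<dots> = a \<odot>\<^bsub>X\<^esub> (\<Oplus>\<^bsub>X\<^esub>i\<in>{..<n}. f i \<odot>\<^bsub>X\<^esub> x i)"
      by (rule X.finsum_smult[symmetric]) (auto intro: sm)
    finally show "(\<Oplus>\<^bsub>X\<^esub>i\<in>{..<n}. (a \<odot>\<^bsub>coord_space n\<^esub> f) i \<odot>\<^bsub>X\<^esub> x i) = \<dots>" by simp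
  qed
qed

lemma hom_coord_space:
  fixes X :: "('k::field, 'u) module"
  assumes X: "vectorspace class_ring X"
    and h: "h \<in> LinearCombinations.module_hom class_ring (coord_space n) X"
    and f: "f \<in> carrier (coord_space n)"
  shows "h f = (\<Oplus>\<^bsub>X\<^esub>i\<in>{..<n}. f i \<odot>\<^bsub>X\<^esub> h (coord_unit i))"
proof -
  interpret X: Module.module class_ring X by (rule module_class[OF X])
  note h1 = module_hom_classD(1)[OF h] and h2 = module_hom_classD(2)[OF h]
    and h3 = module_hom_classD(3)[OF h]
  have uv: "coord_unit i \<in> carrier (coord_space n)" if "i < n" for i
    using that by (auto simp: coord_unit_def)
  have sm: "f i \<odot>\<^bsub>X\<^esub> h (coord_unit i) \<in> carrier X" if "i < n" for i
    using h1[OF uv[OF that]] by (intro X.smult_closed) auto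
  have "h (\<lambda>i. if i < m then f i else 0) = (\<Oplus>\<^bsub>X\<^esub>i\<in>{..<m}. f i \<odot>\<^bsub>X\<^esub> h (coord_unit i))"
    if "m \<le> n" for m
    using that
  proof (induction m)
    case 0
    have "h (\<lambda>_. 0) = h (0 \<odot>\<^bsub>coord_space n\<^esub> (\<lambda>_. 0))" by simp
    also have "\<dots> = 0 \<odot>\<^bsub>X\<^esub> h (\<lambda>_. 0)" by (rule h3) simp
    also have "\<dots> = \<zero>\<^bsub>X\<^esub>" using X.smult_l_null[OF h1[of "\<lambda>_. 0"]] by simp
    finally show ?case by simp
  next
    case (Suc m)
    let ?g = "\<lambda>i. if i < m then f i else 0"
    have "h (\<lambda>i. if i < Suc m then f i else 0)
        = h ((f m \<odot>\<^bsub>coord_space n\<^esub> coord_unit m) \<oplus>\<^bsub>coord_space n\<^esub> ?g)"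
      by (rule arg_cong[where f = h]) (auto simp: coord_unit_def fun_eq_iff less_Suc_eq)
    also have "\<dots> = h (f m \<odot>\<^bsub>coord_space n\<^esub> coord_unit m) \<oplus>\<^bsub>X\<^esub> h ?g"
      using Suc.prems by (intro h2) (auto simp: coord_unit_def)
    also have "h (f m \<odot>\<^bsub>coord_space n\<^esub> coord_unit m) = f m \<odot>\<^bsub>X\<^esub> h (coord_unit m)"
      using Suc.prems by (intro h3 uv) simp
    also have "h ?g = (\<Oplus>\<^bsub>X\<^esub>i\<in>{..<m}. f i \<odot>\<^bsub>X\<^esub> h (coord_unit i))"
      using Suc by simp
    also have "f m \<odot>\<^bsub>X\<^esub> h (coord_unit m) \<oplus>\<^bsub>X\<^esub> \<dots>
        = (\<Oplus>\<^bsub>X\<^esub>i\<in>insert m {..<m}. f i \<odot>\<^bsub>X\<^esub> h (coord_unit i))"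
      using Suc.prems by (intro X.finsum_insert[symmetric]) (auto intro!: sm)
    finally show ?case by (simp add: lessThan_Suc)
  qed
  from this[of n] have "h (\<lambda>i. if i < n then f i else 0)
      = (\<Oplus>\<^bsub>X\<^esub>i\<in>{..<n}. f i \<odot>\<^bsub>X\<^esub> h (coord_unit i))" by simp
  moreover have "(\<lambda>i. if i < n then f i else 0) = f" using f by (auto simp: fun_eq_iff)
  ultimately show ?thesis by simp
qed

lemma coord_sum_coord_unit:
  fixes X :: "('k::field, 'u) module"
  assumes X: "vectorspace class_ring X" and x: "x \<in> {..<n} \<rightarrow> carrier X" and j: "j < n"
  shows "(\<Oplus>\<^bsub>X\<^esub>i\<in>{..<n}. coord_unit j i \<odot>\<^bsub>X\<^esub> x i) = x j"
proof -
  interpret X: Module.module class_ring X by (rule module_class[OF X])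
  have "(\<Oplus>\<^bsub>X\<^esub>i\<in>{..<n}. coord_unit j i \<odot>\<^bsub>X\<^esub> x i)
      = (\<Oplus>\<^bsub>X\<^esub>i\<in>{..<n}. if j = i then x i else \<zero>\<^bsub>X\<^esub>)"
    using x X.smult_one X.smult_l_null
    by (intro X.finsum_cong') (auto simp: coord_unit_def Pi_iff)
  also have "\<dots> = x j" using x j by (intro X.finsum_singleton) auto
  finally show ?thesis .
qed

lemma fd_coord_space: "fd_space (coord_space n :: ('k::field, nat \<Rightarrow> 'k) module)"
proof -
  let ?K = "coord_space n :: ('k, nat \<Rightarrow> 'k) module"
  interpret K: vectorspace class_ring ?K by (rule vectorspace_coord_space)
  let ?A = "coord_unit ` {..<n} :: (nat \<Rightarrow> 'k) set"
  have sub: "?A \<subseteq> carrier ?K" by (auto simp: coord_unit_def)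
  have inj: "inj_on coord_unit S" for S :: "nat set"
    by (auto simp: inj_on_def coord_unit_def fun_eq_iff split: if_splits)
  have "f \<in> K.span ?A" if f: "f \<in> carrier ?K" for f
  proof -
    have id: "(\<lambda>x. x) \<in> LinearCombinations.module_hom class_ring ?K ?K"
      by (rule module_hom_classI) auto
    let ?a = "\<lambda>v :: nat \<Rightarrow> 'k. f (inv_into {..<n} coord_unit v)"
    have inv: "inv_into {..<n} coord_unit (coord_unit i :: nat \<Rightarrow> 'k) = i" if "i < n" for i
      using inj that by (intro inv_into_f_f) auto
    have "f = (\<Oplus>\<^bsub>?K\<^esub>i\<in>{..<n}. f i \<odot>\<^bsub>?K\<^esub> coord_unit i)"
      by (rule hom_coord_space[OF vectorspace_coord_space id f])
    also have "\<dots> = (\<Oplus>\<^bsub>?K\<^esub>i\<in>{..<n}. ?a (coord_unit i) \<odot>\<^bsub>?K\<^esub> coord_unit i)"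
    proof (rule K.finsum_cong')
      show "f i \<odot>\<^bsub>?K\<^esub> coord_unit i = ?a (coord_unit i) \<odot>\<^bsub>?K\<^esub> coord_unit i" if "i \<in> {..<n}" for i
        unfolding inv[OF that[unfolded lessThan_iff]] ..
    next
      show "(\<lambda>i. ?a (coord_unit i) \<odot>\<^bsub>?K\<^esub> coord_unit i) \<in> {..<n} \<rightarrow> carrier ?K"
        using sub by (intro Pi_I K.smult_closed) auto
    qed simp
    also have "\<dots> = (\<Oplus>\<^bsub>?K\<^esub>v\<in>?A. ?a v \<odot>\<^bsub>?K\<^esub> v)"
    proof (rule K.finsum_reindex[symmetric, OF _ inj], rule Pi_I)
      fix v assume "v \<in> ?A"
      then show "?a v \<odot>\<^bsub>?K\<^esub> v \<in> carrier ?K" using sub by (intro K.smult_closed) auto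
    qed
    finally have "f = K.lincomb ?a ?A" unfolding K.lincomb_def .
    moreover have "finite ?A \<and> ?A \<subseteq> ?A \<and> ?a \<in> ?A \<rightarrow> carrier class_ring" by simp
    ultimately show ?thesis unfolding K.span_def by blast
  qed
  moreover have "K.span ?A \<subseteq> carrier ?K" using K.span_is_subset2[OF sub] .
  ultimately have "K.span ?A = carrier ?K" by blast
  then have "K.fin_dim" unfolding K.fin_dim_def using sub by blast
  then show ?thesis using vectorspace_coord_space by (auto simp: fd_space_def)
qed

lemma fd_space_coordinates:
  fixes V :: "('k::field, 'u) module"
  assumes "fd_space V"
  obtains n b t where "b \<in> {..<n} \<rightarrow> carrier V"
    "t \<in> LinearCombinations.module_hom class_ring V (coord_space n)"
    "\<And>v. v \<in> carrier V \<Longrightarrow> v = (\<Oplus>\<^bsub>V\<^esub>i\<in>{..<n}. t v i \<odot>\<^bsub>V\<^esub> b i)"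
    "\<And>j. j < n \<Longrightarrow> t (b j) = coord_unit j"
proof -
  have vs: "vectorspace class_ring V" using assms by (simp add: fd_space_def)
  interpret V: vectorspace class_ring V by (rule vs)
  obtain B where B: "finite B" "V.basis B"
    using V.finite_basis_exists assms by (auto simp: fd_space_def)
  then have sub: "B \<subseteq> carrier V" by (simp add: V.basis_def)
  obtain b n where "bij_betw b {..<n::nat} B"
    using ex_bij_betw_nat_finite[OF B(1)] by (auto simp: atLeast0LessThan)
  then have inj: "inj_on b {..<n}" and im: "b ` {..<n} = B" by (auto simp: bij_betw_def)
  have b: "b \<in> {..<n} \<rightarrow> carrier V" using im sub by auto
  let ?s = "\<lambda>f. \<Oplus>\<^bsub>V\<^esub>i\<in>{..<n}. f i \<odot>\<^bsub>V\<^esub> b i"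
  have s: "?s \<in> LinearCombinations.module_hom class_ring (coord_space n) V"
    by (rule coord_sum_hom[OF vs b])
  have lc: "V.lincomb a B = ?s (\<lambda>i. if i < n then a (b i) else 0)" for a
  proof -
    have "V.lincomb a B = (\<Oplus>\<^bsub>V\<^esub>v\<in>b ` {..<n}. a v \<odot>\<^bsub>V\<^esub> v)" by (simp add: V.lincomb_def im)
    also have "\<dots> = (\<Oplus>\<^bsub>V\<^esub>i\<in>{..<n}. a (b i) \<odot>\<^bsub>V\<^esub> b i)"
      using sub im by (intro V.finsum_reindex inj) (auto intro!: V.smult_closed)
    also have "\<dots> = ?s (\<lambda>i. if i < n then a (b i) else 0)"
      using b by (intro V.finsum_cong') (auto intro!: V.smult_closed)
    finally show ?thesis .
  qed
  have crit: "\<exists>!a. a \<in> B \<rightarrow>\<^sub>E UNIV \<and> V.lincomb a B = v" if "v \<in> carrier V" for v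
    using V.basis_criterion[OF B(1) sub] B(2) that by auto
  have ex1: "\<exists>!f. f \<in> carrier (coord_space n) \<and> ?s f = v" if v: "v \<in> carrier V" for v
  proof -
    obtain a where a: "V.lincomb a B = v" using crit[OF v] by blast
    show ?thesis
    proof (rule ex1I)
      show "(\<lambda>i. if i < n then a (b i) else 0) \<in> carrier (coord_space n) \<and>
          ?s (\<lambda>i. if i < n then a (b i) else 0) = v" using a lc by auto
    next
      fix f assume f: "f \<in> carrier (coord_space n) \<and> ?s f = v"
      have "\<exists>a. a \<in> B \<rightarrow>\<^sub>E UNIV \<and> (\<forall>i<n. a (b i) = g i)" for g :: "nat \<Rightarrow> 'k"
        using im inv_into_f_f[OF inj]
        by (intro exI[of _ "restrict (\<lambda>v. g (inv_into {..<n} b v)) B"]) auto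
      then have ext: "\<exists>a. a \<in> B \<rightarrow>\<^sub>E UNIV \<and> (\<lambda>i. if i < n then a (b i) else 0) = g"
        if "g \<in> carrier (coord_space n)" for g :: "nat \<Rightarrow> 'k"
        using that by (fastforce simp: fun_eq_iff)
      obtain a1 where a1: "a1 \<in> B \<rightarrow>\<^sub>E UNIV" "(\<lambda>i. if i < n then a1 (b i) else 0) = f"
        using ext f by blast
      obtain a2 where a2: "a2 \<in> B \<rightarrow>\<^sub>E UNIV"
          "(\<lambda>i. if i < n then a2 (b i) else 0) = (\<lambda>i. if i < n then a (b i) else 0)"
        using ext[of "\<lambda>i. if i < n then a (b i) else 0"] by auto
      have "V.lincomb a1 B = v" using lc[of a1] arg_cong[OF a1(2), of ?s] f by simp
      moreover have "V.lincomb a2 B = v"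
        using lc[of a2] arg_cong[OF a2(2), of ?s] lc[of a] a by simp
      ultimately have a12: "a1 = a2" using crit[OF v] a1 a2 by blast
      show "f = (\<lambda>i. if i < n then a (b i) else 0)"
        by (rule trans[OF a1(2)[symmetric] a2(2)[folded a12]])
    qed
  qed
  define t where "t v = (THE f. f \<in> carrier (coord_space n) \<and> ?s f = v)" for v
  have t: "t v \<in> carrier (coord_space n)" "?s (t v) = v" if "v \<in> carrier V" for v
    using theI'[OF ex1[OF that]] unfolding t_def by blast+
  have teq: "t v = f" if "f \<in> carrier (coord_space n)" "?s f = v" "v \<in> carrier V" for v f
    using ex1[OF that(3)] t[OF that(3)] that by blast
  have thom: "t \<in> LinearCombinations.module_hom class_ring V (coord_space n)"
  proof (rule module_hom_classI)
    fix v assume v: "v \<in> carrier V"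
    then show "t v \<in> carrier (coord_space n)" by (rule t)
    fix a
    have "?s (a \<odot>\<^bsub>coord_space n\<^esub> t v) = a \<odot>\<^bsub>V\<^esub> ?s (t v)"
      by (rule module_hom_classD(3)[OF s]) (rule t[OF v])
    then show "t (a \<odot>\<^bsub>V\<^esub> v) = a \<odot>\<^bsub>coord_space n\<^esub> t v"
      using t[OF v] v V.smult_closed[of a v] by (intro teq) auto
    fix w assume w: "w \<in> carrier V"
    have "?s (t v \<oplus>\<^bsub>coord_space n\<^esub> t w) = ?s (t v) \<oplus>\<^bsub>V\<^esub> ?s (t w)"
      by (rule module_hom_classD(2)[OF s]) (rule t[OF v] t[OF w])+
    then show "t (v \<oplus>\<^bsub>V\<^esub> w) = t v \<oplus>\<^bsub>coord_space n\<^esub> t w"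
      using t[OF v] t[OF w] v w by (intro teq) auto
  qed
  show ?thesis
  proof (rule that[OF b thom])
    show "v = ?s (t v)" if "v \<in> carrier V" for v using t(2)[OF that] by (rule sym)
    fix j assume j: "j < n"
    show "t (b j) = coord_unit j"
    proof (rule teq)
      show "coord_unit j \<in> carrier (coord_space n)" using j by (auto simp: coord_unit_def)
      show "?s (coord_unit j) = b j" by (rule coord_sum_coord_unit[OF vs b j])
      show "b j \<in> carrier V" using b j by auto
    qed
  qed
qed

lemma hom_eq_on_coordinates:
  fixes V :: "('k::field, 'u) module" and X :: "('k, 'w) module"
  assumes V: "vectorspace class_ring V" and X: "vectorspace class_ring X"
    and b: "b \<in> {..<n} \<rightarrow> carrier V"
    and gen: "\<And>v. v \<in> carrier V \<Longrightarrow> v = (\<Oplus>\<^bsub>V\<^esub>i\<in>{..<n}. t v i \<odot>\<^bsub>V\<^esub> b i)"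
    and t: "t \<in> LinearCombinations.module_hom class_ring V (coord_space n)"
    and f: "f \<in> LinearCombinations.module_hom class_ring V X"
    and g: "g \<in> LinearCombinations.module_hom class_ring V X"
    and eq: "\<And>i. i < n \<Longrightarrow> f (b i) = g (b i)"
    and v: "v \<in> carrier V"
  shows "f v = g v"
proof -
  interpret X: Module.module class_ring X by (rule module_class[OF X])
  let ?s = "\<lambda>c. \<Oplus>\<^bsub>V\<^esub>i\<in>{..<n}. c i \<odot>\<^bsub>V\<^esub> b i"
  note s = coord_sum_hom[OF V b]
  have expand: "h v = (\<Oplus>\<^bsub>X\<^esub>i\<in>{..<n}. t v i \<odot>\<^bsub>X\<^esub> h (b i))"
    if h: "h \<in> LinearCombinations.module_hom class_ring V X" for h
  proof -
    have hs: "(\<lambda>c. h (?s c)) \<in> LinearCombinations.module_hom class_ring (coord_space n) X"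
      using module_hom_classD[OF h] module_hom_classD[OF s] by (intro module_hom_classI) auto
    have "h v = h (?s (t v))" using gen[OF v] by simp
    also have "\<dots> = (\<Oplus>\<^bsub>X\<^esub>i\<in>{..<n}. t v i \<odot>\<^bsub>X\<^esub> h (?s (coord_unit i)))"
      by (rule hom_coord_space[OF X hs module_hom_classD(1)[OF t v]])
    also have "\<dots> = (\<Oplus>\<^bsub>X\<^esub>i\<in>{..<n}. t v i \<odot>\<^bsub>X\<^esub> h (b i))"
      using b coord_sum_coord_unit[OF V b] module_hom_classD(1)[OF h]
      by (intro X.finsum_cong') (auto intro!: X.smult_closed)
    finally show ?thesis .
  qed
  show ?thesis
    unfolding expand[OF f] expand[OF g]
    using b eq module_hom_classD(1)[OF g] by (intro X.finsum_cong') (auto intro!: X.smult_closed)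
qed

lemma tensor_product_exists:
  fixes V W :: "('k::field, nat \<Rightarrow> 'k) module"
  assumes V: "fd_space V" and W: "fd_space W"
  shows "\<exists>P t. fd_space P \<and> is_tensor_product V W P t"
proof -
  have vsV: "vectorspace class_ring V" and vsW: "vectorspace class_ring W"
    using V W by (auto simp: fd_space_def)
  obtain m b f where b: "b \<in> {..<m} \<rightarrow> carrier V"
    and f: "f \<in> LinearCombinations.module_hom class_ring V (coord_space m)"
    and genV: "\<And>v. v \<in> carrier V \<Longrightarrow> v = (\<Oplus>\<^bsub>V\<^esub>i\<in>{..<m}. f v i \<odot>\<^bsub>V\<^esub> b i)"
    and fb: "\<And>j. j < m \<Longrightarrow> f (b j) = coord_unit j"
    by (rule fd_space_coordinates[OF V]) blast
  obtain n d g where d: "d \<in> {..<n} \<rightarrow> carrier W"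
    and g: "g \<in> LinearCombinations.module_hom class_ring W (coord_space n)"
    and genW: "\<And>w. w \<in> carrier W \<Longrightarrow> w = (\<Oplus>\<^bsub>W\<^esub>i\<in>{..<n}. g w i \<odot>\<^bsub>W\<^esub> d i)"
    and gd: "\<And>j. j < n \<Longrightarrow> g (d j) = coord_unit j"
    by (rule fd_space_coordinates[OF W]) blast
  let ?P = "coord_space (m * n) :: ('k, nat \<Rightarrow> 'k) module"
  define t where "t v w = (\<lambda>k. if k < m * n then f v (k div n) * g w (k mod n) else 0)" for v w
  have bil: "bilinear_map V W ?P t"
    unfolding bilinear_map_def
    using module_hom_classD[OF f] module_hom_classD[OF g]
    by (auto intro!: module_hom_classI simp: t_def fun_eq_iff algebra_simps)
  have basis: "t (b (k div n)) (d (k mod n)) = coord_unit k" and "k div n < m" and "k mod n < n"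
    if k: "k < m * n" for k
  proof -
    have n: "n > 0" using k by (cases n) auto
    show kd: "k div n < m" using k by (simp add: less_mult_imp_div_less)
    show km: "k mod n < n" using n by simp
    show "t (b (k div n)) (d (k mod n)) = coord_unit k"
    proof
      fix i
      have "i = k \<longleftrightarrow> i div n = k div n \<and> i mod n = k mod n"
        by (rule iffI) (simp, metis div_mult_mod_eq)
      then show "t (b (k div n)) (d (k mod n)) i = coord_unit k i"
        using k unfolding t_def fb[OF kd] gd[OF km] by (auto simp: coord_unit_def)
    qed
  qed
  note kdiv = this(2) and kmod = this(3)
  have "\<exists>!h. h \<in> lin_maps ?P X \<and> (\<forall>v\<in>carrier V. \<forall>w\<in>carrier W. h (t v w) = \<beta> v w)"
    if X: "vectorspace class_ring X" and \<beta>: "bilinear_map V W X \<beta>"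
    for X :: "('k, nat \<Rightarrow> 'k) module" and \<beta>
  proof -
    interpret X: Module.module class_ring X by (rule module_class[OF X])
    have \<beta>1: "\<beta> v \<in> LinearCombinations.module_hom class_ring W X" if "v \<in> carrier V" for v
      using \<beta> that by (simp add: bilinear_map_def)
    have \<beta>2: "(\<lambda>v. \<beta> v w) \<in> LinearCombinations.module_hom class_ring V X" if "w \<in> carrier W" for w
      using \<beta> that by (simp add: bilinear_map_def)
    have t1: "t v \<in> LinearCombinations.module_hom class_ring W ?P" if "v \<in> carrier V" for v
      using bil that by (simp add: bilinear_map_def)
    have t2: "(\<lambda>v. t v w) \<in> LinearCombinations.module_hom class_ring V ?P" if "w \<in> carrier W" for w
      using bil that by (simp add: bilinear_map_def)
    define x where "x k = \<beta> (b (k div n)) (d (k mod n))" for k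
    have x: "x \<in> {..<m * n} \<rightarrow> carrier X"
    proof
      fix k assume "k \<in> {..<m * n}"
      then have "b (k div n) \<in> carrier V" "d (k mod n) \<in> carrier W"
        using b d kdiv[of k] kmod[of k] by auto
      then show "x k \<in> carrier X"
        unfolding x_def using module_hom_classD(1)[OF \<beta>1] by blast
    qed
    define s where "s c = (\<Oplus>\<^bsub>X\<^esub>k\<in>{..<m * n}. c k \<odot>\<^bsub>X\<^esub> x k)" for c
    have s: "s \<in> LinearCombinations.module_hom class_ring ?P X"
      unfolding s_def by (rule coord_sum_hom[OF X x])
    have s_basis: "s (t (b i) (d j)) = \<beta> (b i) (d j)" if "i < m" "j < n" for i j
    proof -
      let ?k = "i * n + j"
      have "?k < Suc i * n" using that by simp
      also have "\<dots> \<le> m * n" using that by (intro mult_le_mono1) simp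
      finally have k: "?k < m * n" .
      have "t (b i) (d j) = coord_unit ?k" using basis[OF k] that by simp
      then have "s (t (b i) (d j)) = x ?k" unfolding s_def using coord_sum_coord_unit[OF X x k] by simp
      then show ?thesis using that by (simp add: x_def)
    qed
    have st2: "(\<lambda>v. s (t v w)) \<in> LinearCombinations.module_hom class_ring V X" if "w \<in> carrier W" for w
      by (rule module_hom_comp[OF t2[OF that] s])
    have st1: "(\<lambda>w. s (t v w)) \<in> LinearCombinations.module_hom class_ring W X" if "v \<in> carrier V" for v
      by (rule module_hom_comp[OF t1[OF that] s])
    have "s (t v (d j)) = \<beta> v (d j)" if "v \<in> carrier V" "j < n" for v j
    proof -
      have dj: "d j \<in> carrier W" using d that by auto
      show ?thesis
        using hom_eq_on_coordinates[OF vsV X b genV f st2[OF dj] \<beta>2[OF dj] s_basis[OF _ that(2)] that(1)] .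
    qed
    then have st: "s (t v w) = \<beta> v w" if "v \<in> carrier V" "w \<in> carrier W" for v w
      using hom_eq_on_coordinates[OF vsW X d genW g st1[OF that(1)] \<beta>1[OF that(1)] _ that(2)] that
      by blast
    have tc: "t v w \<in> carrier ?P" for v w by (simp add: t_def)
    show ?thesis
    proof (rule ex1I)
      show "restrict s (carrier ?P) \<in> lin_maps ?P X \<and>
          (\<forall>v\<in>carrier V. \<forall>w\<in>carrier W. restrict s (carrier ?P) (t v w) = \<beta> v w)"
      proof (intro conjI ballI)
        interpret P: Module.module class_ring ?P by (rule module_class[OF vectorspace_coord_space])
        have "restrict s (carrier ?P) \<in> LinearCombinations.module_hom class_ring ?P X"
        proof (rule module_hom_classI)
          fix v w :: "nat \<Rightarrow> 'k" and a :: 'k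
          assume v: "v \<in> carrier ?P"
          then show "restrict s (carrier ?P) v \<in> carrier X"
            using module_hom_classD(1)[OF s] by simp
          have "a \<odot>\<^bsub>?P\<^esub> v \<in> carrier ?P" using v by simp
          then show "restrict s (carrier ?P) (a \<odot>\<^bsub>?P\<^esub> v) = a \<odot>\<^bsub>X\<^esub> restrict s (carrier ?P) v"
            using v module_hom_classD(3)[OF s] by (simp only: restrict_apply if_True)
          assume w: "w \<in> carrier ?P"
          have "v \<oplus>\<^bsub>?P\<^esub> w \<in> carrier ?P" using v w by simp
          then show "restrict s (carrier ?P) (v \<oplus>\<^bsub>?P\<^esub> w) =
              restrict s (carrier ?P) v \<oplus>\<^bsub>X\<^esub> restrict s (carrier ?P) w"
            using v w module_hom_classD(2)[OF s] by (simp only: restrict_apply if_True)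
        qed
        then show "restrict s (carrier ?P) \<in> lin_maps ?P X" by (simp add: lin_maps_def)
      qed (use st tc in \<open>simp only: restrict_apply if_True\<close>)
    next
      fix h assume h: "h \<in> lin_maps ?P X \<and> (\<forall>v\<in>carrier V. \<forall>w\<in>carrier W. h (t v w) = \<beta> v w)"
      then have hh: "h \<in> LinearCombinations.module_hom class_ring ?P X"
        and he: "h \<in> extensional (carrier ?P)" by (auto simp: lin_maps_def)
      have hx: "h (coord_unit k) = x k" if "k < m * n" for k
      proof -
        have "b (k div n) \<in> carrier V" "d (k mod n) \<in> carrier W"
          using b d kdiv[OF that] kmod[OF that] by auto
        then have "h (t (b (k div n)) (d (k mod n))) = x k" using h unfolding x_def by blast
        then show ?thesis unfolding basis[OF that] .
      qed
      have "h c = s c" if c: "c \<in> carrier ?P" for c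
        unfolding hom_coord_space[OF X hh c] s_def
        using x hx by (intro X.finsum_cong') (auto intro!: X.smult_closed)
      then show "h = restrict s (carrier ?P)" by (intro extensionalityI[OF he]) auto
    qed
  qed
  then have "is_tensor_product V W ?P t"
    using bil vectorspace_coord_space by (simp add: is_tensor_product_def)
  then show ?thesis using fd_coord_space by blast
qed

lemma tensor_choice_exists: "\<exists>T :: ('k::field, nat \<Rightarrow> 'k) tensor_data. tensor_choice T"
proof -
  obtain P t where Pt: "\<And>V W :: ('k, nat \<Rightarrow> 'k) module. fd_space V \<Longrightarrow> fd_space W \<Longrightarrow>
      fd_space (P V W) \<and> is_tensor_product V W (P V W) (t V W)"
    using tensor_product_exists by metis
  let ?e = "\<lambda>a i. if i = 0 then a else (0 :: 'k)"
  have "bij_betw ?e UNIV (carrier (coord_space (Suc 0)))"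
    by (rule bij_betwI[where g = "\<lambda>f. f 0"]) (auto simp: fun_eq_iff)
  then have "tensor_choice \<lparr> tspace = P, tvec = t, line = coord_space (Suc 0), scal = ?e \<rparr>"
    using Pt fd_coord_space by unfold_locales (auto simp: fun_eq_iff)
  then show ?thesis ..
qed

section \<open>Schur functors on vector spaces\<close>

fun tpow :: "('k::field, 'u) tensor_data \<Rightarrow> ('k, 'u) module \<Rightarrow> nat \<Rightarrow> ('k, 'u) module" where
  "tpow T U 0 = line T"
| "tpow T U (Suc n) = tspace T (tpow T U n) U"

text \<open>\<open>pure_tensor T U n us\<close> is \<open>us 0 \<otimes> \<dots> \<otimes> us (n - 1)\<close>.\<close>

fun pure_tensor ::
  "('k::field, 'u) tensor_data \<Rightarrow> ('k, 'u) module \<Rightarrow> nat \<Rightarrow> (nat \<Rightarrow> 'u) \<Rightarrow> 'u" where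
  "pure_tensor T U 0 us = scal T 1"
| "pure_tensor T U (Suc n) us = tvec T (tpow T U n) U (pure_tensor T U n us) (us n)"

fun tpow_map ::
  "('k::field, 'u) tensor_data \<Rightarrow> ('k, 'u) module \<Rightarrow> ('k, 'u) module \<Rightarrow> ('u \<Rightarrow> 'u) \<Rightarrow> nat \<Rightarrow> 'u \<Rightarrow> 'u"
where
  "tpow_map T U V f 0 = (\<lambda>v\<in>carrier (line T). v)"
| "tpow_map T U V f (Suc n) =
     tensor_map T (tpow T U n) U (tpow T V n) V (tpow_map T U V f n) f"

text \<open>The right action of the symmetric group:
  \<open>(u\<^sub>0 \<otimes> \<dots> \<otimes> u\<^bsub>n-1\<^esub>) \<cdot> \<sigma> = u\<^bsub>\<sigma>(0)\<^esub> \<otimes> \<dots> \<otimes> u\<^bsub>\<sigma>(n-1)\<^esub>\<close>.\<close>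

definition perm_map ::
  "('k::field, 'u) tensor_data \<Rightarrow> ('k, 'u) module \<Rightarrow> nat \<Rightarrow> (nat \<Rightarrow> nat) \<Rightarrow> 'u \<Rightarrow> 'u" where
  "perm_map T U n \<sigma> =
     (THE h. h \<in> lin_maps (tpow T U n) (tpow T U n) \<and>
        (\<forall>us \<in> {..<n} \<rightarrow> carrier U.
           h (pure_tensor T U n us) = pure_tensor T U n (\<lambda>i. us (\<sigma> i))))"

text \<open>Partitions are weakly decreasing lists of positive parts, \<open>\<bar>\<mu>\<bar>\<close> being \<^term>\<open>sum_list \<mu>\<close>.\<close>

definition is_partition :: "nat list \<Rightarrow> bool" where
  "is_partition \<mu> \<longleftrightarrow> sorted_wrt (\<ge>) \<mu> \<and> 0 \<notin> set \<mu>"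

text \<open>The standard tableau filled row by row: entry \<open>k\<close> sits in the box
  \<open>boxes \<mu> ! k\<close>, a pair of a row and a column index.\<close>

definition boxes :: "nat list \<Rightarrow> (nat \<times> nat) list" where
  "boxes \<mu> = concat (map (\<lambda>i. map (Pair i) [0..<\<mu> ! i]) [0..<length \<mu>])"

definition row_group :: "nat list \<Rightarrow> (nat \<Rightarrow> nat) set" where
  "row_group \<mu> = {p. p permutes {..<sum_list \<mu>} \<and>
     (\<forall>k<sum_list \<mu>. fst (boxes \<mu> ! p k) = fst (boxes \<mu> ! k))}"

definition column_group :: "nat list \<Rightarrow> (nat \<Rightarrow> nat) set" where
  "column_group \<mu> = {q. q permutes {..<sum_list \<mu>} \<and>
     (\<forall>k<sum_list \<mu>. snd (boxes \<mu> ! q k) = snd (boxes \<mu> ! k))}"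

text \<open>Right multiplication by the Young symmetrizer
  \<open>(\<Sum>p\<in>row_group \<mu>. p) (\<Sum>q\<in>column_group \<mu>. sgn(q) q)\<close>; the conventions are those of
  Fulton and Harris.\<close>

definition young_symmetrizer ::
  "('k::field, 'u) tensor_data \<Rightarrow> nat list \<Rightarrow> ('k, 'u) module \<Rightarrow> 'u \<Rightarrow> 'u" where
  "young_symmetrizer T \<mu> U t =
     (\<Oplus>\<^bsub>tpow T U (sum_list \<mu>)\<^esub>p\<in>row_group \<mu>.
       \<Oplus>\<^bsub>tpow T U (sum_list \<mu>)\<^esub>q\<in>column_group \<mu>.
        of_int (sign q) \<odot>\<^bsub>tpow T U (sum_list \<mu>)\<^esub> perm_map T U (sum_list \<mu>) (p \<circ> q) t)"

definition schur_space ::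
  "('k::field, 'u) tensor_data \<Rightarrow> nat list \<Rightarrow> ('k, 'u) module \<Rightarrow> ('k, 'u) module" where
  "schur_space T \<mu> U = (tpow T U (sum_list \<mu>))
     \<lparr>carrier := young_symmetrizer T \<mu> U ` carrier (tpow T U (sum_list \<mu>))\<rparr>"

definition schur_map ::
  "('k::field, 'u) tensor_data \<Rightarrow> nat list \<Rightarrow> ('k, 'u) module \<Rightarrow> ('k, 'u) module \<Rightarrow>
   ('u \<Rightarrow> 'u) \<Rightarrow> 'u \<Rightarrow> 'u" where
  "schur_map T \<mu> U V f = restrict (tpow_map T U V f (sum_list \<mu>)) (carrier (schur_space T \<mu> U))"

section \<open>Additive categories with a tensor product\<close>

text \<open>
  An arrow determines its source and target. \<open>TMor C f g\<close> is \<open>f \<otimes> g\<close>, \<open>Assoc C X Y Z\<close> goes from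
  \<open>X \<otimes> (Y \<otimes> Z)\<close> to \<open>(X \<otimes> Y) \<otimes> Z\<close> and \<open>Braid C X Y\<close> from \<open>X \<otimes> Y\<close> to \<open>Y \<otimes> X\<close>.
\<close>

record ('o, 'm) tensor_cat =
  Obj   :: "'o set"
  Hom   :: "'o \<Rightarrow> 'o \<Rightarrow> 'm set"
  Id    :: "'o \<Rightarrow> 'm"
  Comp  :: "'m \<Rightarrow> 'm \<Rightarrow> 'm"
  Add   :: "'m \<Rightarrow> 'm \<Rightarrow> 'm"
  TObj  :: "'o \<Rightarrow> 'o \<Rightarrow> 'o"
  TMor  :: "'m \<Rightarrow> 'm \<Rightarrow> 'm"
  Assoc :: "'o \<Rightarrow> 'o \<Rightarrow> 'o \<Rightarrow> 'm"
  Braid :: "'o \<Rightarrow> 'o \<Rightarrow> 'm"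
  Unit  :: "'o"

definition inverse_pair :: "('o, 'm) tensor_cat \<Rightarrow> 'o \<Rightarrow> 'o \<Rightarrow> 'm \<Rightarrow> 'm \<Rightarrow> bool" where
  "inverse_pair C A B f g \<longleftrightarrow> f \<in> Hom C A B \<and> g \<in> Hom C B A \<and>
     Comp C g f = Id C A \<and> Comp C f g = Id C B"

definition is_iso :: "('o, 'm) tensor_cat \<Rightarrow> 'o \<Rightarrow> 'o \<Rightarrow> 'm \<Rightarrow> bool" where
  "is_iso C A B f \<longleftrightarrow> (\<exists>g. inverse_pair C A B f g)"

definition inverse_arrow :: "('o, 'm) tensor_cat \<Rightarrow> 'o \<Rightarrow> 'o \<Rightarrow> 'm \<Rightarrow> 'm" where
  "inverse_arrow C A B f = (THE g. inverse_pair C A B f g)"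

text \<open>
  A contravariant functor on \<open>C\<close> is a functor on \<open>opposite C\<close>. The associativity and commutativity
  constraints of the opposite category are the inverses of the original ones.
\<close>

definition opposite :: "('o, 'm) tensor_cat \<Rightarrow> ('o, 'm) tensor_cat" where
  "opposite C = C
    \<lparr> Hom := (\<lambda>A B. Hom C B A),
      Comp := (\<lambda>g f. Comp C f g),
      Assoc := (\<lambda>X Y Z. inverse_arrow C (TObj C X (TObj C Y Z)) (TObj C (TObj C X Y) Z)
                          (Assoc C X Y Z)),
      Braid := (\<lambda>X Y. inverse_arrow C (TObj C X Y) (TObj C Y X) (Braid C X Y)) \<rparr>"

record ('o, 'm, 'p, 'n) functor_data =
  on_obj :: "'o \<Rightarrow> 'p"
  on_arr :: "'m \<Rightarrow> 'n"

definition functor_comp ::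
  "('p, 'n, 'q, 'l) functor_data \<Rightarrow> ('o, 'm, 'p, 'n) functor_data \<Rightarrow> ('o, 'm, 'q, 'l) functor_data"
where
  "functor_comp G F = \<lparr> on_obj = on_obj G \<circ> on_obj F, on_arr = on_arr G \<circ> on_arr F \<rparr>"

definition is_functor ::
  "('o, 'm) tensor_cat \<Rightarrow> ('p, 'n) tensor_cat \<Rightarrow> ('o, 'm, 'p, 'n) functor_data \<Rightarrow> bool" where
  "is_functor C D F \<longleftrightarrow>
     (\<forall>A\<in>Obj C. on_obj F A \<in> Obj D) \<and>
     (\<forall>A\<in>Obj C. \<forall>B\<in>Obj C. \<forall>f\<in>Hom C A B. on_arr F f \<in> Hom D (on_obj F A) (on_obj F B)) \<and>
     (\<forall>A\<in>Obj C. on_arr F (Id C A) = Id D (on_obj F A)) \<and>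
     (\<forall>A\<in>Obj C. \<forall>B\<in>Obj C. \<forall>B'\<in>Obj C. \<forall>f\<in>Hom C A B. \<forall>g\<in>Hom C B B'.
        on_arr F (Comp C g f) = Comp D (on_arr F g) (on_arr F f))"

definition is_additive ::
  "('o, 'm) tensor_cat \<Rightarrow> ('p, 'n) tensor_cat \<Rightarrow> ('o, 'm, 'p, 'n) functor_data \<Rightarrow> bool" where
  "is_additive C D F \<longleftrightarrow>
     (\<forall>A\<in>Obj C. \<forall>B\<in>Obj C. \<forall>f\<in>Hom C A B. \<forall>g\<in>Hom C A B.
        on_arr F (Add C f g) = Add D (on_arr F f) (on_arr F g))"

definition naturally_isomorphic ::
  "('o, 'm) tensor_cat \<Rightarrow> ('p, 'n) tensor_cat \<Rightarrow>
   ('o, 'm, 'p, 'n) functor_data \<Rightarrow> ('o, 'm, 'p, 'n) functor_data \<Rightarrow> bool" where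
  "naturally_isomorphic C D F G \<longleftrightarrow> is_functor C D F \<and> is_functor C D G \<and>
     (\<exists>\<eta>. (\<forall>A\<in>Obj C. is_iso D (on_obj F A) (on_obj G A) (\<eta> A)) \<and>
          (\<forall>A\<in>Obj C. \<forall>B\<in>Obj C. \<forall>f\<in>Hom C A B.
             Comp D (\<eta> B) (on_arr F f) = Comp D (on_arr G f) (\<eta> A)))"

definition tensor_functor ::
  "('o, 'm) tensor_cat \<Rightarrow> ('p, 'n) tensor_cat \<Rightarrow>
   ('o, 'm, 'p, 'n) functor_data \<Rightarrow> ('o \<Rightarrow> 'o \<Rightarrow> 'n) \<Rightarrow> bool" where
  "tensor_functor C D F c \<longleftrightarrow>
     is_functor C D F \<and> is_additive C D F \<and>
     (\<forall>X\<in>Obj C. \<forall>Y\<in>Obj C.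
        is_iso D (TObj D (on_obj F X) (on_obj F Y)) (on_obj F (TObj C X Y)) (c X Y)) \<and>
     (\<forall>X\<in>Obj C. \<forall>X'\<in>Obj C. \<forall>Y\<in>Obj C. \<forall>Y'\<in>Obj C. \<forall>f\<in>Hom C X X'. \<forall>g\<in>Hom C Y Y'.
        Comp D (c X' Y') (TMor D (on_arr F f) (on_arr F g)) =
        Comp D (on_arr F (TMor C f g)) (c X Y)) \<and>
     (\<forall>X\<in>Obj C. \<forall>Y\<in>Obj C. \<forall>Z\<in>Obj C.
        Comp D (on_arr F (Assoc C X Y Z))
          (Comp D (c X (TObj C Y Z)) (TMor D (Id D (on_obj F X)) (c Y Z))) =
        Comp D (c (TObj C X Y) Z)
          (Comp D (TMor D (c X Y) (Id D (on_obj F Z)))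
            (Assoc D (on_obj F X) (on_obj F Y) (on_obj F Z)))) \<and>
     (\<forall>X\<in>Obj C. \<forall>Y\<in>Obj C.
        Comp D (c Y X) (Braid D (on_obj F X) (on_obj F Y)) =
        Comp D (on_arr F (Braid C X Y)) (c X Y)) \<and>
     (\<exists>u. is_iso D (on_obj F (Unit C)) (Unit D) u)"

section \<open>Representations of a quiver\<close>

text \<open>A quiver is a \<^locale>\<open>fin_digraph\<close>, which may have loops, oriented cycles and parallel arcs.\<close>

record ('v, 'e, 'k, 'u) qrep =
  sp  :: "'v \<Rightarrow> ('k, 'u) module"
  act :: "'e \<Rightarrow> 'u \<Rightarrow> 'u"

record ('v, 'e, 'k, 'u) qmor =
  src :: "('v, 'e, 'k, 'u) qrep"
  tgt :: "('v, 'e, 'k, 'u) qrep"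
  at_vert :: "'v \<Rightarrow> 'u \<Rightarrow> 'u"

definition reps :: "('v, 'e) pre_digraph \<Rightarrow> ('v, 'e, 'k::field, 'u) qrep set" where
  "reps Q = {V. sp V \<in> extensional (verts Q) \<and> act V \<in> extensional (arcs Q) \<and>
     (\<forall>x\<in>verts Q. fd_space (sp V x)) \<and>
     (\<forall>a\<in>arcs Q. act V a \<in> lin_maps (sp V (tail Q a)) (sp V (head Q a)))}"

definition rep_hom ::
  "('v, 'e) pre_digraph \<Rightarrow> ('v, 'e, 'k::field, 'u) qrep \<Rightarrow> ('v, 'e, 'k, 'u) qrep \<Rightarrow>
   ('v, 'e, 'k, 'u) qmor set" where
  "rep_hom Q V W = {\<phi>. src \<phi> = V \<and> tgt \<phi> = W \<and> at_vert \<phi> \<in> extensional (verts Q) \<and>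
     (\<forall>x\<in>verts Q. at_vert \<phi> x \<in> lin_maps (sp V x) (sp W x)) \<and>
     (\<forall>a\<in>arcs Q. \<forall>v\<in>carrier (sp V (tail Q a)).
        at_vert \<phi> (head Q a) (act V a v) = act W a (at_vert \<phi> (tail Q a) v))}"

definition rep_tensor ::
  "('v, 'e) pre_digraph \<Rightarrow> ('k::field, 'u) tensor_data \<Rightarrow>
   ('v, 'e, 'k, 'u) qrep \<Rightarrow> ('v, 'e, 'k, 'u) qrep \<Rightarrow> ('v, 'e, 'k, 'u) qrep" where
  "rep_tensor Q T V W =
     \<lparr> sp = (\<lambda>x\<in>verts Q. tspace T (sp V x) (sp W x)),
       act = (\<lambda>a\<in>arcs Q. tensor_map T (sp V (tail Q a)) (sp W (tail Q a))
                (sp V (head Q a)) (sp W (head Q a)) (act V a) (act W a)) \<rparr>"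

definition rep_cat ::
  "('v, 'e) pre_digraph \<Rightarrow> ('k::field, 'u) tensor_data \<Rightarrow>
   (('v, 'e, 'k, 'u) qrep, ('v, 'e, 'k, 'u) qmor) tensor_cat" where
  "rep_cat Q T =
     \<lparr> Obj = reps Q,
       Hom = rep_hom Q,
       Id = (\<lambda>V. \<lparr> src = V, tgt = V, at_vert = (\<lambda>x\<in>verts Q. \<lambda>v\<in>carrier (sp V x). v) \<rparr>),
       Comp = (\<lambda>\<psi> \<phi>. \<lparr> src = src \<phi>, tgt = tgt \<psi>,
         at_vert = (\<lambda>x\<in>verts Q. compose (carrier (sp (src \<phi>) x)) (at_vert \<psi> x) (at_vert \<phi> x)) \<rparr>),
       Add = (\<lambda>\<phi> \<psi>. \<lparr> src = src \<phi>, tgt = tgt \<phi>,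
         at_vert = (\<lambda>x\<in>verts Q. \<lambda>v\<in>carrier (sp (src \<phi>) x).
           at_vert \<phi> x v \<oplus>\<^bsub>sp (tgt \<phi>) x\<^esub> at_vert \<psi> x v) \<rparr>),
       TObj = rep_tensor Q T,
       TMor = (\<lambda>\<phi> \<psi>. \<lparr> src = rep_tensor Q T (src \<phi>) (src \<psi>), tgt = rep_tensor Q T (tgt \<phi>) (tgt \<psi>),
         at_vert = (\<lambda>x\<in>verts Q. tensor_map T (sp (src \<phi>) x) (sp (src \<psi>) x)
           (sp (tgt \<phi>) x) (sp (tgt \<psi>) x) (at_vert \<phi> x) (at_vert \<psi> x)) \<rparr>),
       Assoc = (\<lambda>X Y Z. \<lparr> src = rep_tensor Q T X (rep_tensor Q T Y Z),
         tgt = rep_tensor Q T (rep_tensor Q T X Y) Z,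
         at_vert = (\<lambda>x\<in>verts Q. assoc_map T (sp X x) (sp Y x) (sp Z x)) \<rparr>),
       Braid = (\<lambda>X Y. \<lparr> src = rep_tensor Q T X Y, tgt = rep_tensor Q T Y X,
         at_vert = (\<lambda>x\<in>verts Q. braid_map T (sp X x) (sp Y x)) \<rparr>),
       Unit = \<lparr> sp = (\<lambda>x\<in>verts Q. line T), act = (\<lambda>a\<in>arcs Q. \<lambda>v\<in>carrier (line T). v) \<rparr> \<rparr>"

definition schur_rep ::
  "('v, 'e) pre_digraph \<Rightarrow> ('k::field, 'u) tensor_data \<Rightarrow> nat list \<Rightarrow>
   ('v, 'e, 'k, 'u) qrep \<Rightarrow> ('v, 'e, 'k, 'u) qrep" where
  "schur_rep Q T \<mu> V =
     \<lparr> sp = (\<lambda>x\<in>verts Q. schur_space T \<mu> (sp V x)),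
       act = (\<lambda>a\<in>arcs Q. schur_map T \<mu> (sp V (tail Q a)) (sp V (head Q a)) (act V a)) \<rparr>"

definition schur_functor ::
  "('v, 'e) pre_digraph \<Rightarrow> ('k::field, 'u) tensor_data \<Rightarrow> nat list \<Rightarrow>
   (('v, 'e, 'k, 'u) qrep, ('v, 'e, 'k, 'u) qmor,
    ('v, 'e, 'k, 'u) qrep, ('v, 'e, 'k, 'u) qmor) functor_data" where
  "schur_functor Q T \<mu> =
     \<lparr> on_obj = schur_rep Q T \<mu>,
       on_arr = (\<lambda>\<phi>. \<lparr> src = schur_rep Q T \<mu> (src \<phi>), tgt = schur_rep Q T \<mu> (tgt \<phi>),
         at_vert = (\<lambda>x\<in>verts Q. schur_map T \<mu> (sp (src \<phi>) x) (sp (tgt \<phi>) x) (at_vert \<phi> x)) \<rparr>) \<rparr>"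

end

theory Submission
  imports Defs
begin

text \<open>A tensor functor \<open>F\<close> comes with isomorphisms \<open>c\<close>, and iterating \<open>c\<close> gives natural isomorphisms
  \<open>eta n V\<close> from the \<open>n\<close>-th tensor power of \<open>F V\<close> to \<open>F\<close> of the \<open>n\<close>-th tensor power of \<open>V\<close>.
  Compatibility of \<open>c\<close> with associativity and commutativity says that \<open>eta\<close> intertwines the
  transpositions of adjacent tensor factors (\<open>eta_transpose\<close>), hence all permutations: \<open>F\<close> carries
  the action of \<open>\<sigma>\<close> to that of \<open>\<sigma>\<close> if it is covariant, and to that of the inverse of \<open>\<sigma>\<close> if it is
  contravariant. Being additive, \<open>F\<close> is linear over the rational numbers (\<open>FA_scale_rat\<close>), so the
  same holds for the whole rational group algebra, with the inversion of permutations extended to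
  the anti-involution \<open>star\<close> (\<open>eta_alg\<close>).

  The Schur functor is the image of the action of an element \<open>e\<close> of this algebra, the Young
  symmetrizer. An additive functor need not preserve images, but it preserves split ones, and the
  image of \<open>e\<close> splits off because the group algebra is von Neumann regular. Only the following
  consequence of the positivity of the standard inner product on the group algebra is used, for
  which the particular form of \<open>e\<close> is irrelevant: there is \<open>y\<close> with \<open>star e = star e * e * y\<close>
  (\<open>group_algebra_regular\<close>), and therefore \<open>e * y * e = e\<close>. If \<open>F\<close> is covariant, then \<open>F\<close> of the
  Schur functor of \<open>V\<close> and the Schur functor of \<open>F V\<close> are images of the same split endomorphism of
  the tensor power of \<open>F V\<close>, up to \<open>eta\<close>. If \<open>F\<close> is contravariant, then the former is the image of
  \<open>star e\<close>, and the equation for \<open>y\<close> shows that this image is naturally isomorphic to that of \<open>e\<close>.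
  Both cases are instances of \<open>naturally_isomorphic_if_split\<close>.\<close>

section \<open>The rational group algebra of a symmetric group\<close>

text \<open>Elements of the group algebra of the permutations of a finite set \<open>S\<close> are functions on
  permutations, of which only the values at permutations of \<open>S\<close> matter; \<open>conv S\<close> is the
  product, \<open>star\<close> the anti-involution inverting each permutation, and \<open>inner_prod S\<close> the inner
  product for which the permutations are orthonormal.\<close>

abbreviation pinv :: "('x \<Rightarrow> 'x) \<Rightarrow> 'x \<Rightarrow> 'x" where
  "pinv p \<equiv> inv_into UNIV p"

definition conv :: "'x set \<Rightarrow> (('x \<Rightarrow> 'x) \<Rightarrow> rat) \<Rightarrow> (('x \<Rightarrow> 'x) \<Rightarrow> rat) \<Rightarrow> ('x \<Rightarrow> 'x) \<Rightarrow> rat" where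
  "conv S a b \<sigma> = (\<Sum>\<tau> | \<tau> permutes S. a \<tau> * b (pinv \<tau> \<circ> \<sigma>))"

definition star :: "(('x \<Rightarrow> 'x) \<Rightarrow> rat) \<Rightarrow> ('x \<Rightarrow> 'x) \<Rightarrow> rat" where
  "star a \<sigma> = a (pinv \<sigma>)"

definition inner_prod :: "'x set \<Rightarrow> (('x \<Rightarrow> 'x) \<Rightarrow> rat) \<Rightarrow> (('x \<Rightarrow> 'x) \<Rightarrow> rat) \<Rightarrow> rat" where
  "inner_prod S a b = (\<Sum>\<sigma> | \<sigma> permutes S. a \<sigma> * b \<sigma>)"

lemma pinv_compose:
  assumes "p permutes S" "q permutes S"
  shows "pinv (p \<circ> q) = pinv q \<circ> pinv p"
  by (rule o_inv_distrib) (rule permutes_bij[OF assms(1)], rule permutes_bij[OF assms(2)])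

lemma conv_cong:
  assumes "\<And>\<tau>. \<tau> permutes S \<Longrightarrow> a \<tau> = a' \<tau>" "\<And>\<tau>. \<tau> permutes S \<Longrightarrow> b \<tau> = b' \<tau>" "\<sigma> permutes S"
  shows "conv S a b \<sigma> = conv S a' b' \<sigma>"
  unfolding conv_def using assms by (intro sum.cong) (auto intro: permutes_compose permutes_inv)

lemma conv_alt:
  assumes "\<sigma> permutes S"
  shows "conv S a b \<sigma> = (\<Sum>\<rho> | \<rho> permutes S. a (\<sigma> \<circ> pinv \<rho>) * b \<rho>)"
proof -
  have "conv S a b \<sigma> = (\<Sum>\<tau> | \<tau> permutes S. a (\<sigma> \<circ> \<tau>) * b (pinv (\<sigma> \<circ> \<tau>) \<circ> \<sigma>))"
    unfolding conv_def by (rule setum_permutations_compose_left[OF assms])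
  also have "\<dots> = (\<Sum>\<rho> | \<rho> permutes S. a (\<sigma> \<circ> pinv \<rho>) * b (pinv (\<sigma> \<circ> pinv \<rho>) \<circ> \<sigma>))"
    by (rule sum_permutations_inverse)
  also have "\<dots> = (\<Sum>\<rho> | \<rho> permutes S. a (\<sigma> \<circ> pinv \<rho>) * b \<rho>)"
  proof (rule sum.cong[OF refl])
    fix \<rho> assume "\<rho> \<in> {\<rho>. \<rho> permutes S}"
    then have r: "\<rho> permutes S" by simp
    have "pinv (\<sigma> \<circ> pinv \<rho>) \<circ> \<sigma> = \<rho> \<circ> (pinv \<sigma> \<circ> \<sigma>)"
      by (simp only: pinv_compose[OF assms permutes_inv[OF r]] permutes_inv_inv[OF r] o_assoc)
    then have "pinv (\<sigma> \<circ> pinv \<rho>) \<circ> \<sigma> = \<rho>" using permutes_inv_o(2)[OF assms] by simp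
    then show "a (\<sigma> \<circ> pinv \<rho>) * b (pinv (\<sigma> \<circ> pinv \<rho>) \<circ> \<sigma>) = a (\<sigma> \<circ> pinv \<rho>) * b \<rho>" by simp
  qed
  finally show ?thesis .
qed

lemma conv_assoc:
  assumes "\<sigma> permutes S"
  shows "conv S (conv S a b) c \<sigma> = conv S a (conv S b c) \<sigma>"
proof -
  let ?G = "{\<tau>. \<tau> permutes S}"
  have "conv S (conv S a b) c \<sigma> = (\<Sum>\<rho>\<in>?G. conv S a b (\<sigma> \<circ> pinv \<rho>) * c \<rho>)"
    by (rule conv_alt[OF assms])
  also have "\<dots> = (\<Sum>\<rho>\<in>?G. \<Sum>\<tau>\<in>?G. a \<tau> * (b (pinv \<tau> \<circ> \<sigma> \<circ> pinv \<rho>) * c \<rho>))"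
    by (simp add: conv_def sum_distrib_right mult.assoc o_assoc)
  also have "\<dots> = (\<Sum>\<tau>\<in>?G. \<Sum>\<rho>\<in>?G. a \<tau> * (b (pinv \<tau> \<circ> \<sigma> \<circ> pinv \<rho>) * c \<rho>))"
    by (rule sum.swap)
  also have "\<dots> = (\<Sum>\<tau>\<in>?G. a \<tau> * conv S b c (pinv \<tau> \<circ> \<sigma>))"
    using assms by (intro sum.cong refl) (simp add: conv_alt permutes_compose permutes_inv sum_distrib_left)
  finally show ?thesis by (simp add: conv_def)
qed

lemma star_conv:
  assumes "\<sigma> permutes S"
  shows "star (conv S a b) \<sigma> = conv S (star b) (star a) \<sigma>"
proof -
  have "star (conv S a b) \<sigma> = (\<Sum>\<rho> | \<rho> permutes S. b \<rho> * a (pinv \<sigma> \<circ> pinv \<rho>))"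
    using assms by (simp add: star_def conv_alt permutes_inv mult.commute)
  also have "\<dots> = (\<Sum>\<rho> | \<rho> permutes S. b (pinv \<rho>) * a (pinv \<sigma> \<circ> pinv (pinv \<rho>)))"
    by (rule sum_permutations_inverse)
  also have "\<dots> = conv S (star b) (star a) \<sigma>"
    unfolding conv_def star_def
    by (intro sum.cong refl)
      (simp only: mem_Collect_eq pinv_compose[OF permutes_inv assms] permutes_inv_inv)
  finally show ?thesis .
qed

lemma star_star: "\<sigma> permutes S \<Longrightarrow> star (star a) \<sigma> = a \<sigma>"
  by (simp add: star_def permutes_inv_inv)

text \<open>Left multiplication by \<open>star a\<close> is adjoint to left multiplication by \<open>a\<close>.\<close>

lemma inner_prod_conv_left:
  "inner_prod S (conv S a b) c = inner_prod S b (conv S (star a) c)"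
proof -
  let ?G = "{\<tau>. \<tau> permutes S}"
  have "inner_prod S (conv S a b) c = (\<Sum>\<sigma>\<in>?G. \<Sum>\<rho>\<in>?G. a (\<sigma> \<circ> pinv \<rho>) * b \<rho> * c \<sigma>)"
    by (simp add: inner_prod_def conv_alt sum_distrib_right)
  also have "\<dots> = (\<Sum>\<rho>\<in>?G. \<Sum>\<sigma>\<in>?G. a (\<sigma> \<circ> pinv \<rho>) * b \<rho> * c \<sigma>)" by (rule sum.swap)
  also have "\<dots> = (\<Sum>\<rho>\<in>?G. b \<rho> * (\<Sum>\<sigma>\<in>?G. star a (\<rho> \<circ> pinv \<sigma>) * c \<sigma>))"
    unfolding star_def sum_distrib_left
    by (intro sum.cong refl)
      (simp only: mem_Collect_eq pinv_compose[OF _ permutes_inv] permutes_inv_inv mult_ac)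
  also have "\<dots> = inner_prod S b (conv S (star a) c)"
    by (simp add: inner_prod_def conv_alt)
  finally show ?thesis .
qed

lemma inner_prod_self_eq_0:
  assumes "finite S" "inner_prod S a a = 0" "\<sigma> permutes S"
  shows "a \<sigma> = 0"
proof -
  have "\<forall>\<sigma>\<in>{\<sigma>. \<sigma> permutes S}. a \<sigma> * a \<sigma> = 0"
    using assms(2) unfolding inner_prod_def
    by (subst (asm) sum_nonneg_eq_0_iff) (auto simp: finite_permutations[OF assms(1)])
  then show ?thesis using assms(3) by auto
qed

text \<open>Orthogonal projection onto the span of a finite family, by the Gram-Schmidt process without
  normalization, so that it works over the rational numbers.\<close>

lemma orthogonal_projection:
  fixes u :: "'j \<Rightarrow> 'x \<Rightarrow> rat"
  assumes "finite J" "finite G"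
  shows "\<exists>c. \<forall>k\<in>J. (\<Sum>x\<in>G. (v x - (\<Sum>j\<in>J. c j * u j x)) * u k x) = 0"
  using assms(1)
proof (induction J arbitrary: v rule: finite_induct)
  case empty
  then show ?case by simp
next
  case (insert m J)
  obtain c where c: "\<And>k. k \<in> J \<Longrightarrow> (\<Sum>x\<in>G. (v x - (\<Sum>j\<in>J. c j * u j x)) * u k x) = 0"
    using insert.IH[of v] by blast
  obtain d where d: "\<And>k. k \<in> J \<Longrightarrow> (\<Sum>x\<in>G. (u m x - (\<Sum>j\<in>J. d j * u j x)) * u k x) = 0"
    using insert.IH[of "u m"] by blast
  define w where "w x = u m x - (\<Sum>j\<in>J. d j * u j x)" for x
  define z where "z x = v x - (\<Sum>j\<in>J. c j * u j x)" for x
  have wu: "(\<Sum>x\<in>G. w x * u k x) = 0" if "k \<in> J" for k using d[OF that] by (simp add: w_def)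
  have zu: "(\<Sum>x\<in>G. z x * u k x) = 0" if "k \<in> J" for k using c[OF that] by (simp add: z_def)
  \<comment> \<open>a vector orthogonal to the old family pairs with \<open>u m\<close> as with its projected part \<open>w\<close>\<close>
  have um: "(\<Sum>x\<in>G. f x * u m x) = (\<Sum>x\<in>G. f x * w x)"
    if f: "\<And>k. k \<in> J \<Longrightarrow> (\<Sum>x\<in>G. f x * u k x) = 0" for f
  proof -
    have "(\<Sum>x\<in>G. f x * (\<Sum>j\<in>J. d j * u j x)) = (\<Sum>j\<in>J. d j * (\<Sum>x\<in>G. f x * u j x))"
      by (simp add: sum_distrib_left sum.swap[of _ G] mult_ac)
    also have "\<dots> = 0" by (simp add: f)
    finally show ?thesis by (simp add: w_def algebra_simps sum_subtractf)
  qed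
  define W where "W = (\<Sum>x\<in>G. w x * w x)"
  define r where "r = (\<Sum>x\<in>G. z x * w x) / W"
  have rW: "r * W = (\<Sum>x\<in>G. z x * w x)"
  proof (cases "W = 0")
    case True
    then have "\<forall>x\<in>G. w x * w x = 0"
      using assms(2) unfolding W_def by (subst (asm) sum_nonneg_eq_0_iff) auto
    then show ?thesis using True by simp
  qed (simp add: r_def)
  define c' where "c' j = (if j = m then r else c j - r * d j)" for j
  have eq: "v x - (\<Sum>j\<in>insert m J. c' j * u j x) = z x - r * w x" for x
  proof -
    have "(\<Sum>j\<in>J. c' j * u j x) = (\<Sum>j\<in>J. (c j - r * d j) * u j x)"
      using insert.hyps(2) by (intro sum.cong) (auto simp: c'_def)
    also have "\<dots> = (\<Sum>j\<in>J. c j * u j x) - r * (\<Sum>j\<in>J. d j * u j x)"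
      by (simp add: algebra_simps sum_subtractf sum_distrib_left)
    finally show ?thesis
      using insert.hyps by (simp add: z_def w_def c'_def algebra_simps)
  qed
  have old: "(\<Sum>x\<in>G. (z x - r * w x) * u k x) = 0" if "k \<in> J" for k
  proof -
    have "(\<Sum>x\<in>G. (z x - r * w x) * u k x) = (\<Sum>x\<in>G. z x * u k x) - r * (\<Sum>x\<in>G. w x * u k x)"
      by (simp add: algebra_simps sum_subtractf sum_distrib_left)
    then show ?thesis using wu zu that by simp
  qed
  have "(\<Sum>x\<in>G. (z x - r * w x) * u m x) = (\<Sum>x\<in>G. (z x - r * w x) * w x)"
    by (rule um) (rule old)
  also have "\<dots> = 0"
    using rW by (simp add: algebra_simps sum_subtractf sum_distrib_left W_def)
  finally show ?case using old unfolding eq[symmetric] by blast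
qed

text \<open>The rational group algebra is regular, in the strong form that the quasi-inverse is
  compatible with the anti-involution: \<open>y\<close> is found by projecting \<open>star e\<close> orthogonally to the
  right ideal generated by \<open>star e * e\<close>. The remainder
  \<open>z = star e - star e * e * y\<close> satisfies \<open>e * z = 0\<close>, and this forces
  \<open>z\<close> to be orthogonal to itself.\<close>

lemma group_algebra_regular:
  assumes S: "finite S"
  obtains y where
    "\<And>\<sigma>. \<sigma> permutes S \<Longrightarrow> conv S (star e) (conv S e y) \<sigma> = star e \<sigma>"
    "\<And>\<sigma>. \<sigma> permutes S \<Longrightarrow> conv S (conv S (star y) (star e)) e \<sigma> = e \<sigma>"
    "\<And>\<sigma>. \<sigma> permutes S \<Longrightarrow> conv S e (conv S y e) \<sigma> = e \<sigma>"
proof -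
  let ?G = "{\<tau>. \<tau> permutes S}"
  note perm = permutes_compose permutes_inv
  define s where "s = conv S (star e) e"
  obtain y where y: "\<And>\<rho>. \<rho> \<in> ?G \<Longrightarrow>
      (\<Sum>\<sigma>\<in>?G. (star e \<sigma> - (\<Sum>\<rho>\<in>?G. y \<rho> * s (\<sigma> \<circ> pinv \<rho>))) * s (\<sigma> \<circ> pinv \<rho>)) = 0"
    using orthogonal_projection[of ?G ?G "star e" "\<lambda>\<rho> \<sigma>. s (\<sigma> \<circ> pinv \<rho>)"]
      finite_permutations[OF S] by blast
  define z where "z \<sigma> = star e \<sigma> - conv S (star e) (conv S e y) \<sigma>" for \<sigma>
  have z: "z \<sigma> = star e \<sigma> - (\<Sum>\<rho>\<in>?G. y \<rho> * s (\<sigma> \<circ> pinv \<rho>))" if "\<sigma> permutes S" for \<sigma>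
    using that by (simp add: z_def s_def conv_alt[of _ _ _ y] mult.commute flip: conv_assoc)
  have zs: "inner_prod S z (conv S s b) = 0" for b
  proof -
    have "inner_prod S z (conv S s b) = (\<Sum>\<sigma>\<in>?G. \<Sum>\<rho>\<in>?G. b \<rho> * (z \<sigma> * s (\<sigma> \<circ> pinv \<rho>)))"
      by (simp add: inner_prod_def conv_alt sum_distrib_left mult_ac)
    also have "\<dots> = (\<Sum>\<rho>\<in>?G. \<Sum>\<sigma>\<in>?G. b \<rho> * (z \<sigma> * s (\<sigma> \<circ> pinv \<rho>)))" by (rule sum.swap)
    also have "\<dots> = (\<Sum>\<rho>\<in>?G. b \<rho> * (\<Sum>\<sigma>\<in>?G. z \<sigma> * s (\<sigma> \<circ> pinv \<rho>)))"
      by (simp add: sum_distrib_left)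
    also have "\<dots> = 0" using y by (simp add: z)
    finally show ?thesis .
  qed
  have ez: "inner_prod S (conv S e z) (conv S e b) = 0" for b
  proof -
    have "inner_prod S z (conv S s b) = inner_prod S z (conv S (star e) (conv S e b))"
      unfolding inner_prod_def s_def by (intro sum.cong) (simp_all add: conv_assoc)
    then show ?thesis using zs[of b] by (simp add: inner_prod_conv_left)
  qed
  have ez0: "conv S e z \<sigma> = 0" if "\<sigma> permutes S" for \<sigma>
    by (rule inner_prod_self_eq_0[OF S ez that])
  have "inner_prod S z z = inner_prod S z (star e) - inner_prod S z (conv S (star e) (conv S e y))"
    unfolding inner_prod_def sum_subtractf[symmetric]
    by (intro sum.cong refl) (simp add: z_def algebra_simps)
  also have "inner_prod S z (conv S (star e) (conv S e y)) = 0"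
    using ez[of y] by (simp add: inner_prod_conv_left)
  also have "inner_prod S z (star e) = conv S e z id"
    by (simp add: conv_alt[OF permutes_id] inner_prod_def star_def mult.commute)
  also have "\<dots> = 0" by (rule ez0[OF permutes_id])
  finally have "inner_prod S z z = 0" by simp
  then have 1: "conv S (star e) (conv S e y) \<sigma> = star e \<sigma>" if "\<sigma> permutes S" for \<sigma>
    using inner_prod_self_eq_0[OF S _ that, of z] by (simp add: z_def)
  have 2: "conv S (conv S (star y) (star e)) e \<sigma> = e \<sigma>" if "\<sigma> permutes S" for \<sigma>
  proof -
    have "e \<sigma> = star (star e) \<sigma>" using that by (simp add: star_star)
    also have "\<dots> = star (conv S (star e) (conv S e y)) \<sigma>"
      using 1 that by (simp add: star_def[of "star e"] star_def[of "conv S _ _"] permutes_inv)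
    also have "\<dots> = conv S (star (conv S e y)) (star (star e)) \<sigma>" by (rule star_conv[OF that])
    also have "\<dots> = conv S (conv S (star y) (star e)) e \<sigma>"
      by (rule conv_cong) (simp_all add: star_conv star_star that)
    finally show ?thesis by simp
  qed
  have 3: "conv S e (conv S y e) \<sigma> = e \<sigma>" if s: "\<sigma> permutes S" for \<sigma>
  proof -
    let ?se = "star e" and ?sy = "star y"
    have "conv S e (conv S y e) \<sigma> = conv S (conv S (conv S ?sy ?se) e) (conv S y e) \<sigma>"
      by (rule conv_cong) (simp_all add: 2 s)
    also have "\<dots> = conv S (conv S ?sy ?se) (conv S e (conv S y e)) \<sigma>" by (rule conv_assoc[OF s])
    also have "\<dots> = conv S ?sy (conv S ?se (conv S e (conv S y e))) \<sigma>" by (rule conv_assoc[OF s])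
    also have "\<dots> = conv S ?sy (conv S ?se e) \<sigma>"
    proof (rule conv_cong)
      fix \<tau> assume t: "\<tau> permutes S"
      have "conv S ?se (conv S e (conv S y e)) \<tau> = conv S ?se (conv S (conv S e y) e) \<tau>"
        by (rule conv_cong) (simp_all add: conv_assoc t)
      also have "\<dots> = conv S (conv S ?se (conv S e y)) e \<tau>" by (simp add: conv_assoc t)
      also have "\<dots> = conv S ?se e \<tau>" by (rule conv_cong) (simp_all add: 1 t)
      finally show "conv S ?se (conv S e (conv S y e)) \<tau> = conv S ?se e \<tau>" .
    qed (simp_all add: s)
    also have "\<dots> = e \<sigma>" using 2[OF s] by (simp add: conv_assoc s)
    finally show ?thesis .
  qed
  show ?thesis by (rule that) (fact 1 2 3)+
qed

text \<open>A property of functions that holds for the indicators of the elements of \<open>G\<close> and is preserved by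
  linear combinations holds for some function with prescribed values on \<open>G\<close>; the values off \<open>G\<close>
  are not controlled.\<close>

lemma group_algebra_induct:
  assumes "finite G"
    and delta: "\<And>\<sigma>. \<sigma> \<in> G \<Longrightarrow> P (\<lambda>\<tau>. if \<tau> = \<sigma> then 1 else 0 :: rat)"
    and add: "\<And>a b. P a \<Longrightarrow> P b \<Longrightarrow> P (\<lambda>\<tau>. a \<tau> + b \<tau>)"
    and scale: "\<And>r a. P a \<Longrightarrow> P (\<lambda>\<tau>. r * a \<tau>)"
    and ne: "G \<noteq> {}"
  obtains b where "P b" "\<And>\<tau>. \<tau> \<in> G \<Longrightarrow> b \<tau> = a \<tau>"
proof -
  have "\<exists>b. P b \<and> (\<forall>\<tau>. b \<tau> = (if \<tau> \<in> H then a \<tau> else 0))" if "finite H" "H \<subseteq> G" for H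
    using that
  proof (induction H rule: finite_induct)
    case empty
    obtain \<sigma> where "\<sigma> \<in> G" using ne by blast
    from scale[OF delta[OF this], of 0] show ?case by (intro exI[of _ "\<lambda>_. 0"]) simp
  next
    case (insert \<sigma> H)
    then obtain b where b: "P b" "\<And>\<tau>. b \<tau> = (if \<tau> \<in> H then a \<tau> else 0)" by blast
    have "P (\<lambda>\<tau>. b \<tau> + a \<sigma> * (if \<tau> = \<sigma> then 1 else 0))"
      by (rule add[OF b(1) scale[OF delta]]) (use insert.prems in blast)
    then show ?case using insert.hyps(2) by (rule_tac exI, rule_tac conjI) (auto simp: b(2))
  qed
  from this[of G] obtain b where "P b" "\<And>\<tau>. b \<tau> = (if \<tau> \<in> G then a \<tau> else 0)"
    using assms(1) by blast
  then show ?thesis using that[of b] by simp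
qed

text \<open>The transposition of \<open>i\<close> and \<open>i + 1\<close>; these generate the permutations of \<open>{..<n}\<close>.\<close>

abbreviation adj :: "nat \<Rightarrow> nat \<Rightarrow> nat" where
  "adj i \<equiv> Transposition.transpose i (Suc i)"

lemma permutes_adjacent_induct [consumes 1, case_names id adj]:
  assumes p: "p permutes {..<n::nat}"
    and id: "P id"
    and adj: "\<And>i p. Suc i < n \<Longrightarrow> p permutes {..<n} \<Longrightarrow> P p \<Longrightarrow> P (adj i \<circ> p)"
  shows "P p"
proof -
  have adj': "P (apply_adj_transps xs \<circ> p) \<and> apply_adj_transps xs \<circ> p permutes {..<n}"
    if "set xs \<subseteq> {i. Suc i < n}" "P p" "p permutes {..<n}" for xs p
    using that
  proof (induction xs)
    case (Cons i xs)
    then have IH: "P (apply_adj_transps xs \<circ> p)" "apply_adj_transps xs \<circ> p permutes {..<n}" "Suc i < n"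
      using Cons.IH Cons.prems unfolding set_simps insert_subset mem_Collect_eq by blast+
    then have "adj i \<circ> (apply_adj_transps xs \<circ> p) permutes {..<n}"
      by (intro permutes_compose[OF IH(2)] permutes_swap_id) auto
    then show ?case using adj[OF IH(3,2,1)]
      by (simp only: apply_adj_transps_Cons o_assoc Suc_eq_plus1)
  qed simp
  have less: "P (Transposition.transpose a b \<circ> p)" if "a < b" "b < n" "P p" "p permutes {..<n}" for a b p
  proof -
    have "set (adj_transp_seq a b) \<subseteq> {i. Suc i < n}"
      using that(2) by (auto simp: set_adj_transp_seq[OF that(1)])
    from adj'[OF this that(3,4)] show ?thesis unfolding adj_transp_seq_correct[OF that(1)] ..
  qed
  show ?thesis
    using p finite_lessThan
  proof (induction p rule: permutes_induct)
    case (swap a b p)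
    then show ?case
      using less[of a b p] less[of b a p] transpose_commute[of a b]
      by (cases "a < b") (simp_all only: lessThan_iff not_less_iff_gr_or_eq simp_thms)
  qed (rule id)
qed

section \<open>Linear maps and tensor products\<close>

lemma fd_vs: "fd_space V \<Longrightarrow> vectorspace class_ring V"
  by (simp add: fd_space_def)

lemma vs_closed:
  fixes V :: "('k::field, 'u) module"
  assumes "vectorspace class_ring V"
  shows "\<And>v w. v \<in> carrier V \<Longrightarrow> w \<in> carrier V \<Longrightarrow> v \<oplus>\<^bsub>V\<^esub> w \<in> carrier V"
    and "\<And>a v. v \<in> carrier V \<Longrightarrow> a \<odot>\<^bsub>V\<^esub> v \<in> carrier V"
    and "\<zero>\<^bsub>V\<^esub> \<in> carrier V"
proof -
  interpret V: Module.module class_ring V by (rule module_class[OF assms])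
  show "\<And>v w. v \<in> carrier V \<Longrightarrow> w \<in> carrier V \<Longrightarrow> v \<oplus>\<^bsub>V\<^esub> w \<in> carrier V" by simp
  show "\<And>a v. v \<in> carrier V \<Longrightarrow> a \<odot>\<^bsub>V\<^esub> v \<in> carrier V" by (rule V.smult_closed) simp_all
  show "\<zero>\<^bsub>V\<^esub> \<in> carrier V" by simp
qed

lemma vs_ac:
  fixes V :: "('k::field, 'u) module"
  assumes "vectorspace class_ring V"
  shows "\<And>a v w. v \<in> carrier V \<Longrightarrow> w \<in> carrier V \<Longrightarrow>
      a \<odot>\<^bsub>V\<^esub> (v \<oplus>\<^bsub>V\<^esub> w) = a \<odot>\<^bsub>V\<^esub> v \<oplus>\<^bsub>V\<^esub> a \<odot>\<^bsub>V\<^esub> w"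
    and "\<And>a b v. v \<in> carrier V \<Longrightarrow> (a * b) \<odot>\<^bsub>V\<^esub> v = a \<odot>\<^bsub>V\<^esub> (b \<odot>\<^bsub>V\<^esub> v)"
    and "\<And>a b v. v \<in> carrier V \<Longrightarrow> (a + b) \<odot>\<^bsub>V\<^esub> v = a \<odot>\<^bsub>V\<^esub> v \<oplus>\<^bsub>V\<^esub> b \<odot>\<^bsub>V\<^esub> v"
    and "\<And>v. v \<in> carrier V \<Longrightarrow> 1 \<odot>\<^bsub>V\<^esub> v = v"
    and "\<And>v. v \<in> carrier V \<Longrightarrow> 0 \<odot>\<^bsub>V\<^esub> v = \<zero>\<^bsub>V\<^esub>"
    and "\<And>u v w z. u \<in> carrier V \<Longrightarrow> v \<in> carrier V \<Longrightarrow> w \<in> carrier V \<Longrightarrow> z \<in> carrier V \<Longrightarrow>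
      (u \<oplus>\<^bsub>V\<^esub> v) \<oplus>\<^bsub>V\<^esub> (w \<oplus>\<^bsub>V\<^esub> z) = (u \<oplus>\<^bsub>V\<^esub> w) \<oplus>\<^bsub>V\<^esub> (v \<oplus>\<^bsub>V\<^esub> z)"
proof -
  interpret V: Module.module class_ring V by (rule module_class[OF assms])
  show "\<And>a v w. v \<in> carrier V \<Longrightarrow> w \<in> carrier V \<Longrightarrow>
      a \<odot>\<^bsub>V\<^esub> (v \<oplus>\<^bsub>V\<^esub> w) = a \<odot>\<^bsub>V\<^esub> v \<oplus>\<^bsub>V\<^esub> a \<odot>\<^bsub>V\<^esub> w"
    by (rule V.smult_r_distr) simp_all
  show "\<And>a b v. v \<in> carrier V \<Longrightarrow> (a * b) \<odot>\<^bsub>V\<^esub> v = a \<odot>\<^bsub>V\<^esub> (b \<odot>\<^bsub>V\<^esub> v)"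
    using V.smult_assoc1 by simp
  show "\<And>a b v. v \<in> carrier V \<Longrightarrow> (a + b) \<odot>\<^bsub>V\<^esub> v = a \<odot>\<^bsub>V\<^esub> v \<oplus>\<^bsub>V\<^esub> b \<odot>\<^bsub>V\<^esub> v"
    using V.smult_l_distr by simp
  show "\<And>v. v \<in> carrier V \<Longrightarrow> 1 \<odot>\<^bsub>V\<^esub> v = v" using V.smult_one by simp
  show "\<And>v. v \<in> carrier V \<Longrightarrow> 0 \<odot>\<^bsub>V\<^esub> v = \<zero>\<^bsub>V\<^esub>" using V.smult_l_null by simp
  show "\<And>u v w z. u \<in> carrier V \<Longrightarrow> v \<in> carrier V \<Longrightarrow> w \<in> carrier V \<Longrightarrow> z \<in> carrier V \<Longrightarrow>
      (u \<oplus>\<^bsub>V\<^esub> v) \<oplus>\<^bsub>V\<^esub> (w \<oplus>\<^bsub>V\<^esub> z) = (u \<oplus>\<^bsub>V\<^esub> w) \<oplus>\<^bsub>V\<^esub> (v \<oplus>\<^bsub>V\<^esub> z)"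
    by (simp add: V.a_ac)
qed

abbreviation hom_set :: "('k::field, 'u) module \<Rightarrow> ('k, 'w) module \<Rightarrow> ('u \<Rightarrow> 'w) set" where
  "hom_set V W \<equiv> LinearCombinations.module_hom class_ring V W"

lemma lin_maps_hom: "f \<in> lin_maps V W \<Longrightarrow> f \<in> hom_set V W"
  by (simp add: lin_maps_def)

lemma lin_maps_closed: "f \<in> lin_maps V W \<Longrightarrow> v \<in> carrier V \<Longrightarrow> f v \<in> carrier W"
  by (rule module_hom_classD(1)[OF lin_maps_hom])

lemma lin_maps_ext:
  assumes "f \<in> lin_maps V W" "g \<in> lin_maps V W'" "\<And>v. v \<in> carrier V \<Longrightarrow> f v = g v"
  shows "f = g"
  using assms by (intro extensionalityI[of f "carrier V" g]) (auto simp: lin_maps_def)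

lemma hom_set_cong:
  fixes V :: "('k::field, 'u) module" and W :: "('k, 'w) module"
  assumes V: "vectorspace class_ring V" and f: "f \<in> hom_set V W"
    and eq: "\<And>v. v \<in> carrier V \<Longrightarrow> g v = f v"
  shows "g \<in> hom_set V W"
  using module_hom_classD[OF f] vs_closed[OF V] by (intro module_hom_classI) (simp_all add: eq)

lemma restrict_lin_maps:
  assumes "vectorspace class_ring V" "f \<in> hom_set V W"
  shows "restrict f (carrier V) \<in> lin_maps V W"
  unfolding lin_maps_def by (intro IntI hom_set_cong[OF assms]) simp_all

lemma id_hom: "(\<lambda>v. v) \<in> hom_set V V"
  by (rule module_hom_classI) simp_all

lemma lin_maps_id: "vectorspace class_ring V \<Longrightarrow> (\<lambda>v\<in>carrier V. v) \<in> lin_maps V V"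
  by (rule restrict_lin_maps[OF _ id_hom])

lemma lin_maps_compose:
  assumes "vectorspace class_ring U" "f \<in> lin_maps U V" "g \<in> lin_maps V W"
  shows "compose (carrier U) g f \<in> lin_maps U W"
  unfolding compose_def
  by (rule restrict_lin_maps[OF assms(1) module_hom_comp[OF assms(2,3)[THEN lin_maps_hom]]])

lemma hom_set_add:
  fixes V :: "('k::field, 'u) module" and W :: "('k, 'w) module"
  assumes W: "vectorspace class_ring W" and f: "f \<in> hom_set V W" and g: "g \<in> hom_set V W"
  shows "(\<lambda>v. f v \<oplus>\<^bsub>W\<^esub> g v) \<in> hom_set V W"
proof (rule module_hom_classI)
  fix v w assume v: "v \<in> carrier V" and w: "w \<in> carrier V"
  note fg = module_hom_classD[OF f] module_hom_classD[OF g]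
  show "f v \<oplus>\<^bsub>W\<^esub> g v \<in> carrier W" using v by (intro vs_closed(1)[OF W] fg(1,4))
  show "f (v \<oplus>\<^bsub>V\<^esub> w) \<oplus>\<^bsub>W\<^esub> g (v \<oplus>\<^bsub>V\<^esub> w) = f v \<oplus>\<^bsub>W\<^esub> g v \<oplus>\<^bsub>W\<^esub> (f w \<oplus>\<^bsub>W\<^esub> g w)"
    unfolding fg(2)[OF v w] fg(5)[OF v w] using v w by (intro vs_ac(6)[OF W] fg(1,4))
  show "f (a \<odot>\<^bsub>V\<^esub> v) \<oplus>\<^bsub>W\<^esub> g (a \<odot>\<^bsub>V\<^esub> v) = a \<odot>\<^bsub>W\<^esub> (f v \<oplus>\<^bsub>W\<^esub> g v)" for a
    unfolding fg(3)[OF v] fg(6)[OF v] using v by (intro vs_ac(1)[OF W, symmetric] fg(1,4))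
qed

lemma hom_set_scale:
  fixes V :: "('k::field, 'u) module" and W :: "('k, 'w) module"
  assumes W: "vectorspace class_ring W" and f: "f \<in> hom_set V W"
  shows "(\<lambda>v. a \<odot>\<^bsub>W\<^esub> f v) \<in> hom_set V W"
proof (rule module_hom_classI)
  fix v w assume v: "v \<in> carrier V" and w: "w \<in> carrier V"
  note f = module_hom_classD[OF f]
  show "a \<odot>\<^bsub>W\<^esub> f v \<in> carrier W" using v by (intro vs_closed(2)[OF W] f(1))
  show "a \<odot>\<^bsub>W\<^esub> f (v \<oplus>\<^bsub>V\<^esub> w) = a \<odot>\<^bsub>W\<^esub> f v \<oplus>\<^bsub>W\<^esub> a \<odot>\<^bsub>W\<^esub> f w"
    unfolding f(2)[OF v w] using v w by (intro vs_ac(1)[OF W] f(1))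
  show "a \<odot>\<^bsub>W\<^esub> f (b \<odot>\<^bsub>V\<^esub> v) = b \<odot>\<^bsub>W\<^esub> (a \<odot>\<^bsub>W\<^esub> f v)" for b
    unfolding f(3)[OF v] using vs_ac(2)[OF W f(1)[OF v]] mult.commute[of a b] by metis
qed

text \<open>Identities between vectors, in particular between finite sums, are reduced to identities in the
  field by evaluating all linear functionals.\<close>

definition functional :: "('k::field, 'u) module \<Rightarrow> ('u \<Rightarrow> 'k) \<Rightarrow> bool" where
  "functional V \<phi> \<longleftrightarrow>
     (\<forall>v\<in>carrier V. \<forall>w\<in>carrier V. \<phi> (v \<oplus>\<^bsub>V\<^esub> w) = \<phi> v + \<phi> w) \<and>
     (\<forall>a. \<forall>v\<in>carrier V. \<phi> (a \<odot>\<^bsub>V\<^esub> v) = a * \<phi> v)"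

lemma functionalD:
  assumes "functional V \<phi>"
  shows "\<And>v w. v \<in> carrier V \<Longrightarrow> w \<in> carrier V \<Longrightarrow> \<phi> (v \<oplus>\<^bsub>V\<^esub> w) = \<phi> v + \<phi> w"
    and "\<And>a v. v \<in> carrier V \<Longrightarrow> \<phi> (a \<odot>\<^bsub>V\<^esub> v) = a * \<phi> v"
  using assms by (auto simp: functional_def)

lemma functional_comp:
  fixes V :: "('k::field, 'u) module" and W :: "('k, 'w) module"
  assumes "f \<in> hom_set V W" "functional W \<phi>"
  shows "functional V (\<lambda>v. \<phi> (f v))"
  using module_hom_classD[OF assms(1)] functionalD[OF assms(2)] by (simp add: functional_def)

lemma functionals_separate:
  fixes V :: "('k::field, 'u) module"
  assumes V: "fd_space V" and v: "v \<in> carrier V" and w: "w \<in> carrier V"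
    and eq: "\<And>\<phi>. functional V \<phi> \<Longrightarrow> \<phi> v = \<phi> w"
  shows "v = w"
proof -
  obtain n b t where b: "b \<in> {..<n} \<rightarrow> carrier V"
    and t: "t \<in> hom_set V (coord_space n)"
    and gen: "\<And>v. v \<in> carrier V \<Longrightarrow> v = (\<Oplus>\<^bsub>V\<^esub>i\<in>{..<n}. t v i \<odot>\<^bsub>V\<^esub> b i)"
    by (rule fd_space_coordinates[OF V]) blast
  have "functional V (\<lambda>v. t v i)" for i
    using module_hom_classD(2,3)[OF t] by (simp add: functional_def)
  then have "t v = t w" using eq by blast
  then show ?thesis using gen[OF v] gen[OF w] by simp
qed

lemma finsum_closed_vs:
  fixes V :: "('k::field, 'u) module"
  assumes "vectorspace class_ring V" "\<And>i. i \<in> A \<Longrightarrow> f i \<in> carrier V"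
  shows "(\<Oplus>\<^bsub>V\<^esub>i\<in>A. f i) \<in> carrier V"
proof -
  interpret V: Module.module class_ring V by (rule module_class[OF assms(1)])
  show ?thesis using assms(2) by (intro V.finsum_closed) auto
qed

lemma functional_finsum:
  fixes V :: "('k::field, 'u) module"
  assumes V: "vectorspace class_ring V" and \<phi>: "functional V \<phi>" and "finite A"
    and f: "\<And>i. i \<in> A \<Longrightarrow> f i \<in> carrier V"
  shows "\<phi> (\<Oplus>\<^bsub>V\<^esub>i\<in>A. f i) = (\<Sum>i\<in>A. \<phi> (f i))"
  using assms(3) f
proof (induction A rule: finite_induct)
  case empty
  interpret V: Module.module class_ring V by (rule module_class[OF V])
  have "\<phi> \<zero>\<^bsub>V\<^esub> = \<phi> (0 \<odot>\<^bsub>V\<^esub> \<zero>\<^bsub>V\<^esub>)" by (simp add: vs_ac(5)[OF V])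
  also have "\<dots> = 0" using functionalD(2)[OF \<phi>, of "\<zero>\<^bsub>V\<^esub>" 0] by simp
  finally show ?case by simp
next
  case (insert i A)
  interpret V: Module.module class_ring V by (rule module_class[OF V])
  have "(\<Oplus>\<^bsub>V\<^esub>i\<in>insert i A. f i) = f i \<oplus>\<^bsub>V\<^esub> (\<Oplus>\<^bsub>V\<^esub>i\<in>A. f i)"
    using insert by (intro V.finsum_insert) auto
  then show ?case
    using insert functionalD(1)[OF \<phi>, of "f i" "\<Oplus>\<^bsub>V\<^esub>i\<in>A. f i"] finsum_closed_vs[OF V, of A f] by simp
qed

lemma bilinear_mapI:
  assumes "\<And>v. v \<in> carrier V \<Longrightarrow> b v \<in> hom_set W X"
    and "\<And>w. w \<in> carrier W \<Longrightarrow> (\<lambda>v. b v w) \<in> hom_set V X"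
  shows "bilinear_map V W X b"
  using assms by (simp add: bilinear_map_def)

context tensor_choice
begin

lemma vs_tspace: "fd_space V \<Longrightarrow> fd_space W \<Longrightarrow> vectorspace class_ring (tspace T V W)"
  by (intro fd_vs fd_tspace)

lemma tvec_hom_right:
  "fd_space V \<Longrightarrow> fd_space W \<Longrightarrow> v \<in> carrier V \<Longrightarrow> tvec T V W v \<in> hom_set W (tspace T V W)"
  using tensor by (simp add: is_tensor_product_def bilinear_map_def)

lemma tvec_hom_left:
  "fd_space V \<Longrightarrow> fd_space W \<Longrightarrow> w \<in> carrier W \<Longrightarrow>
    (\<lambda>v. tvec T V W v w) \<in> hom_set V (tspace T V W)"
  using tensor by (simp add: is_tensor_product_def bilinear_map_def)

lemma tvec_closed:
  "fd_space V \<Longrightarrow> fd_space W \<Longrightarrow> v \<in> carrier V \<Longrightarrow> w \<in> carrier W \<Longrightarrow>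
    tvec T V W v w \<in> carrier (tspace T V W)"
  by (rule module_hom_classD(1)[OF tvec_hom_right])

lemma tensor_lift:
  assumes "fd_space V" "fd_space W" "vectorspace class_ring X" "bilinear_map V W X b"
  obtains h where "h \<in> lin_maps (tspace T V W) X"
    "\<And>v w. v \<in> carrier V \<Longrightarrow> w \<in> carrier W \<Longrightarrow> h (tvec T V W v w) = b v w"
proof -
  have "\<exists>!h. h \<in> lin_maps (tspace T V W) X \<and>
      (\<forall>v\<in>carrier V. \<forall>w\<in>carrier W. h (tvec T V W v w) = b v w)"
    using tensor[OF assms(1,2)] assms(3,4) unfolding is_tensor_product_def by blast
  then show ?thesis using that by blast
qed

text \<open>Linear maps on a tensor product are determined by their values on the vectors \<open>v \<otimes> w\<close>.\<close>

lemma tensor_ext: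
  fixes X :: "('k, 'u) module"
  assumes V: "fd_space V" and W: "fd_space W" and X: "vectorspace class_ring X"
    and f: "f \<in> hom_set (tspace T V W) X" and g: "g \<in> hom_set (tspace T V W) X"
    and eq: "\<And>v w. v \<in> carrier V \<Longrightarrow> w \<in> carrier W \<Longrightarrow> f (tvec T V W v w) = g (tvec T V W v w)"
    and t: "t \<in> carrier (tspace T V W)"
  shows "f t = g t"
proof -
  let ?P = "tspace T V W"
  have "bilinear_map V W X (\<lambda>v w. f (tvec T V W v w))"
    by (rule bilinear_mapI)
      (rule module_hom_comp[OF tvec_hom_right[OF V W] f], assumption,
       rule module_hom_comp[OF tvec_hom_left[OF V W] f], assumption)
  then have ex1: "\<exists>!h. h \<in> lin_maps ?P X \<and>
      (\<forall>v\<in>carrier V. \<forall>w\<in>carrier W. h (tvec T V W v w) = f (tvec T V W v w))"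
    using tensor[OF V W] X unfolding is_tensor_product_def by blast
  have "restrict f (carrier ?P) = restrict g (carrier ?P)"
    using ex1 restrict_lin_maps[OF vs_tspace[OF V W] f] restrict_lin_maps[OF vs_tspace[OF V W] g]
      eq tvec_closed[OF V W] by (elim ex1E) (metis (no_types, lifting) restrict_apply')
  then show ?thesis using t by (metis restrict_apply')
qed

lemma tensor_map_spec:
  assumes "fd_space V" "fd_space W" "fd_space V'" "fd_space W'"
    and f: "f \<in> lin_maps V V'" and g: "g \<in> lin_maps W W'"
  shows "tensor_map T V W V' W' f g \<in> lin_maps (tspace T V W) (tspace T V' W')"
    and "v \<in> carrier V \<Longrightarrow> w \<in> carrier W \<Longrightarrow>
      tensor_map T V W V' W' f g (tvec T V W v w) = tvec T V' W' (f v) (g w)"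
proof -
  have "bilinear_map V W (tspace T V' W') (\<lambda>v w. tvec T V' W' (f v) (g w))"
    using lin_maps_closed[OF f] lin_maps_closed[OF g]
    by (intro bilinear_mapI
        module_hom_comp[OF lin_maps_hom[OF g] tvec_hom_right[OF assms(3,4)]]
        module_hom_comp[OF lin_maps_hom[OF f] tvec_hom_left[OF assms(3,4)]])
  then have "\<exists>!h. h \<in> lin_maps (tspace T V W) (tspace T V' W') \<and>
      (\<forall>v\<in>carrier V. \<forall>w\<in>carrier W. h (tvec T V W v w) = tvec T V' W' (f v) (g w))"
    using tensor[OF assms(1,2)] vs_tspace[OF assms(3,4)] unfolding is_tensor_product_def by blast
  from theI'[OF this, folded tensor_map_def]
  show "tensor_map T V W V' W' f g \<in> lin_maps (tspace T V W) (tspace T V' W')"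
    and "v \<in> carrier V \<Longrightarrow> w \<in> carrier W \<Longrightarrow>
      tensor_map T V W V' W' f g (tvec T V W v w) = tvec T V' W' (f v) (g w)"
    by blast+
qed

lemma tensor_map_id:
  assumes V: "fd_space V" and W: "fd_space W"
  shows "tensor_map T V W V W (\<lambda>v\<in>carrier V. v) (\<lambda>w\<in>carrier W. w) = (\<lambda>t\<in>carrier (tspace T V W). t)"
proof (rule lin_maps_ext[OF tensor_map_spec(1)[OF V W V W] lin_maps_id])
  fix t assume t: "t \<in> carrier (tspace T V W)"
  show "tensor_map T V W V W (\<lambda>v\<in>carrier V. v) (\<lambda>w\<in>carrier W. w) t = (\<lambda>t\<in>carrier (tspace T V W). t) t"
    using lin_maps_id[OF fd_vs[OF V]] lin_maps_id[OF fd_vs[OF W]]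
    by (intro tensor_ext[OF V W vs_tspace[OF V W] lin_maps_hom[OF tensor_map_spec(1)[OF V W V W]]
          lin_maps_hom[OF lin_maps_id[OF vs_tspace[OF V W]]] _ t])
      (simp_all only: tensor_map_spec(2)[OF V W V W] restrict_apply' tvec_closed[OF V W])
qed (rule lin_maps_id fd_vs V W vs_tspace)+

lemma tensor_map_comp:
  assumes V: "fd_space V" "fd_space W" "fd_space V'" "fd_space W'" "fd_space V''" "fd_space W''"
    and f: "f \<in> lin_maps V V'" and g: "g \<in> lin_maps W W'"
    and f': "f' \<in> lin_maps V' V''" and g': "g' \<in> lin_maps W' W''"
  shows "compose (carrier (tspace T V W)) (tensor_map T V' W' V'' W'' f' g') (tensor_map T V W V' W' f g)
    = tensor_map T V W V'' W'' (compose (carrier V) f' f) (compose (carrier W) g' g)"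
    (is "?l = ?r")
proof -
  note ff = lin_maps_compose[OF fd_vs[OF V(1)] f f'] and gg = lin_maps_compose[OF fd_vs[OF V(2)] g g']
  have l: "?l \<in> lin_maps (tspace T V W) (tspace T V'' W'')"
    by (rule lin_maps_compose[OF vs_tspace[OF V(1,2)] tensor_map_spec(1) tensor_map_spec(1)])
      (simp_all add: assms)
  have r: "?r \<in> lin_maps (tspace T V W) (tspace T V'' W'')"
    by (rule tensor_map_spec(1)[OF V(1,2,5,6) ff gg])
  show ?thesis
  proof (rule lin_maps_ext[OF l r])
    fix t assume t: "t \<in> carrier (tspace T V W)"
    show "?l t = ?r t"
      by (rule tensor_ext[OF V(1,2) vs_tspace[OF V(5,6)] lin_maps_hom[OF l] lin_maps_hom[OF r] _ t])
        (simp add: compose_eq tvec_closed V tensor_map_spec(2)[OF V(1,2,3,4) f g]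
          tensor_map_spec(2)[OF V(3,4,5,6) f' g'] tensor_map_spec(2)[OF V(1,2,5,6) ff gg]
          lin_maps_closed[OF f] lin_maps_closed[OF g])
  qed
qed

lemma tensor_ext_left:
  fixes X :: "('k, 'u) module"
  assumes U: "fd_space U" and V: "fd_space V" and W: "fd_space W" and X: "vectorspace class_ring X"
    and f: "f \<in> hom_set (tspace T (tspace T U V) W) X"
    and g: "g \<in> hom_set (tspace T (tspace T U V) W) X"
    and eq: "\<And>u v w. u \<in> carrier U \<Longrightarrow> v \<in> carrier V \<Longrightarrow> w \<in> carrier W \<Longrightarrow>
      f (tvec T (tspace T U V) W (tvec T U V u v) w) = g (tvec T (tspace T U V) W (tvec T U V u v) w)"
    and t: "t \<in> carrier (tspace T (tspace T U V) W)"
  shows "f t = g t"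
proof (rule tensor_ext[OF fd_tspace[OF U V] W X f g _ t])
  fix s w assume s: "s \<in> carrier (tspace T U V)" and w: "w \<in> carrier W"
  note h = tvec_hom_left[OF fd_tspace[OF U V] W w]
  show "f (tvec T (tspace T U V) W s w) = g (tvec T (tspace T U V) W s w)"
    by (rule tensor_ext[OF U V X module_hom_comp[OF h f] module_hom_comp[OF h g] _ s])
      (rule eq[OF _ _ w])
qed

lemma tensor_ext_right:
  fixes X :: "('k, 'u) module"
  assumes U: "fd_space U" and V: "fd_space V" and W: "fd_space W" and X: "vectorspace class_ring X"
    and f: "f \<in> hom_set (tspace T U (tspace T V W)) X"
    and g: "g \<in> hom_set (tspace T U (tspace T V W)) X"
    and eq: "\<And>u v w. u \<in> carrier U \<Longrightarrow> v \<in> carrier V \<Longrightarrow> w \<in> carrier W \<Longrightarrow>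
      f (tvec T U (tspace T V W) u (tvec T V W v w)) = g (tvec T U (tspace T V W) u (tvec T V W v w))"
    and t: "t \<in> carrier (tspace T U (tspace T V W))"
  shows "f t = g t"
proof (rule tensor_ext[OF U fd_tspace[OF V W] X f g _ t])
  fix u s assume u: "u \<in> carrier U" and s: "s \<in> carrier (tspace T V W)"
  note h = tvec_hom_right[OF U fd_tspace[OF V W] u]
  show "f (tvec T U (tspace T V W) u s) = g (tvec T U (tspace T V W) u s)"
    by (rule tensor_ext[OF V W X module_hom_comp[OF h f] module_hom_comp[OF h g] _ s])
      (rule eq[OF u])
qed

lemma assoc_spec:
  assumes U: "fd_space U" and V: "fd_space V" and W: "fd_space W"
  shows "assoc_map T U V W \<in> lin_maps (tspace T U (tspace T V W)) (tspace T (tspace T U V) W)"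
    and "u \<in> carrier U \<Longrightarrow> v \<in> carrier V \<Longrightarrow> w \<in> carrier W \<Longrightarrow>
      assoc_map T U V W (tvec T U (tspace T V W) u (tvec T V W v w)) =
      tvec T (tspace T U V) W (tvec T U V u v) w"
proof -
  note UV = fd_tspace[OF U V] and VW = fd_tspace[OF V W]
  let ?X = "tspace T (tspace T U V) W"
  let ?b = "\<lambda>u v w. tvec T (tspace T U V) W (tvec T U V u v) w"
  note X = vs_tspace[OF UV W]
  have "bilinear_map V W ?X (?b u)" if u: "u \<in> carrier U" for u
    by (rule bilinear_mapI)
      (rule tvec_hom_right[OF UV W tvec_closed[OF U V u]], assumption,
       rule module_hom_comp[OF tvec_hom_right[OF U V u] tvec_hom_left[OF UV W]], assumption)
  then have "\<exists>h. h \<in> lin_maps (tspace T V W) ?X \<and>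
      (\<forall>v\<in>carrier V. \<forall>w\<in>carrier W. h (tvec T V W v w) = ?b u v w)" if "u \<in> carrier U" for u
    using that tensor_lift[OF V W X] by metis
  then obtain h where h: "\<And>u. u \<in> carrier U \<Longrightarrow> h u \<in> lin_maps (tspace T V W) ?X"
    and hb: "\<And>u v w. u \<in> carrier U \<Longrightarrow> v \<in> carrier V \<Longrightarrow> w \<in> carrier W \<Longrightarrow>
      h u (tvec T V W v w) = ?b u v w"
    by metis
  have b2: "(\<lambda>u. ?b u v w) \<in> hom_set U ?X" if "v \<in> carrier V" "w \<in> carrier W" for v w
    by (rule module_hom_comp[OF tvec_hom_left[OF U V] tvec_hom_left[OF UV W]]) fact+
  note hl = h[THEN lin_maps_hom]
  have "bilinear_map U (tspace T V W) ?X h"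
  proof (rule bilinear_mapI[OF hl module_hom_classI])
    fix s assume s: "s \<in> carrier (tspace T V W)"
    fix u assume u: "u \<in> carrier U"
    show "h u s \<in> carrier ?X" using lin_maps_closed[OF h[OF u] s] .
    show "h (a \<odot>\<^bsub>U\<^esub> u) s = a \<odot>\<^bsub>?X\<^esub> h u s" for a
    proof (rule tensor_ext[OF V W X hl[OF vs_closed(2)[OF fd_vs[OF U] u]] hom_set_scale[OF X hl[OF u]] _ s])
      fix v w assume vw: "v \<in> carrier V" "w \<in> carrier W"
      show "h (a \<odot>\<^bsub>U\<^esub> u) (tvec T V W v w) = a \<odot>\<^bsub>?X\<^esub> h u (tvec T V W v w)"
        using module_hom_classD(3)[OF b2[OF vw] u] by (simp add: hb u vw vs_closed[OF fd_vs[OF U]])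
    qed
    fix u' assume u': "u' \<in> carrier U"
    show "h (u \<oplus>\<^bsub>U\<^esub> u') s = h u s \<oplus>\<^bsub>?X\<^esub> h u' s"
    proof (rule tensor_ext[OF V W X hl[OF vs_closed(1)[OF fd_vs[OF U] u u']]
          hom_set_add[OF X hl[OF u] hl[OF u']] _ s])
      fix v w assume vw: "v \<in> carrier V" "w \<in> carrier W"
      show "h (u \<oplus>\<^bsub>U\<^esub> u') (tvec T V W v w) = h u (tvec T V W v w) \<oplus>\<^bsub>?X\<^esub> h u' (tvec T V W v w)"
        using module_hom_classD(2)[OF b2[OF vw] u u'] by (simp add: hb u u' vw vs_closed[OF fd_vs[OF U]])
    qed
  qed
  then obtain k where k: "k \<in> lin_maps (tspace T U (tspace T V W)) ?X"
    and kh: "\<And>u s. u \<in> carrier U \<Longrightarrow> s \<in> carrier (tspace T V W) \<Longrightarrow>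
      k (tvec T U (tspace T V W) u s) = h u s"
    using tensor_lift[OF U VW X] by blast
  have kb: "k (tvec T U (tspace T V W) u (tvec T V W v w)) = ?b u v w"
    if "u \<in> carrier U" "v \<in> carrier V" "w \<in> carrier W" for u v w
    using that by (simp add: kh hb tvec_closed V W)
  have "k' = k" if k': "k' \<in> lin_maps (tspace T U (tspace T V W)) ?X"
    "\<forall>u\<in>carrier U. \<forall>v\<in>carrier V. \<forall>w\<in>carrier W.
      k' (tvec T U (tspace T V W) u (tvec T V W v w)) = ?b u v w" for k'
    by (rule lin_maps_ext[OF k'(1) k], rule tensor_ext_right[OF U V W X lin_maps_hom[OF k'(1)] lin_maps_hom[OF k]])
      (use k'(2) kb in auto)
  then have "\<exists>!k. k \<in> lin_maps (tspace T U (tspace T V W)) ?X \<and>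
      (\<forall>u\<in>carrier U. \<forall>v\<in>carrier V. \<forall>w\<in>carrier W.
        k (tvec T U (tspace T V W) u (tvec T V W v w)) = ?b u v w)"
    using k kb by blast
  from theI'[OF this, folded assoc_map_def]
  show "assoc_map T U V W \<in> lin_maps (tspace T U (tspace T V W)) ?X"
    and "u \<in> carrier U \<Longrightarrow> v \<in> carrier V \<Longrightarrow> w \<in> carrier W \<Longrightarrow>
      assoc_map T U V W (tvec T U (tspace T V W) u (tvec T V W v w)) = ?b u v w"
    by blast+
qed

lemma braid_spec:
  assumes V: "fd_space V" and W: "fd_space W"
  shows "braid_map T V W \<in> lin_maps (tspace T V W) (tspace T W V)"
    and "v \<in> carrier V \<Longrightarrow> w \<in> carrier W \<Longrightarrow> braid_map T V W (tvec T V W v w) = tvec T W V w v"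
proof -
  have "bilinear_map V W (tspace T W V) (\<lambda>v w. tvec T W V w v)"
    by (rule bilinear_mapI)
      (rule tvec_hom_left[OF W V], assumption, rule tvec_hom_right[OF W V], assumption)
  then have "\<exists>!h. h \<in> lin_maps (tspace T V W) (tspace T W V) \<and>
      (\<forall>v\<in>carrier V. \<forall>w\<in>carrier W. h (tvec T V W v w) = tvec T W V w v)"
    using tensor[OF V W] vs_tspace[OF W V] unfolding is_tensor_product_def by blast
  from theI'[OF this, folded braid_map_def]
  show "braid_map T V W \<in> lin_maps (tspace T V W) (tspace T W V)"
    and "v \<in> carrier V \<Longrightarrow> w \<in> carrier W \<Longrightarrow> braid_map T V W (tvec T V W v w) = tvec T W V w v"
    by blast+
qed

lemma braid_braid:
  assumes V: "fd_space V" and W: "fd_space W" and t: "t \<in> carrier (tspace T V W)"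
  shows "braid_map T W V (braid_map T V W t) = t"
proof (rule tensor_ext[OF V W vs_tspace[OF V W] _ _ _ t])
  show "(\<lambda>t. braid_map T W V (braid_map T V W t)) \<in> hom_set (tspace T V W) (tspace T V W)"
    by (rule module_hom_comp[OF lin_maps_hom[OF braid_spec(1)[OF V W]] lin_maps_hom[OF braid_spec(1)[OF W V]]])
  show "(\<lambda>t. t) \<in> hom_set (tspace T V W) (tspace T V W)"
    by (rule id_hom)
qed (simp add: V W braid_spec(2))

lemma assoc_map_natural:
  assumes U: "fd_space U" "fd_space U'" and V: "fd_space V" "fd_space V'"
    and W: "fd_space W" "fd_space W'"
    and f: "f \<in> lin_maps U U'" and g: "g \<in> lin_maps V V'" and h: "h \<in> lin_maps W W'"
    and t: "t \<in> carrier (tspace T U (tspace T V W))"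
  shows "assoc_map T U' V' W' (tensor_map T U (tspace T V W) U' (tspace T V' W') f
      (tensor_map T V W V' W' g h) t) =
    tensor_map T (tspace T U V) W (tspace T U' V') W' (tensor_map T U V U' V' f g) h (assoc_map T U V W t)"
proof -
  note VW = fd_tspace[OF V(1) W(1)] and UV = fd_tspace[OF U(1) V(1)]
    and VW' = fd_tspace[OF V(2) W(2)] and UV' = fd_tspace[OF U(2) V(2)]
  note gh = tensor_map_spec[OF V(1) W(1) V(2) W(2) g h] and fg = tensor_map_spec[OF U(1) V(1) U(2) V(2) f g]
  note f_gh = tensor_map_spec[OF U(1) VW U(2) VW' f gh(1)]
  note fg_h = tensor_map_spec[OF UV W(1) UV' W(2) fg(1) h]
  note a = assoc_spec[OF U(1) V(1) W(1)] and a' = assoc_spec[OF U(2) V(2) W(2)]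
  show ?thesis
    by (rule tensor_ext_right[OF U(1) V(1) W(1) vs_tspace[OF UV' W(2)]
          module_hom_comp[OF f_gh(1)[THEN lin_maps_hom] a'(1)[THEN lin_maps_hom]]
          module_hom_comp[OF a(1)[THEN lin_maps_hom] fg_h(1)[THEN lin_maps_hom]] _ t])
      (simp add: f_gh(2) gh(2) fg_h(2) fg(2) a(2) a'(2) tvec_closed U V W
        lin_maps_closed[OF f] lin_maps_closed[OF g] lin_maps_closed[OF h])
qed

lemma braid_map_natural:
  assumes V: "fd_space V" "fd_space V'" and W: "fd_space W" "fd_space W'"
    and g: "g \<in> lin_maps V V'" and h: "h \<in> lin_maps W W'"
    and t: "t \<in> carrier (tspace T V W)"
  shows "braid_map T V' W' (tensor_map T V W V' W' g h t) = tensor_map T W V W' V' h g (braid_map T V W t)"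
proof -
  note gh = tensor_map_spec[OF V(1) W(1) V(2) W(2) g h] and hg = tensor_map_spec[OF W(1) V(1) W(2) V(2) h g]
  show ?thesis
    by (rule tensor_ext[OF V(1) W(1) vs_tspace[OF W(2) V(2)]
          module_hom_comp[OF gh(1)[THEN lin_maps_hom] lin_maps_hom[OF braid_spec(1)[OF V(2) W(2)]]]
          module_hom_comp[OF lin_maps_hom[OF braid_spec(1)[OF V(1) W(1)]] hg(1)[THEN lin_maps_hom]] _ t])
      (simp add: gh(2) hg(2) braid_spec(2) V W lin_maps_closed[OF g] lin_maps_closed[OF h])
qed

end

section \<open>Tensor powers and the group algebra action\<close>

context tensor_choice
begin

text \<open>The associativity isomorphism is invertible; its inverse is a composite of further associativity
  and commutativity isomorphisms.\<close>

lemma assoc_inverse: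
  assumes U: "fd_space U" and V: "fd_space V" and W: "fd_space W"
  obtains k where "k \<in> lin_maps (tspace T (tspace T U V) W) (tspace T U (tspace T V W))"
    "\<And>u v w. u \<in> carrier U \<Longrightarrow> v \<in> carrier V \<Longrightarrow> w \<in> carrier W \<Longrightarrow>
      k (tvec T (tspace T U V) W (tvec T U V u v) w) = tvec T U (tspace T V W) u (tvec T V W v w)"
    "\<And>t. t \<in> carrier (tspace T U (tspace T V W)) \<Longrightarrow> k (assoc_map T U V W t) = t"
    "\<And>t. t \<in> carrier (tspace T (tspace T U V) W) \<Longrightarrow> assoc_map T U V W (k t) = t"
proof -
  note UV = fd_tspace[OF U V] and VW = fd_tspace[OF V W] and WU = fd_tspace[OF W U]
  \<comment> \<open>\<open>(U \<otimes> V) \<otimes> W \<rightarrow> W \<otimes> (U \<otimes> V) \<rightarrow> (W \<otimes> U) \<otimes> V \<rightarrow> V \<otimes> (W \<otimes> U) \<rightarrow> (V \<otimes> W) \<otimes> U \<rightarrow> U \<otimes> (V \<otimes> W)\<close>\<close>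
  define k0 where "k0 t = braid_map T (tspace T V W) U (assoc_map T V W U
    (braid_map T (tspace T W U) V (assoc_map T W U V (braid_map T (tspace T U V) W t))))" for t
  define k where "k = restrict k0 (carrier (tspace T (tspace T U V) W))"
  have k0: "k0 \<in> hom_set (tspace T (tspace T U V) W) (tspace T U (tspace T V W))"
    unfolding k0_def
    by (rule module_hom_comp[OF _ lin_maps_hom[OF braid_spec(1)[OF VW U]]],
        rule module_hom_comp[OF _ lin_maps_hom[OF assoc_spec(1)[OF V W U]]],
        rule module_hom_comp[OF _ lin_maps_hom[OF braid_spec(1)[OF WU V]]],
        rule module_hom_comp[OF _ lin_maps_hom[OF assoc_spec(1)[OF W U V]]],
        rule lin_maps_hom[OF braid_spec(1)[OF UV W]])
  have k: "k \<in> lin_maps (tspace T (tspace T U V) W) (tspace T U (tspace T V W))"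
    unfolding k_def by (rule restrict_lin_maps[OF vs_tspace[OF UV W] k0])
  have kt: "k (tvec T (tspace T U V) W (tvec T U V u v) w) = tvec T U (tspace T V W) u (tvec T V W v w)"
    if "u \<in> carrier U" "v \<in> carrier V" "w \<in> carrier W" for u v w
    using that unfolding k_def
    by (simp add: tvec_closed UV VW WU U V W k0_def braid_spec(2) assoc_spec(2))
  note a = assoc_spec(1)[OF U V W]
  show ?thesis
  proof (rule that[OF k kt])
    fix t assume t: "t \<in> carrier (tspace T U (tspace T V W))"
    show "k (assoc_map T U V W t) = t"
      by (rule tensor_ext_right[OF U V W vs_tspace[OF U VW]
            module_hom_comp[OF lin_maps_hom[OF a] lin_maps_hom[OF k]] _ _ t])
        (simp_all add: assoc_spec(2) U V W kt id_hom)
  next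
    fix t assume t: "t \<in> carrier (tspace T (tspace T U V) W)"
    show "assoc_map T U V W (k t) = t"
      by (rule tensor_ext_left[OF U V W vs_tspace[OF UV W]
            module_hom_comp[OF lin_maps_hom[OF k] lin_maps_hom[OF a]] _ _ t])
        (simp_all add: assoc_spec(2) U V W kt id_hom)
  qed
qed

lemma scal_span: "t \<in> carrier (line T) \<longleftrightarrow> (\<exists>a. t = a \<odot>\<^bsub>line T\<^esub> scal T 1)"
proof -
  have "carrier (line T) = range (scal T)" using scal_bij by (simp add: bij_betw_def)
  moreover have "scal T a = a \<odot>\<^bsub>line T\<^esub> scal T 1" for a using scal_mult[of a 1] by (simp only: mult_1_right)
  ultimately show ?thesis by (metis rangeE rangeI)
qed

lemma fd_tpow: "fd_space U \<Longrightarrow> fd_space (tpow T U n)"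
  by (induction n) (simp_all add: fd_line fd_tspace)

lemma vs_tpow: "fd_space U \<Longrightarrow> vectorspace class_ring (tpow T U n)"
  by (intro fd_vs fd_tpow)

lemma pure_tensor_closed:
  "fd_space U \<Longrightarrow> us \<in> {..<n} \<rightarrow> carrier U \<Longrightarrow> pure_tensor T U n us \<in> carrier (tpow T U n)"
proof (induction n)
  case 0
  then show ?case using scal_bij by (auto simp: bij_betw_def)
next
  case (Suc n)
  then have "us \<in> {..<n} \<rightarrow> carrier U" "us n \<in> carrier U" by auto
  then show ?case using Suc by (simp add: tvec_closed fd_tpow)
qed

lemma pure_tensor_cong:
  "(\<And>i. i < n \<Longrightarrow> us i = vs i) \<Longrightarrow> pure_tensor T U n us = pure_tensor T U n vs"
  by (induction n) simp_all

text \<open>Linear maps on a tensor power are determined by their values on pure tensors.\<close>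

lemma tpow_ext:
  fixes X :: "('k, 'u) module"
  assumes U: "fd_space U" and X: "vectorspace class_ring X"
    and "f \<in> hom_set (tpow T U n) X" "g \<in> hom_set (tpow T U n) X"
    and "\<And>us. us \<in> {..<n} \<rightarrow> carrier U \<Longrightarrow> f (pure_tensor T U n us) = g (pure_tensor T U n us)"
    and "t \<in> carrier (tpow T U n)"
  shows "f t = g t"
  using assms(3-)
proof (induction n arbitrary: f g t)
  case 0
  have s: "scal T 1 \<in> carrier (line T)" using scal_bij by (auto simp: bij_betw_def)
  obtain a where "t = a \<odot>\<^bsub>line T\<^esub> scal T 1" using 0(4) scal_span by auto
  then show ?case
    using module_hom_classD(3)[OF 0(1), of "scal T 1" a] module_hom_classD(3)[OF 0(2), of "scal T 1" a]
      s 0(3) by simp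
next
  case (Suc n)
  note f = Suc.prems(1)[unfolded tpow.simps] and g = Suc.prems(2)[unfolded tpow.simps]
  show ?case
  proof (rule tensor_ext[OF fd_tpow[OF U] U X f g _ Suc.prems(4)[unfolded tpow.simps]])
    fix s u assume s: "s \<in> carrier (tpow T U n)" and u: "u \<in> carrier U"
    note h = tvec_hom_left[OF fd_tpow[OF U] U u, of n]
    show "f (tvec T (tpow T U n) U s u) = g (tvec T (tpow T U n) U s u)"
    proof (rule Suc.IH[OF module_hom_comp[OF h f] module_hom_comp[OF h g] _ s])
      fix us assume us: "us \<in> {..<n} \<rightarrow> carrier U"
      let ?us = "\<lambda>i. if i < n then us i else u"
      have "pure_tensor T U n ?us = pure_tensor T U n us" by (rule pure_tensor_cong) simp
      moreover have "f (pure_tensor T U (Suc n) ?us) = g (pure_tensor T U (Suc n) ?us)"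
        using us u by (intro Suc.prems(3)) auto
      ultimately show "f (tvec T (tpow T U n) U (pure_tensor T U n us) u) =
          g (tvec T (tpow T U n) U (pure_tensor T U n us) u)" by simp
    qed
  qed
qed

lemma tpow_map_spec:
  assumes U: "fd_space U" and V: "fd_space V" and f: "f \<in> lin_maps U V"
  shows "tpow_map T U V f n \<in> lin_maps (tpow T U n) (tpow T V n)"
    and "us \<in> {..<n} \<rightarrow> carrier U \<Longrightarrow>
      tpow_map T U V f n (pure_tensor T U n us) = pure_tensor T V n (\<lambda>i. f (us i))"
proof -
  show 1: "tpow_map T U V f n \<in> lin_maps (tpow T U n) (tpow T V n)" for n
  proof (induction n)
    case 0
    show ?case by (simp only: tpow_map.simps tpow.simps lin_maps_id[OF fd_vs[OF fd_line]])
  next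
    case (Suc n)
    show ?case
      unfolding tpow_map.simps tpow.simps
      by (rule tensor_map_spec(1)[OF fd_tpow[OF U] U fd_tpow[OF V] V Suc f])
  qed
  show "us \<in> {..<n} \<rightarrow> carrier U \<Longrightarrow>
      tpow_map T U V f n (pure_tensor T U n us) = pure_tensor T V n (\<lambda>i. f (us i))"
  proof (induction n)
    case 0
    then show ?case using scal_bij by (auto simp: bij_betw_def)
  next
    case (Suc n)
    then have us: "us \<in> {..<n} \<rightarrow> carrier U" "us n \<in> carrier U" by auto
    then show ?case
      using Suc.IH[OF us(1)] pure_tensor_closed[OF U us(1)]
      by (simp add: tensor_map_spec(2)[OF fd_tpow[OF U] U fd_tpow[OF V] V 1 f])
  qed
qed

subsection \<open>The action of permutations\<close>

lemma transpose_last_two_exists: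
  assumes X: "fd_space X" and U: "fd_space U"
  obtains h where "h \<in> lin_maps (tspace T (tspace T X U) U) (tspace T (tspace T X U) U)"
    "\<And>x u v. x \<in> carrier X \<Longrightarrow> u \<in> carrier U \<Longrightarrow> v \<in> carrier U \<Longrightarrow>
      h (tvec T (tspace T X U) U (tvec T X U x u) v) = tvec T (tspace T X U) U (tvec T X U x v) u"
proof -
  let ?P = "tspace T (tspace T X U) U"
  note XU = fd_tspace[OF X U] and UU = fd_tspace[OF U U]
  obtain k where k: "k \<in> lin_maps ?P (tspace T X (tspace T U U))"
    "\<And>u v w. u \<in> carrier X \<Longrightarrow> v \<in> carrier U \<Longrightarrow> w \<in> carrier U \<Longrightarrow>
      k (tvec T (tspace T X U) U (tvec T X U u v) w) = tvec T X (tspace T U U) u (tvec T U U v w)"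
    by (rule assoc_inverse[OF X U U]) blast
  let ?i = "\<lambda>x\<in>carrier X. x"
  let ?b = "tensor_map T X (tspace T U U) X (tspace T U U) ?i (braid_map T U U)"
  note id = lin_maps_id[OF fd_vs[OF X]] and br = braid_spec(1)[OF U U]
  note b = tensor_map_spec[OF X UU X UU id br]
  define h where "h = restrict (\<lambda>t. assoc_map T X U U (?b (k t))) (carrier ?P)"
  have "h \<in> lin_maps ?P ?P"
    unfolding h_def
    by (rule restrict_lin_maps[OF vs_tspace[OF XU U]],
        rule module_hom_comp[OF _ lin_maps_hom[OF assoc_spec(1)[OF X U U]]],
        rule module_hom_comp[OF lin_maps_hom[OF k(1)] lin_maps_hom[OF b(1)]])
  moreover have "h (tvec T (tspace T X U) U (tvec T X U x u) v) = tvec T (tspace T X U) U (tvec T X U x v) u"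
    if "x \<in> carrier X" "u \<in> carrier U" "v \<in> carrier U" for x u v
    using that by (simp add: h_def k(2) b(2) tvec_closed X U XU UU braid_spec(2) assoc_spec(2)
        del: restrict_apply add: restrict_apply')
  ultimately show ?thesis by (rule that)
qed

lemma perm_map_adjacent_exists:
  assumes U: "fd_space U" and "Suc i < n"
  shows "\<exists>h. h \<in> lin_maps (tpow T U n) (tpow T U n) \<and> (\<forall>us \<in> {..<n} \<rightarrow> carrier U.
    h (pure_tensor T U n us) = pure_tensor T U n (\<lambda>i'. us (adj i i')))"
  using assms(2)
proof (induction n)
  case (Suc n)
  show ?case
  proof (cases "Suc i < n")
    case True
    then obtain h where h: "h \<in> lin_maps (tpow T U n) (tpow T U n)"
      "\<forall>us \<in> {..<n} \<rightarrow> carrier U. h (pure_tensor T U n us) =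
        pure_tensor T U n (\<lambda>i'. us (adj i i'))"
      using Suc.IH by blast
    let ?h = "tensor_map T (tpow T U n) U (tpow T U n) U h (\<lambda>u\<in>carrier U. u)"
    note spec = tensor_map_spec[OF fd_tpow[OF U] U fd_tpow[OF U] U h(1) lin_maps_id[OF fd_vs[OF U]]]
    have "?h (pure_tensor T U (Suc n) us) =
        pure_tensor T U (Suc n) (\<lambda>i'. us (adj i i'))"
      if us: "us \<in> {..<Suc n} \<rightarrow> carrier U" for us
    proof -
      have us': "us \<in> {..<n} \<rightarrow> carrier U" "us n \<in> carrier U" using us by auto
      show ?thesis
        using True us'(2) pure_tensor_closed[OF U us'(1)] h(2) us'(1)
        by (simp add: spec(2) transpose_def)
    qed
    then show ?thesis using spec(1) by (intro exI[of _ ?h]) simp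
  next
    case False
    with Suc.prems have n: "n = Suc i" by simp
    obtain h where h: "h \<in> lin_maps (tpow T U (Suc n)) (tpow T U (Suc n))"
      and h2: "\<And>x u v. x \<in> carrier (tpow T U i) \<Longrightarrow> u \<in> carrier U \<Longrightarrow> v \<in> carrier U \<Longrightarrow>
      h (tvec T (tpow T U n) U (tvec T (tpow T U i) U x u) v) =
      tvec T (tpow T U n) U (tvec T (tpow T U i) U x v) u"
      unfolding n tpow.simps by (rule transpose_last_two_exists[OF fd_tpow[OF U] U]) blast
    have "h (pure_tensor T U (Suc n) us) =
        pure_tensor T U (Suc n) (\<lambda>i'. us (adj i i'))"
      if us: "us \<in> {..<Suc n} \<rightarrow> carrier U" for us
    proof -
      have us': "us \<in> {..<i} \<rightarrow> carrier U" "us i \<in> carrier U" "us (Suc i) \<in> carrier U"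
        using us n by auto
      have "pure_tensor T U i (\<lambda>i'. us (adj i i')) = pure_tensor T U i us"
        by (rule pure_tensor_cong) (simp add: transpose_def)
      then show ?thesis
        using us'(2,3) pure_tensor_closed[OF U us'(1)]
        by (simp add: n h2[unfolded n tpow.simps])
    qed
    then show ?thesis using h by blast
  qed
qed simp

lemma permutes_funcset:
  "us \<in> S \<rightarrow> A \<Longrightarrow> p permutes S \<Longrightarrow> (\<lambda>i. us (p i)) \<in> S \<rightarrow> A"
  by (auto simp: permutes_in_image)

lemma perm_map_spec:
  assumes U: "fd_space U" and \<sigma>: "\<sigma> permutes {..<n}"
  shows "perm_map T U n \<sigma> \<in> lin_maps (tpow T U n) (tpow T U n)"
    and "us \<in> {..<n} \<rightarrow> carrier U \<Longrightarrow>
      perm_map T U n \<sigma> (pure_tensor T U n us) = pure_tensor T U n (\<lambda>i. us (\<sigma> i))"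
proof -
  let ?P = "\<lambda>\<sigma> h. h \<in> lin_maps (tpow T U n) (tpow T U n) \<and>
    (\<forall>us \<in> {..<n} \<rightarrow> carrier U. h (pure_tensor T U n us) = pure_tensor T U n (\<lambda>i. us (\<sigma> i)))"
  have "\<exists>h. ?P \<sigma> h"
    using \<sigma>
  proof (induction rule: permutes_adjacent_induct)
    show "\<exists>h. ?P id h"
      using lin_maps_id[OF vs_tpow[OF U]] pure_tensor_closed[OF U]
      by (intro exI[of _ "\<lambda>t\<in>carrier (tpow T U n). t"]) (simp del: restrict_apply add: restrict_apply')
  next
    fix i p assume i: "Suc i < n" and p: "p permutes {..<n}"
    let ?s = "adj i"
    have s: "?s permutes {..<n}" using i by (intro permutes_swap_id) auto
    assume "\<exists>h. ?P p h"
    then obtain h where h: "?P p h" by blast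
    obtain k where k: "?P ?s k" using perm_map_adjacent_exists[OF U i] by blast
    have "compose (carrier (tpow T U n)) h k (pure_tensor T U n us) =
        pure_tensor T U n (\<lambda>i. us ((?s \<circ> p) i))" if us: "us \<in> {..<n} \<rightarrow> carrier U" for us
      using h k us permutes_funcset[OF us s] pure_tensor_closed[OF U us] by (simp add: compose_eq)
    then show "\<exists>h. ?P (?s \<circ> p) h"
      using lin_maps_compose[OF vs_tpow[OF U], of k n "tpow T U n" h] h k by blast
  qed
  moreover have "h = h'" if h: "?P \<sigma> h" and h': "?P \<sigma> h'" for h h'
  proof (rule lin_maps_ext[OF h[THEN conjunct1] h'[THEN conjunct1]])
    show "h t = h' t" if t: "t \<in> carrier (tpow T U n)" for t
      by (rule tpow_ext[OF U vs_tpow[OF U] h[THEN conjunct1, THEN lin_maps_hom]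
            h'[THEN conjunct1, THEN lin_maps_hom] _ t]) (use h h' in auto)
  qed
  ultimately have "\<exists>!h. ?P \<sigma> h" by blast
  from theI'[OF this, folded perm_map_def]
  show "perm_map T U n \<sigma> \<in> lin_maps (tpow T U n) (tpow T U n)"
    and "us \<in> {..<n} \<rightarrow> carrier U \<Longrightarrow>
      perm_map T U n \<sigma> (pure_tensor T U n us) = pure_tensor T U n (\<lambda>i. us (\<sigma> i))"
    by blast+
qed

lemma perm_map_eqI:
  assumes U: "fd_space U" and \<sigma>: "\<sigma> permutes {..<n}"
    and h: "h \<in> hom_set (tpow T U n) (tpow T U n)"
    and eq: "\<And>us. us \<in> {..<n} \<rightarrow> carrier U \<Longrightarrow>
      h (pure_tensor T U n us) = pure_tensor T U n (\<lambda>i. us (\<sigma> i))"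
    and t: "t \<in> carrier (tpow T U n)"
  shows "perm_map T U n \<sigma> t = h t"
  by (rule tpow_ext[OF U vs_tpow[OF U] lin_maps_hom[OF perm_map_spec(1)[OF U \<sigma>]] h _ t])
    (simp add: perm_map_spec(2)[OF U \<sigma>] eq)

lemma perm_map_closed:
  "fd_space U \<Longrightarrow> \<sigma> permutes {..<n} \<Longrightarrow> t \<in> carrier (tpow T U n) \<Longrightarrow>
    perm_map T U n \<sigma> t \<in> carrier (tpow T U n)"
  by (rule lin_maps_closed[OF perm_map_spec(1)])

lemma perm_map_id:
  assumes U: "fd_space U" and t: "t \<in> carrier (tpow T U n)"
  shows "perm_map T U n id t = t"
  by (rule perm_map_eqI[OF U permutes_id id_hom _ t]) simp

lemma perm_map_compose:
  assumes U: "fd_space U" and \<sigma>: "\<sigma> permutes {..<n}" and \<tau>: "\<tau> permutes {..<n}"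
    and t: "t \<in> carrier (tpow T U n)"
  shows "perm_map T U n \<sigma> (perm_map T U n \<tau> t) = perm_map T U n (\<tau> \<circ> \<sigma>) t"
  by (rule perm_map_eqI[OF U permutes_compose[OF \<sigma> \<tau>] _ _ t, symmetric],
      rule module_hom_comp[OF perm_map_spec(1)[OF U \<tau>, THEN lin_maps_hom]
        perm_map_spec(1)[OF U \<sigma>, THEN lin_maps_hom]])
    (simp add: perm_map_spec(2)[OF U \<tau>] perm_map_spec(2)[OF U \<sigma>] permutes_funcset[OF _ \<tau>])

lemma perm_map_natural:
  assumes U: "fd_space U" and V: "fd_space V" and f: "f \<in> lin_maps U V"
    and \<sigma>: "\<sigma> permutes {..<n}" and t: "t \<in> carrier (tpow T U n)"
  shows "tpow_map T U V f n (perm_map T U n \<sigma> t) = perm_map T V n \<sigma> (tpow_map T U V f n t)"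
proof (rule tpow_ext[OF U vs_tpow[OF V] _ _ _ t])
  show "(\<lambda>t. tpow_map T U V f n (perm_map T U n \<sigma> t)) \<in> hom_set (tpow T U n) (tpow T V n)"
    by (rule module_hom_comp[OF perm_map_spec(1)[OF U \<sigma>, THEN lin_maps_hom]
          tpow_map_spec(1)[OF U V f, THEN lin_maps_hom]])
  show "(\<lambda>t. perm_map T V n \<sigma> (tpow_map T U V f n t)) \<in> hom_set (tpow T U n) (tpow T V n)"
    by (rule module_hom_comp[OF tpow_map_spec(1)[OF U V f, THEN lin_maps_hom]
          perm_map_spec(1)[OF V \<sigma>, THEN lin_maps_hom]])
  fix us assume us: "us \<in> {..<n} \<rightarrow> carrier U"
  have "(\<lambda>i. f (us i)) \<in> {..<n} \<rightarrow> carrier V" using us lin_maps_closed[OF f] by auto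
  then show "tpow_map T U V f n (perm_map T U n \<sigma> (pure_tensor T U n us)) =
      perm_map T V n \<sigma> (tpow_map T U V f n (pure_tensor T U n us))"
    using us permutes_funcset[OF us \<sigma>]
    by (simp add: perm_map_spec(2)[OF U \<sigma>] perm_map_spec(2)[OF V \<sigma>] tpow_map_spec(2)[OF U V f])
qed

text \<open>The transpositions of adjacent factors of a tensor power are given recursively: on the last two
  factors by the commutativity isomorphism, conjugated by associativity, and otherwise by tensoring
  with the identity.\<close>

lemma perm_map_lower:
  assumes U: "fd_space U" and i: "Suc i < n"
  shows "perm_map T U (Suc n) (adj i) =
    tensor_map T (tpow T U n) U (tpow T U n) U
      (perm_map T U n (adj i)) (\<lambda>u\<in>carrier U. u)" (is "_ = ?h")
proof -
  let ?s = "adj i"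
  have s: "?s permutes {..<n}" "?s permutes {..<Suc n}" using i by (auto intro!: permutes_swap_id)
  note spec = tensor_map_spec[OF fd_tpow[OF U] U fd_tpow[OF U] U perm_map_spec(1)[OF U s(1)]
      lin_maps_id[OF fd_vs[OF U]]]
  show ?thesis
  proof (rule lin_maps_ext[OF perm_map_spec(1)[OF U s(2)] spec(1)[folded tpow.simps]])
    fix t assume t: "t \<in> carrier (tpow T U (Suc n))"
    show "perm_map T U (Suc n) ?s t = ?h t"
    proof (rule perm_map_eqI[OF U s(2) lin_maps_hom[OF spec(1)[folded tpow.simps]] _ t])
      fix us assume us: "us \<in> {..<Suc n} \<rightarrow> carrier U"
      have us': "us \<in> {..<n} \<rightarrow> carrier U" "us n \<in> carrier U" using us by auto
      show "?h (pure_tensor T U (Suc n) us) = pure_tensor T U (Suc n) (\<lambda>j. us (?s j))"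
        using i us'(2) pure_tensor_closed[OF U us'(1)]
        by (simp add: spec(2) perm_map_spec(2)[OF U s(1) us'(1)] transpose_def)
    qed
  qed
qed

lemma perm_map_top:
  assumes U: "fd_space U"
    and t: "t \<in> carrier (tspace T (tpow T U n) (tspace T U U))"
  shows "perm_map T U (Suc (Suc n)) (adj n) (assoc_map T (tpow T U n) U U t)
    = assoc_map T (tpow T U n) U U (tensor_map T (tpow T U n) (tspace T U U) (tpow T U n) (tspace T U U)
        (\<lambda>v\<in>carrier (tpow T U n). v) (braid_map T U U) t)"
proof -
  let ?X = "tpow T U n" and ?Y = "tpow T U (Suc (Suc n))"
  let ?s = "adj n"
  have s: "?s permutes {..<Suc (Suc n)}" by (auto intro!: permutes_swap_id)
  note X = fd_tpow[OF U, of n] and Y = vs_tpow[OF U, of "Suc (Suc n)"] and UU = fd_tspace[OF U U]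
  note a = assoc_spec[OF X U U]
  note b = tensor_map_spec[OF X UU X UU lin_maps_id[OF fd_vs[OF X]] braid_spec(1)[OF U U]]
  note p = perm_map_spec[OF U s]
  obtain k where k: "k \<in> lin_maps ?Y (tspace T ?X (tspace T U U))"
    and k2: "\<And>x u v. x \<in> carrier ?X \<Longrightarrow> u \<in> carrier U \<Longrightarrow> v \<in> carrier U \<Longrightarrow>
      k (tvec T (tspace T ?X U) U (tvec T ?X U x u) v) = tvec T ?X (tspace T U U) x (tvec T U U u v)"
    and k3: "\<And>t. t \<in> carrier (tspace T ?X (tspace T U U)) \<Longrightarrow> k (assoc_map T ?X U U t) = t"
    unfolding tpow.simps by (rule assoc_inverse[OF X U U]) blast
  let ?h = "\<lambda>t. assoc_map T ?X U U (tensor_map T ?X (tspace T U U) ?X (tspace T U U)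
        (\<lambda>v\<in>carrier ?X. v) (braid_map T U U) (k t))"
  have h: "?h \<in> hom_set ?Y ?Y"
    using module_hom_comp[OF module_hom_comp[OF k[THEN lin_maps_hom] b(1)[THEN lin_maps_hom]]
        a(1)[THEN lin_maps_hom]] by simp
  have at: "assoc_map T ?X U U t \<in> carrier ?Y" using lin_maps_closed[OF a(1) t] by simp
  have "perm_map T U (Suc (Suc n)) ?s (assoc_map T ?X U U t) = ?h (assoc_map T ?X U U t)"
  proof (rule perm_map_eqI[OF U s h _ at])
    fix us assume us: "us \<in> {..<Suc (Suc n)} \<rightarrow> carrier U"
    have us': "us \<in> {..<n} \<rightarrow> carrier U" "us n \<in> carrier U" "us (Suc n) \<in> carrier U"
      using us by auto
    have "pure_tensor T U n (\<lambda>j. us (?s j)) = pure_tensor T U n us"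
      by (rule pure_tensor_cong) (simp add: transpose_def)
    then show "?h (pure_tensor T U (Suc (Suc n)) us) = pure_tensor T U (Suc (Suc n)) (\<lambda>j. us (?s j))"
      using us'(2,3) pure_tensor_closed[OF U us'(1)]
      by (simp add: k2 b(2) a(2) tvec_closed U braid_spec(2) )
  qed
  then show ?thesis by (simp only: k3[OF t])
qed

end

text \<open>Tensor powers are modules over the rational group algebra when the ground field has
  characteristic zero.\<close>

locale tensor_choice_0 = tensor_choice T for T :: "('k::field_char_0, 'u) tensor_data"

text \<open>The action of an element of the rational group algebra. As the permutations act from the right,
  it is an antihomomorphism, see \<open>alg_map_conv\<close>.\<close>

definition alg_map ::
  "('k::field_char_0, 'u) tensor_data \<Rightarrow> ('k, 'u) module \<Rightarrow> nat \<Rightarrow> ((nat \<Rightarrow> nat) \<Rightarrow> rat) \<Rightarrow> 'u \<Rightarrow> 'u" where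
  "alg_map T U n a = (\<lambda>t\<in>carrier (tpow T U n). \<Oplus>\<^bsub>tpow T U n\<^esub>\<sigma>\<in>{\<sigma>. \<sigma> permutes {..<n}}.
     of_rat (a \<sigma>) \<odot>\<^bsub>tpow T U n\<^esub> perm_map T U n \<sigma> t)"

context tensor_choice_0
begin

lemma alg_map_term_closed:
  "fd_space U \<Longrightarrow> \<sigma> permutes {..<n} \<Longrightarrow> t \<in> carrier (tpow T U n) \<Longrightarrow>
    r \<odot>\<^bsub>tpow T U n\<^esub> perm_map T U n \<sigma> t \<in> carrier (tpow T U n)"
  by (intro vs_closed(2) vs_tpow perm_map_closed)

lemma alg_map_closed:
  assumes U: "fd_space U" and t: "t \<in> carrier (tpow T U n)"
  shows "alg_map T U n a t \<in> carrier (tpow T U n)"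
  unfolding alg_map_def restrict_apply'[OF t]
  by (intro finsum_closed_vs vs_tpow U alg_map_term_closed t) simp

lemma functional_alg_map:
  assumes U: "fd_space U" and \<phi>: "functional (tpow T U n) \<phi>" and t: "t \<in> carrier (tpow T U n)"
  shows "\<phi> (alg_map T U n a t) = (\<Sum>\<sigma> | \<sigma> permutes {..<n}. of_rat (a \<sigma>) * \<phi> (perm_map T U n \<sigma> t))"
proof -
  have "\<phi> (alg_map T U n a t) = (\<Sum>\<sigma> | \<sigma> permutes {..<n}.
      \<phi> (of_rat (a \<sigma>) \<odot>\<^bsub>tpow T U n\<^esub> perm_map T U n \<sigma> t))"
    unfolding alg_map_def restrict_apply'[OF t]
    by (intro functional_finsum vs_tpow U \<phi> alg_map_term_closed t finite_permutations) simp_all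
  also have "\<dots> = (\<Sum>\<sigma> | \<sigma> permutes {..<n}. of_rat (a \<sigma>) * \<phi> (perm_map T U n \<sigma> t))"
    by (intro sum.cong refl functionalD(2)[OF \<phi>] perm_map_closed[OF U] t) simp
  finally show ?thesis .
qed

lemma alg_map_lin:
  assumes U: "fd_space U"
  shows "alg_map T U n a \<in> lin_maps (tpow T U n) (tpow T U n)"
proof -
  let ?P = "tpow T U n"
  note vs = vs_tpow[OF U, of n] and cl = alg_map_closed[OF U]
  have p: "functional ?P \<phi> \<Longrightarrow> \<sigma> permutes {..<n} \<Longrightarrow> functional ?P (\<lambda>t. \<phi> (perm_map T U n \<sigma> t))" for \<phi> \<sigma>
    by (rule functional_comp[OF lin_maps_hom[OF perm_map_spec(1)[OF U]]])
  have "alg_map T U n a \<in> hom_set ?P ?P"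
  proof (rule module_hom_classI)
    fix s t assume s: "s \<in> carrier ?P" and t: "t \<in> carrier ?P"
    show "alg_map T U n a s \<in> carrier ?P" using cl[OF s] .
    show "alg_map T U n a (s \<oplus>\<^bsub>?P\<^esub> t) = alg_map T U n a s \<oplus>\<^bsub>?P\<^esub> alg_map T U n a t"
    proof (rule functionals_separate[OF fd_tpow[OF U]])
      fix \<phi> assume \<phi>: "functional ?P \<phi>"
      show "\<phi> (alg_map T U n a (s \<oplus>\<^bsub>?P\<^esub> t)) = \<phi> (alg_map T U n a s \<oplus>\<^bsub>?P\<^esub> alg_map T U n a t)"
        unfolding functionalD(1)[OF \<phi> cl[OF s] cl[OF t]] functional_alg_map[OF U \<phi> s]
          functional_alg_map[OF U \<phi> t] functional_alg_map[OF U \<phi> vs_closed(1)[OF vs s t]]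
          sum.distrib[symmetric]
        by (intro sum.cong refl) (simp add: functionalD(1)[OF p[OF \<phi>] s t] distrib_left)
    qed (intro cl s t vs_closed[OF vs])+
    fix r show "alg_map T U n a (r \<odot>\<^bsub>?P\<^esub> s) = r \<odot>\<^bsub>?P\<^esub> alg_map T U n a s"
    proof (rule functionals_separate[OF fd_tpow[OF U]])
      fix \<phi> assume \<phi>: "functional ?P \<phi>"
      show "\<phi> (alg_map T U n a (r \<odot>\<^bsub>?P\<^esub> s)) = \<phi> (r \<odot>\<^bsub>?P\<^esub> alg_map T U n a s)"
        unfolding functionalD(2)[OF \<phi> cl[OF s]] functional_alg_map[OF U \<phi> s]
          functional_alg_map[OF U \<phi> vs_closed(2)[OF vs s]] sum_distrib_left
        by (intro sum.cong refl) (simp add: functionalD(2)[OF p[OF \<phi>] s])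
    qed (intro cl s t vs_closed[OF vs])+
  qed
  then show ?thesis by (simp add: lin_maps_def alg_map_def)
qed

lemma alg_map_eqI:
  assumes U: "fd_space U" and s: "s \<in> carrier (tpow T U n)" and t: "t \<in> carrier (tpow T U n)"
    and eq: "\<And>\<phi>. functional (tpow T U n) \<phi> \<Longrightarrow>
      (\<Sum>\<sigma> | \<sigma> permutes {..<n}. of_rat (a \<sigma>) * \<phi> (perm_map T U n \<sigma> t)) = \<phi> s"
  shows "alg_map T U n a t = s"
  using functionals_separate[OF fd_tpow[OF U] alg_map_closed[OF U t] s] eq functional_alg_map[OF U _ t]
  by metis

lemma alg_map_cong:
  assumes "\<And>\<sigma>. \<sigma> permutes {..<n} \<Longrightarrow> a \<sigma> = b \<sigma>" and U: "fd_space U"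
  shows "alg_map T U n a = alg_map T U n b"
proof (rule lin_maps_ext[OF alg_map_lin[OF U] alg_map_lin[OF U]])
  fix t assume t: "t \<in> carrier (tpow T U n)"
  show "alg_map T U n a t = alg_map T U n b t"
    by (rule alg_map_eqI[OF U alg_map_closed[OF U t] t])
      (simp add: functional_alg_map[OF U _ t] assms(1))
qed

lemma alg_map_delta:
  assumes U: "fd_space U" and \<sigma>: "\<sigma> permutes {..<n}"
  shows "alg_map T U n (\<lambda>\<tau>. if \<tau> = \<sigma> then 1 else 0) = perm_map T U n \<sigma>"
proof (rule lin_maps_ext[OF alg_map_lin[OF U] perm_map_spec(1)[OF U \<sigma>]])
  fix t assume t: "t \<in> carrier (tpow T U n)"
  show "alg_map T U n (\<lambda>\<tau>. if \<tau> = \<sigma> then 1 else 0) t = perm_map T U n \<sigma> t"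
  proof (rule alg_map_eqI[OF U perm_map_closed[OF U \<sigma> t] t])
    fix \<phi>
    have "(\<Sum>\<tau> | \<tau> permutes {..<n}. of_rat (if \<tau> = \<sigma> then 1 else 0) * \<phi> (perm_map T U n \<tau> t))
        = (\<Sum>\<tau> | \<tau> permutes {..<n}. if \<tau> = \<sigma> then \<phi> (perm_map T U n \<tau> t) else 0)"
      by (intro sum.cong) auto
    also have "\<dots> = \<phi> (perm_map T U n \<sigma> t)"
      using \<sigma> by (simp add: sum.delta finite_permutations)
    finally show "(\<Sum>\<tau> | \<tau> permutes {..<n}. of_rat (if \<tau> = \<sigma> then 1 else 0) * \<phi> (perm_map T U n \<tau> t))
        = \<phi> (perm_map T U n \<sigma> t)" .
  qed
qed

lemma alg_map_add:
  assumes U: "fd_space U" and t: "t \<in> carrier (tpow T U n)"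
  shows "alg_map T U n (\<lambda>\<sigma>. a \<sigma> + b \<sigma>) t = alg_map T U n a t \<oplus>\<^bsub>tpow T U n\<^esub> alg_map T U n b t"
  by (rule alg_map_eqI[OF U vs_closed(1)[OF vs_tpow[OF U] alg_map_closed[OF U t] alg_map_closed[OF U t]] t])
    (simp add: functionalD(1)[OF _ alg_map_closed[OF U t] alg_map_closed[OF U t]]
      functional_alg_map[OF U _ t] of_rat_add distrib_right sum.distrib)

lemma alg_map_scale:
  assumes U: "fd_space U" and t: "t \<in> carrier (tpow T U n)"
  shows "alg_map T U n (\<lambda>\<sigma>. r * a \<sigma>) t = of_rat r \<odot>\<^bsub>tpow T U n\<^esub> alg_map T U n a t"
  by (rule alg_map_eqI[OF U vs_closed(2)[OF vs_tpow[OF U] alg_map_closed[OF U t]] t])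
    (simp add: functionalD(2)[OF _ alg_map_closed[OF U t]]
      functional_alg_map[OF U _ t] of_rat_mult sum_distrib_left mult.assoc)

lemma alg_map_conv:
  assumes U: "fd_space U" and t: "t \<in> carrier (tpow T U n)"
  shows "alg_map T U n a (alg_map T U n b t) = alg_map T U n (conv {..<n} b a) t"
proof (rule alg_map_eqI[OF U alg_map_closed[OF U t] alg_map_closed[OF U t]])
  let ?G = "{\<sigma>. \<sigma> permutes {..<n}}" and ?P = "perm_map T U n"
  fix \<phi> assume \<phi>: "functional (tpow T U n) \<phi>"
  have 1: "\<phi> (?P \<sigma> (alg_map T U n b t)) = (\<Sum>\<tau>\<in>?G. of_rat (b \<tau>) * \<phi> (?P (\<tau> \<circ> \<sigma>) t))"
    if s: "\<sigma> permutes {..<n}" for \<sigma>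
  proof -
    have "functional (tpow T U n) (\<lambda>t. \<phi> (?P \<sigma> t))"
      by (rule functional_comp[OF lin_maps_hom[OF perm_map_spec(1)[OF U s]] \<phi>])
    from functional_alg_map[OF U this t] show ?thesis
      by (simp add: perm_map_compose[OF U s _ t])
  qed
  have "(\<Sum>\<sigma>\<in>?G. of_rat (a \<sigma>) * \<phi> (?P \<sigma> (alg_map T U n b t)))
      = (\<Sum>\<sigma>\<in>?G. \<Sum>\<tau>\<in>?G. of_rat (b \<tau>) * (of_rat (a \<sigma>) * \<phi> (?P (\<tau> \<circ> \<sigma>) t)))"
    by (simp add: 1 sum_distrib_left mult_ac)
  also have "\<dots> = (\<Sum>\<tau>\<in>?G. \<Sum>\<sigma>\<in>?G. of_rat (b \<tau>) * (of_rat (a \<sigma>) * \<phi> (?P (\<tau> \<circ> \<sigma>) t)))"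
    by (rule sum.swap)
  also have "\<dots> = (\<Sum>\<tau>\<in>?G. \<Sum>\<rho>\<in>?G. of_rat (b \<tau>) * (of_rat (a (pinv \<tau> \<circ> \<rho>)) * \<phi> (?P \<rho> t)))"
  proof (rule sum.cong[OF refl])
    fix \<tau> assume "\<tau> \<in> ?G"
    then have \<tau>: "\<tau> permutes {..<n}" by simp
    have "pinv \<tau> \<circ> (\<tau> \<circ> \<sigma>) = \<sigma>" for \<sigma> :: "nat \<Rightarrow> nat"
      by (simp only: o_assoc permutes_inv_o(2)[OF \<tau>] id_o)
    then show "(\<Sum>\<sigma>\<in>?G. of_rat (b \<tau>) * (of_rat (a \<sigma>) * \<phi> (?P (\<tau> \<circ> \<sigma>) t)))
        = (\<Sum>\<rho>\<in>?G. of_rat (b \<tau>) * (of_rat (a (pinv \<tau> \<circ> \<rho>)) * \<phi> (?P \<rho> t)))"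
      by (subst setum_permutations_compose_left[OF \<tau>, of "\<lambda>\<rho>. of_rat (b \<tau>) * (of_rat (a (pinv \<tau> \<circ> \<rho>)) * \<phi> (?P \<rho> t))"])
        (simp only:)
  qed
  also have "\<dots> = (\<Sum>\<rho>\<in>?G. \<Sum>\<tau>\<in>?G. of_rat (b \<tau>) * (of_rat (a (pinv \<tau> \<circ> \<rho>)) * \<phi> (?P \<rho> t)))"
    by (rule sum.swap)
  also have "\<dots> = \<phi> (alg_map T U n (conv {..<n} b a) t)"
    by (simp only: functional_alg_map[OF U \<phi> t] conv_def of_rat_sum of_rat_mult sum_distrib_right mult.assoc)
  finally show "(\<Sum>\<sigma>\<in>?G. of_rat (a \<sigma>) * \<phi> (?P \<sigma> (alg_map T U n b t))) =
      \<phi> (alg_map T U n (conv {..<n} b a) t)" .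
qed

lemma alg_map_natural:
  assumes U: "fd_space U" and V: "fd_space V" and f: "f \<in> lin_maps U V"
    and t: "t \<in> carrier (tpow T U n)"
  shows "tpow_map T U V f n (alg_map T U n a t) = alg_map T V n a (tpow_map T U V f n t)"
proof (rule sym, rule alg_map_eqI[OF V])
  note F = tpow_map_spec(1)[OF U V f, of n]
  show "tpow_map T U V f n (alg_map T U n a t) \<in> carrier (tpow T V n)"
    by (rule lin_maps_closed[OF F alg_map_closed[OF U t]])
  show ft: "tpow_map T U V f n t \<in> carrier (tpow T V n)" by (rule lin_maps_closed[OF F t])
  fix \<phi> assume \<phi>: "functional (tpow T V n) \<phi>"
  show "(\<Sum>\<sigma> | \<sigma> permutes {..<n}. of_rat (a \<sigma>) * \<phi> (perm_map T V n \<sigma> (tpow_map T U V f n t))) =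
      \<phi> (tpow_map T U V f n (alg_map T U n a t))"
    using functional_alg_map[OF U functional_comp[OF lin_maps_hom[OF F] \<phi>] t]
    by (simp add: perm_map_natural[OF U V f _ t])
qed

subsection \<open>The Young symmetrizer\<close>

text \<open>The group algebra element by which the Young symmetrizer acts.\<close>

definition young_element :: "nat list \<Rightarrow> (nat \<Rightarrow> nat) \<Rightarrow> rat" where
  "young_element \<mu> \<sigma> =
     (\<Sum>p\<in>row_group \<mu>. \<Sum>q\<in>column_group \<mu>. if p \<circ> q = \<sigma> then of_int (sign q) else 0)"

lemma young_symmetrizer_alg_map:
  assumes U: "fd_space U" and t: "t \<in> carrier (tpow T U (sum_list \<mu>))"
  shows "young_symmetrizer T \<mu> U t = alg_map T U (sum_list \<mu>) (young_element \<mu>) t"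
proof -
  define n where "n = sum_list \<mu>"
  let ?G = "{\<sigma>. \<sigma> permutes {..<n}}" and ?P = "tpow T U n" and ?R = "row_group \<mu>" and ?C = "column_group \<mu>"
  note vs = vs_tpow[OF U, of n] and t' = t[folded n_def]
  have sub: "?R \<subseteq> ?G" "?C \<subseteq> ?G" by (auto simp: row_group_def column_group_def n_def)
  have fin: "finite ?G" "finite ?R" "finite ?C"
    using finite_subset[OF sub(1)] finite_subset[OF sub(2)] by (simp_all add: finite_permutations)
  have pq: "p \<circ> q permutes {..<n}" if "p \<in> ?R" "q \<in> ?C" for p q
    using sub that by (auto intro: permutes_compose)
  have c1: "of_int (sign q) \<odot>\<^bsub>?P\<^esub> perm_map T U n (p \<circ> q) t \<in> carrier ?P" if "p \<in> ?R" "q \<in> ?C" for p q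
    by (rule alg_map_term_closed[OF U pq[OF that] t'])
  have c2: "(\<Oplus>\<^bsub>?P\<^esub>q\<in>?C. of_int (sign q) \<odot>\<^bsub>?P\<^esub> perm_map T U n (p \<circ> q) t) \<in> carrier ?P"
    if "p \<in> ?R" for p
    by (rule finsum_closed_vs[OF vs c1[OF that]])
  have "alg_map T U n (young_element \<mu>) t = young_symmetrizer T \<mu> U t"
    unfolding young_symmetrizer_def n_def[symmetric]
  proof (rule alg_map_eqI[OF U finsum_closed_vs[OF vs c2] t'])
    fix \<phi> assume \<phi>: "functional ?P \<phi>"
    have "\<phi> (\<Oplus>\<^bsub>?P\<^esub>p\<in>?R. \<Oplus>\<^bsub>?P\<^esub>q\<in>?C. of_int (sign q) \<odot>\<^bsub>?P\<^esub> perm_map T U n (p \<circ> q) t)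
        = (\<Sum>p\<in>?R. \<phi> (\<Oplus>\<^bsub>?P\<^esub>q\<in>?C. of_int (sign q) \<odot>\<^bsub>?P\<^esub> perm_map T U n (p \<circ> q) t))"
      by (rule functional_finsum[OF vs \<phi> fin(2) c2])
    also have "\<dots> = (\<Sum>p\<in>?R. \<Sum>q\<in>?C. \<phi> (of_int (sign q) \<odot>\<^bsub>?P\<^esub> perm_map T U n (p \<circ> q) t))"
      by (intro sum.cong refl functional_finsum[OF vs \<phi> fin(3) c1])
    also have "\<dots> = (\<Sum>p\<in>?R. \<Sum>q\<in>?C. of_int (sign q) * \<phi> (perm_map T U n (p \<circ> q) t))"
      by (intro sum.cong refl functionalD(2)[OF \<phi>] perm_map_closed[OF U] pq t')
    also have "\<dots> = (\<Sum>p\<in>?R. \<Sum>q\<in>?C. \<Sum>\<sigma>\<in>?G.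
        if p \<circ> q = \<sigma> then of_int (sign q) * \<phi> (perm_map T U n \<sigma> t) else 0)"
      using pq fin(1) by (intro sum.cong refl) (simp only: sum.delta' mem_Collect_eq if_True)
    also have "\<dots> = (\<Sum>p\<in>?R. \<Sum>\<sigma>\<in>?G. \<Sum>q\<in>?C.
        if p \<circ> q = \<sigma> then of_int (sign q) * \<phi> (perm_map T U n \<sigma> t) else 0)"
      by (intro sum.cong refl sum.swap)
    also have "\<dots> = (\<Sum>\<sigma>\<in>?G. \<Sum>p\<in>?R. \<Sum>q\<in>?C.
        if p \<circ> q = \<sigma> then of_int (sign q) * \<phi> (perm_map T U n \<sigma> t) else 0)"
      by (rule sum.swap)
    also have "\<dots> = (\<Sum>\<sigma>\<in>?G. of_rat (young_element \<mu> \<sigma>) * \<phi> (perm_map T U n \<sigma> t))"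
      unfolding young_element_def of_rat_sum sum_distrib_right
      by (intro sum.cong refl) (simp split: if_split)
    finally show "(\<Sum>\<sigma>\<in>?G. of_rat (young_element \<mu> \<sigma>) * \<phi> (perm_map T U n \<sigma> t)) =
      \<phi> (\<Oplus>\<^bsub>?P\<^esub>p\<in>?R. \<Oplus>\<^bsub>?P\<^esub>q\<in>?C. of_int (sign q) \<odot>\<^bsub>?P\<^esub> perm_map T U n (p \<circ> q) t)" by simp
  qed
  then show ?thesis by (simp add: n_def)
qed

text \<open>The Young symmetrizer factors through its image, the Schur functor.\<close>

lemma carrier_schur_space:
  assumes "fd_space U"
  shows "carrier (schur_space T \<mu> U) =
    alg_map T U (sum_list \<mu>) (young_element \<mu>) ` carrier (tpow T U (sum_list \<mu>))"
  using young_symmetrizer_alg_map[OF assms] by (auto simp: schur_space_def)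

lemma schur_space_ops [simp]:
  "v \<oplus>\<^bsub>schur_space T \<mu> U\<^esub> w = v \<oplus>\<^bsub>tpow T U (sum_list \<mu>)\<^esub> w"
  "a \<odot>\<^bsub>schur_space T \<mu> U\<^esub> v = a \<odot>\<^bsub>tpow T U (sum_list \<mu>)\<^esub> v"
  "\<zero>\<^bsub>schur_space T \<mu> U\<^esub> = \<zero>\<^bsub>tpow T U (sum_list \<mu>)\<^esub>"
  by (simp_all add: schur_space_def)

lemma schur_space_subset:
  "fd_space U \<Longrightarrow> carrier (schur_space T \<mu> U) \<subseteq> carrier (tpow T U (sum_list \<mu>))"
  by (auto simp: carrier_schur_space alg_map_closed)

lemma fd_schur_space:
  assumes U: "fd_space U"
  shows "fd_space (schur_space T \<mu> U)"
proof -
  let ?P = "tpow T U (sum_list \<mu>)" and ?S = "schur_space T \<mu> U"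
  let ?e = "alg_map T U (sum_list \<mu>) (young_element \<mu>)"
  note vs = vs_tpow[OF U, of "sum_list \<mu>"]
  interpret P: vectorspace class_ring ?P by (rule vs)
  note hom = module_hom_classD[OF lin_maps_hom[OF alg_map_lin[OF U, of "sum_list \<mu>" "young_element \<mu>"]]]
  have mem: "s \<in> carrier ?S \<longleftrightarrow> (\<exists>t\<in>carrier ?P. s = ?e t)" for s
    by (auto simp: carrier_schur_space[OF U])
  have add: "s \<oplus>\<^bsub>?P\<^esub> t \<in> carrier ?S" if s: "s \<in> carrier ?S" and t: "t \<in> carrier ?S" for s t
  proof -
    obtain s' t' where st: "s' \<in> carrier ?P" "t' \<in> carrier ?P" "s = ?e s'" "t = ?e t'"
      using s t mem by blast
    then have "s \<oplus>\<^bsub>?P\<^esub> t = ?e (s' \<oplus>\<^bsub>?P\<^esub> t')" by (simp add: hom)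
    moreover have "s' \<oplus>\<^bsub>?P\<^esub> t' \<in> carrier ?P" using st by simp
    ultimately show ?thesis using mem by blast
  qed
  have scale: "a \<odot>\<^bsub>?P\<^esub> s \<in> carrier ?S" if s: "s \<in> carrier ?S" for s a
  proof -
    obtain s' where s': "s' \<in> carrier ?P" "s = ?e s'" using s mem by blast
    then have "a \<odot>\<^bsub>?P\<^esub> s = ?e (a \<odot>\<^bsub>?P\<^esub> s')" by (simp add: hom)
    moreover have "a \<odot>\<^bsub>?P\<^esub> s' \<in> carrier ?P" by (rule vs_closed(2)[OF vs s'(1)])
    ultimately show ?thesis using mem by blast
  qed
  have zero: "\<zero>\<^bsub>?P\<^esub> \<in> carrier ?S"
  proof -
    have "?e \<zero>\<^bsub>?P\<^esub> \<in> carrier ?S" using mem vs_closed(3)[OF vs] by blast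
    from scale[OF this, of 0] show ?thesis by (simp add: vs_ac(5)[OF vs] hom vs_closed[OF vs])
  qed
  have sub: "s \<in> carrier ?P" if "s \<in> carrier ?S" for s
    using schur_space_subset[OF U] that by blast
  have ag: "abelian_group ?S"
  proof (rule abelian_groupI, unfold schur_space_ops)
    fix s assume s: "s \<in> carrier ?S"
    have "(- 1) \<odot>\<^bsub>?P\<^esub> s \<oplus>\<^bsub>?P\<^esub> s = ((- 1) + 1) \<odot>\<^bsub>?P\<^esub> s"
      unfolding vs_ac(3)[OF vs sub[OF s]] vs_ac(4)[OF vs sub[OF s]] ..
    also have "\<dots> = \<zero>\<^bsub>?P\<^esub>" by (simp add: vs_ac(5)[OF vs sub[OF s]])
    finally show "\<exists>r\<in>carrier ?S. r \<oplus>\<^bsub>?P\<^esub> s = \<zero>\<^bsub>?P\<^esub>" using scale[OF s] by blast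
  qed (use sub add zero in \<open>auto simp: P.a_ac\<close>)
  have "Module.module class_ring ?S"
  proof (rule Module.module.intro[OF fieldE(1)[OF class_field.field_axioms] ag])
    show "module_axioms class_ring ?S"
      by (rule Module.module_axioms.intro) (simp_all add: sub scale vs_ac[OF vs])
  qed
  then have S: "vectorspace class_ring ?S"
    using class_field.field_axioms by (rule vectorspace.intro)
  interpret S: vectorspace class_ring ?S by (rule S)
  have eS: "?e \<in> hom_set ?P ?S"
    by (rule module_hom_classI) (auto simp: hom carrier_schur_space[OF U])
  interpret lm: linear_map class_ring ?P ?S ?e
    by (intro linear_map.intro mod_hom.intro mod_hom_axioms.intro vs S module_class[OF vs] module_class[OF S] eS)
  have "vectorspace.fin_dim class_ring ?S"
    by (rule lm.surj_fin_dim) (use fd_tpow[OF U] in \<open>simp_all add: fd_space_def carrier_schur_space[OF U]\<close>)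
  then show ?thesis using S by (simp add: fd_space_def)
qed

lemma vs_schur_space: "fd_space U \<Longrightarrow> vectorspace class_ring (schur_space T \<mu> U)"
  by (intro fd_vs fd_schur_space)

lemma schur_inclusion_lin:
  assumes U: "fd_space U"
  shows "(\<lambda>v\<in>carrier (schur_space T \<mu> U). v) \<in> lin_maps (schur_space T \<mu> U) (tpow T U (sum_list \<mu>))"
  by (rule restrict_lin_maps[OF vs_schur_space[OF U]], rule module_hom_classI)
    (use schur_space_subset[OF U] in auto)

lemma schur_projection_lin:
  assumes U: "fd_space U"
  shows "alg_map T U (sum_list \<mu>) (young_element \<mu>) \<in> lin_maps (tpow T U (sum_list \<mu>)) (schur_space T \<mu> U)"
  using alg_map_lin[OF U, of "sum_list \<mu>" "young_element \<mu>"]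
    module_hom_classD[OF lin_maps_hom[OF alg_map_lin[OF U, of "sum_list \<mu>" "young_element \<mu>"]]]
  unfolding lin_maps_def
  by (intro IntI module_hom_classI) (simp_all add: carrier_schur_space[OF U])

lemma schur_map_lin:
  assumes U: "fd_space U" and V: "fd_space V" and f: "f \<in> lin_maps U V"
  shows "schur_map T \<mu> U V f \<in> lin_maps (schur_space T \<mu> U) (schur_space T \<mu> V)"
proof -
  note F = tpow_map_spec(1)[OF U V f, of "sum_list \<mu>"]
  note hom = module_hom_classD[OF lin_maps_hom[OF F]]
  have sub: "s \<in> carrier (tpow T U (sum_list \<mu>))" if "s \<in> carrier (schur_space T \<mu> U)" for s
    using schur_space_subset[OF U] that by blast
  have cl: "tpow_map T U V f (sum_list \<mu>) s \<in> carrier (schur_space T \<mu> V)"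
    if "s \<in> carrier (schur_space T \<mu> U)" for s
    using that hom(1) by (auto simp: carrier_schur_space U V alg_map_natural[OF U V f])
  have "tpow_map T U V f (sum_list \<mu>) \<in> hom_set (schur_space T \<mu> U) (schur_space T \<mu> V)"
    by (rule module_hom_classI) (simp_all add: sub hom cl)
  then show ?thesis unfolding schur_map_def by (rule restrict_lin_maps[OF vs_schur_space[OF U]])
qed

end

section \<open>The tensor category of quiver representations\<close>

locale quiver_reps = tensor_choice_0 T + wf_digraph Q
  for T :: "('k::field_char_0, 'u) tensor_data" and Q :: "('v, 'e) pre_digraph"
begin

abbreviation D :: "(('v, 'e, 'k, 'u) qrep, ('v, 'e, 'k, 'u) qmor) tensor_cat" where
  "D \<equiv> rep_cat Q T"

abbreviation comp_D (infixr "**" 55) where "g ** f \<equiv> Comp D g f"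

abbreviation tensor_D (infixr "\<boxtimes>" 70) where "f \<boxtimes> g \<equiv> TMor D f g"

abbreviation tens where "tens \<equiv> rep_tensor Q T"

text \<open>Since an arrow carries its source and target, being an arrow is a property of \<open>f\<close> alone.\<close>

definition arr :: "('v, 'e, 'k, 'u) qmor \<Rightarrow> bool" where
  "arr f \<longleftrightarrow> src f \<in> reps Q \<and> tgt f \<in> reps Q \<and> f \<in> rep_hom Q (src f) (tgt f)"

text \<open>The arrow from \<open>V\<close> to \<open>W\<close> with components \<open>h x\<close>; these matter only at the vertices of \<open>Q\<close>.\<close>

definition mor :: "('v, 'e, 'k, 'u) qrep \<Rightarrow> ('v, 'e, 'k, 'u) qrep \<Rightarrow> ('v \<Rightarrow> 'u \<Rightarrow> 'u) \<Rightarrow>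
    ('v, 'e, 'k, 'u) qmor" where
  "mor V W h = \<lparr> src = V, tgt = W, at_vert = (\<lambda>x\<in>verts Q. h x) \<rparr>"

lemma mor_simps [simp]:
  "src (mor V W h) = V" "tgt (mor V W h) = W" "x \<in> verts Q \<Longrightarrow> at_vert (mor V W h) x = h x"
  by (simp_all add: mor_def)

lemma arrD:
  assumes "arr f"
  shows "src f \<in> reps Q" "tgt f \<in> reps Q"
  using assms by (simp_all add: arr_def)

lemma Hom_D: "V \<in> reps Q \<Longrightarrow> W \<in> reps Q \<Longrightarrow> f \<in> Hom D V W \<longleftrightarrow> arr f \<and> src f = V \<and> tgt f = W"
  by (auto simp: rep_cat_def arr_def rep_hom_def)

lemma Obj_D [simp]: "Obj D = reps Q"
  by (simp add: rep_cat_def)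

lemma fd_sp: "V \<in> reps Q \<Longrightarrow> x \<in> verts Q \<Longrightarrow> fd_space (sp V x)"
  by (simp add: reps_def)

lemma vs_sp: "V \<in> reps Q \<Longrightarrow> x \<in> verts Q \<Longrightarrow> vectorspace class_ring (sp V x)"
  by (intro fd_vs fd_sp)

lemma act_lin: "V \<in> reps Q \<Longrightarrow> a \<in> arcs Q \<Longrightarrow> act V a \<in> lin_maps (sp V (tail Q a)) (sp V (head Q a))"
  by (simp add: reps_def)

lemma act_closed: "V \<in> reps Q \<Longrightarrow> a \<in> arcs Q \<Longrightarrow> v \<in> carrier (sp V (tail Q a)) \<Longrightarrow>
    act V a v \<in> carrier (sp V (head Q a))"
  by (rule lin_maps_closed[OF act_lin])

lemma arr_lin: "arr f \<Longrightarrow> x \<in> verts Q \<Longrightarrow> at_vert f x \<in> lin_maps (sp (src f) x) (sp (tgt f) x)"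
  by (simp add: arr_def rep_hom_def)

lemma arr_closed: "arr f \<Longrightarrow> x \<in> verts Q \<Longrightarrow> v \<in> carrier (sp (src f) x) \<Longrightarrow>
    at_vert f x v \<in> carrier (sp (tgt f) x)"
  by (rule lin_maps_closed[OF arr_lin])

lemma arr_act: "arr f \<Longrightarrow> a \<in> arcs Q \<Longrightarrow> v \<in> carrier (sp (src f) (tail Q a)) \<Longrightarrow>
    at_vert f (head Q a) (act (src f) a v) = act (tgt f) a (at_vert f (tail Q a) v)"
  by (simp add: arr_def rep_hom_def)

lemma arr_morI:
  assumes "V \<in> reps Q" "W \<in> reps Q"
    and "\<And>x. x \<in> verts Q \<Longrightarrow> h x \<in> lin_maps (sp V x) (sp W x)"
    and "\<And>a v. a \<in> arcs Q \<Longrightarrow> v \<in> carrier (sp V (tail Q a)) \<Longrightarrow>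
      h (head Q a) (act V a v) = act W a (h (tail Q a) v)"
  shows "arr (mor V W h)"
  using assms by (simp add: arr_def rep_hom_def) (simp add: mor_def)

lemma arr_ext:
  assumes f: "arr f" and g: "arr g" and st: "src f = src g" "tgt f = tgt g"
    and eq: "\<And>x v. x \<in> verts Q \<Longrightarrow> v \<in> carrier (sp (src f) x) \<Longrightarrow> at_vert f x v = at_vert g x v"
  shows "f = g"
proof -
  have "at_vert f = at_vert g"
  proof (rule extensionalityI)
    show "at_vert f \<in> extensional (verts Q)" "at_vert g \<in> extensional (verts Q)"
      using f g by (simp_all add: arr_def rep_hom_def)
    show "at_vert f x = at_vert g x" if x: "x \<in> verts Q" for x
      by (rule lin_maps_ext[OF arr_lin[OF f x] arr_lin[OF g x, folded st]]) (rule eq[OF x])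
  qed
  then show ?thesis using st by (cases f, cases g) simp
qed

declare arrD [simp]

subsection \<open>Composition\<close>

lemma comp_D_mor:
  "g ** f = mor (src f) (tgt g) (\<lambda>x. compose (carrier (sp (src f) x)) (at_vert g x) (at_vert f x))"
  by (simp add: rep_cat_def mor_def)

lemma Id_D_mor: "Id D V = mor V V (\<lambda>x. \<lambda>v\<in>carrier (sp V x). v)"
  by (simp add: rep_cat_def mor_def)

lemma comp_simps [simp]:
  "src (g ** f) = src f" "tgt (g ** f) = tgt g"
  "x \<in> verts Q \<Longrightarrow> v \<in> carrier (sp (src f) x) \<Longrightarrow> at_vert (g ** f) x v = at_vert g x (at_vert f x v)"
  by (simp_all add: comp_D_mor compose_eq)

lemma Id_simps [simp]:
  "src (Id D V) = V" "tgt (Id D V) = V"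
  "x \<in> verts Q \<Longrightarrow> v \<in> carrier (sp V x) \<Longrightarrow> at_vert (Id D V) x v = v"
  by (simp_all add: Id_D_mor)

lemma arr_comp [simp]:
  assumes f: "arr f" and g: "arr g" and [simp]: "src g = tgt f"
  shows "arr (g ** f)"
  unfolding comp_D_mor
proof (rule arr_morI)
  fix x assume x: "x \<in> verts Q"
  show "compose (carrier (sp (src f) x)) (at_vert g x) (at_vert f x) \<in> lin_maps (sp (src f) x) (sp (tgt g) x)"
    using arr_lin[OF g x] by (intro lin_maps_compose[OF vs_sp arr_lin[OF f x]]) (simp_all add: f x)
next
  fix a v assume a: "a \<in> arcs Q" and v: "v \<in> carrier (sp (src f) (tail Q a))"
  have "at_vert g (head Q a) (act (tgt f) a (at_vert f (tail Q a) v)) =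
      act (tgt g) a (at_vert g (tail Q a) (at_vert f (tail Q a) v))"
    using arr_act[OF g a] arr_closed[OF f tail_in_verts[OF a] v] by simp
  then show "compose (carrier (sp (src f) (head Q a))) (at_vert g (head Q a)) (at_vert f (head Q a)) (act (src f) a v)
      = act (tgt g) a (compose (carrier (sp (src f) (tail Q a))) (at_vert g (tail Q a)) (at_vert f (tail Q a)) v)"
    using act_closed[OF arrD(1)[OF f] a v] by (simp add: compose_eq v arr_act[OF f a v])
qed (simp_all add: f g)

lemma arr_Id [simp]: "V \<in> reps Q \<Longrightarrow> arr (Id D V)"
  unfolding Id_D_mor
  by (rule arr_morI) (simp_all add: lin_maps_id vs_sp act_closed del: restrict_apply add: restrict_apply')

lemma comp_assoc:
  assumes "arr f" "arr g" "arr h" "src g = tgt f" "src h = tgt g"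
  shows "(h ** g) ** f = h ** g ** f"
  by (rule arr_ext) (use assms arr_closed[of f] in simp_all)

lemma comp_Id_left [simp]:
  assumes "arr f" "tgt f = W"
  shows "Id D W ** f = f"
  by (rule arr_ext) (use assms arr_closed[of f] in auto)

lemma comp_Id_right [simp]:
  assumes "arr f" "src f = V"
  shows "f ** Id D V = f"
  by (rule arr_ext) (use assms in auto)

subsection \<open>Linear structure\<close>

text \<open>The scalar multiple of an arrow.\<close>

definition scale :: "'k \<Rightarrow> ('v, 'e, 'k, 'u) qmor \<Rightarrow> ('v, 'e, 'k, 'u) qmor" where
  "scale r f = mor (src f) (tgt f)
     (\<lambda>x. \<lambda>v\<in>carrier (sp (src f) x). r \<odot>\<^bsub>sp (tgt f) x\<^esub> at_vert f x v)"

lemma add_D_mor: "Add D f g = mor (src f) (tgt f)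
    (\<lambda>x. \<lambda>v\<in>carrier (sp (src f) x). at_vert f x v \<oplus>\<^bsub>sp (tgt f) x\<^esub> at_vert g x v)"
  by (simp add: rep_cat_def mor_def)

lemma add_simps [simp]:
  "src (Add D f g) = src f" "tgt (Add D f g) = tgt f"
  "x \<in> verts Q \<Longrightarrow> v \<in> carrier (sp (src f) x) \<Longrightarrow>
    at_vert (Add D f g) x v = at_vert f x v \<oplus>\<^bsub>sp (tgt f) x\<^esub> at_vert g x v"
  by (simp_all add: add_D_mor)

lemma scale_simps [simp]:
  "src (scale r f) = src f" "tgt (scale r f) = tgt f"
  "x \<in> verts Q \<Longrightarrow> v \<in> carrier (sp (src f) x) \<Longrightarrow>
    at_vert (scale r f) x v = r \<odot>\<^bsub>sp (tgt f) x\<^esub> at_vert f x v"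
  by (simp_all add: scale_def)

lemma arr_add [simp]:
  assumes f: "arr f" and g: "arr g" and st: "src g = src f" "tgt g = tgt f"
  shows "arr (Add D f g)"
  unfolding add_D_mor
proof (rule arr_morI)
  fix x assume x: "x \<in> verts Q"
  show "(\<lambda>v\<in>carrier (sp (src f) x). at_vert f x v \<oplus>\<^bsub>sp (tgt f) x\<^esub> at_vert g x v)
      \<in> lin_maps (sp (src f) x) (sp (tgt f) x)"
    using arr_lin[OF g x] arr_lin[OF f x]
    by (intro restrict_lin_maps hom_set_add vs_sp) (simp_all add: f x st lin_maps_hom)
next
  fix a v assume a: "a \<in> arcs Q" and v: "v \<in> carrier (sp (src f) (tail Q a))"
  note t = tail_in_verts[OF a]
  have v': "v \<in> carrier (sp (src g) (tail Q a))" using v st by simp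
  show "(\<lambda>v\<in>carrier (sp (src f) (head Q a)). at_vert f (head Q a) v \<oplus>\<^bsub>sp (tgt f) (head Q a)\<^esub> at_vert g (head Q a) v)
        (act (src f) a v) =
      act (tgt f) a ((\<lambda>v\<in>carrier (sp (src f) (tail Q a)). at_vert f (tail Q a) v \<oplus>\<^bsub>sp (tgt f) (tail Q a)\<^esub> at_vert g (tail Q a) v) v)"
    unfolding restrict_apply'[OF v] restrict_apply'[OF act_closed[OF arrD(1)[OF f] a v]]
    using arr_act[OF f a v] arr_act[OF g a v'] arr_closed[OF f t v] arr_closed[OF g t v']
      module_hom_classD(2)[OF lin_maps_hom[OF act_lin[OF arrD(2)[OF f] a]]]
    by (simp add: st)
qed (simp_all add: f g)

lemma arr_scale [simp]:
  assumes f: "arr f"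
  shows "arr (scale r f)"
  unfolding scale_def
proof (rule arr_morI)
  fix x assume x: "x \<in> verts Q"
  show "(\<lambda>v\<in>carrier (sp (src f) x). r \<odot>\<^bsub>sp (tgt f) x\<^esub> at_vert f x v)
      \<in> lin_maps (sp (src f) x) (sp (tgt f) x)"
    using arr_lin[OF f x]
    by (intro restrict_lin_maps hom_set_scale vs_sp) (simp_all add: f x lin_maps_hom)
next
  fix a v assume a: "a \<in> arcs Q" and v: "v \<in> carrier (sp (src f) (tail Q a))"
  show "(\<lambda>v\<in>carrier (sp (src f) (head Q a)). r \<odot>\<^bsub>sp (tgt f) (head Q a)\<^esub> at_vert f (head Q a) v)
        (act (src f) a v) =
      act (tgt f) a ((\<lambda>v\<in>carrier (sp (src f) (tail Q a)). r \<odot>\<^bsub>sp (tgt f) (tail Q a)\<^esub> at_vert f (tail Q a) v) v)"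
    unfolding restrict_apply'[OF v] restrict_apply'[OF act_closed[OF arrD(1)[OF f] a v]]
    using arr_act[OF f a v] arr_closed[OF f tail_in_verts[OF a] v]
      module_hom_classD(3)[OF lin_maps_hom[OF act_lin[OF arrD(2)[OF f] a]]]
    by simp
qed (simp_all add: f)

lemma scale_one:
  assumes "arr f"
  shows "scale 1 f = f"
  by (rule arr_ext) (use assms in \<open>simp_all add: vs_ac(4)[OF vs_sp] arr_closed\<close>)

lemma scale_scale:
  assumes "arr f"
  shows "scale r (scale s f) = scale (r * s) f"
  by (rule arr_ext) (use assms in \<open>simp_all add: vs_ac(2)[OF vs_sp] arr_closed\<close>)

lemma scale_add_left:
  assumes "arr f"
  shows "scale (r + s) f = Add D (scale r f) (scale s f)"
  by (rule arr_ext) (use assms in \<open>simp_all add: vs_ac(3)[OF vs_sp] arr_closed\<close>)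

lemma add_comp:
  assumes "arr f" "arr g" "arr h" "src g = tgt f" "src h = src g" "tgt h = tgt g"
  shows "Add D g h ** f = Add D (g ** f) (h ** f)"
  by (rule arr_ext) (use assms arr_closed[of f] in simp_all)

lemma comp_add:
  assumes f: "arr f" and "arr g" "arr h" "src h = tgt f" "src g = src f" "tgt g = tgt f"
  shows "h ** Add D f g = Add D (h ** f) (h ** g)"
proof (rule arr_ext)
  fix x v assume x: "x \<in> verts Q" and v: "v \<in> carrier (sp (src (h ** Add D f g)) x)"
  show "at_vert (h ** Add D f g) x v = at_vert (Add D (h ** f) (h ** g)) x v"
    using module_hom_classD(2)[OF lin_maps_hom[OF arr_lin[of h x]]] assms x v arr_closed[of f x v] arr_closed[of g x v]
    by simp
qed (use assms in simp_all)

lemma scale_comp: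
  assumes "arr f" "arr g" "src g = tgt f"
  shows "scale r g ** f = scale r (g ** f)"
  by (rule arr_ext) (use assms arr_closed[of f] in simp_all)

lemma comp_scale:
  assumes "arr f" "arr g" "src g = tgt f"
  shows "g ** scale r f = scale r (g ** f)"
proof (rule arr_ext)
  fix x v assume x: "x \<in> verts Q" and v: "v \<in> carrier (sp (src (g ** scale r f)) x)"
  show "at_vert (g ** scale r f) x v = at_vert (scale r (g ** f)) x v"
    using module_hom_classD(3)[OF lin_maps_hom[OF arr_lin[of g x]]] assms x v arr_closed[of f x v]
    by simp
qed (use assms in simp_all)

text \<open>An additive idempotent is the zero arrow, here written as \<open>scale 0 f\<close>.\<close>

lemma add_cancel:
  assumes f: "arr f" and eq: "Add D f f = f"
  shows "f = scale 0 f"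
proof (rule arr_ext)
  fix x v assume x: "x \<in> verts Q" and v: "v \<in> carrier (sp (src f) x)"
  let ?W = "sp (tgt f) x"
  note vs = vs_sp[OF arrD(2)[OF f] x]
  interpret W: Module.module class_ring ?W by (rule module_class[OF vs])
  have c: "at_vert f x v \<in> carrier ?W" by (rule arr_closed[OF f x v])
  have "at_vert (Add D f f) x v = at_vert f x v" using eq by simp
  then have "at_vert f x v \<oplus>\<^bsub>?W\<^esub> at_vert f x v = at_vert f x v" using x v by simp
  then have "at_vert f x v = \<zero>\<^bsub>?W\<^esub>" using c W.add.l_cancel_one[OF c c] by simp
  then show "at_vert f x v = at_vert (scale 0 f) x v" using x v vs_ac(5)[OF vs c] by simp
qed (use f in simp_all)

subsection \<open>Tensor products\<close>

lemma TObj_D [simp]: "TObj D = tens" by (simp add: rep_cat_def)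

lemma rep_tensor_simps [simp]:
  "x \<in> verts Q \<Longrightarrow> sp (tens V W) x = tspace T (sp V x) (sp W x)"
  "a \<in> arcs Q \<Longrightarrow> act (tens V W) a = tensor_map T (sp V (tail Q a)) (sp W (tail Q a))
                (sp V (head Q a)) (sp W (head Q a)) (act V a) (act W a)"
  by (simp_all add: rep_tensor_def)

lemma rep_tensor_reps [simp]:
  assumes V: "V \<in> reps Q" and W: "W \<in> reps Q"
  shows "tens V W \<in> reps Q"
proof -
  have "tensor_map T (sp V (tail Q a)) (sp W (tail Q a)) (sp V (head Q a)) (sp W (head Q a)) (act V a) (act W a)
      \<in> lin_maps (tspace T (sp V (tail Q a)) (sp W (tail Q a))) (tspace T (sp V (head Q a)) (sp W (head Q a)))"
    if a: "a \<in> arcs Q" for a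
    by (intro tensor_map_spec fd_sp V W act_lin a tail_in_verts head_in_verts)
  moreover have "fd_space (sp (tens V W) x)" if x: "x \<in> verts Q" for x
    using fd_tspace[OF fd_sp[OF V x] fd_sp[OF W x]] x by simp
  moreover have "sp (tens V W) \<in> extensional (verts Q)"
    "act (tens V W) \<in> extensional (arcs Q)" by (simp_all add: rep_tensor_def)
  ultimately show ?thesis
    unfolding reps_def mem_Collect_eq by (intro conjI ballI) (simp_all only: rep_tensor_simps tail_in_verts head_in_verts)
qed

lemma tensor_D_mor: "f \<boxtimes> g = mor (tens (src f) (src g)) (tens (tgt f) (tgt g))
    (\<lambda>x. tensor_map T (sp (src f) x) (sp (src g) x) (sp (tgt f) x) (sp (tgt g) x) (at_vert f x) (at_vert g x))"
  by (simp add: rep_cat_def mor_def)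

lemma tensor_simps [simp]:
  "src (f \<boxtimes> g) = tens (src f) (src g)" "tgt (f \<boxtimes> g) = tens (tgt f) (tgt g)"
  "x \<in> verts Q \<Longrightarrow> at_vert (f \<boxtimes> g) x =
     tensor_map T (sp (src f) x) (sp (src g) x) (sp (tgt f) x) (sp (tgt g) x) (at_vert f x) (at_vert g x)"
  by (simp_all add: tensor_D_mor)

lemma arr_tensor [simp]:
  assumes f: "arr f" and g: "arr g"
  shows "arr (f \<boxtimes> g)"
  unfolding tensor_D_mor
proof (rule arr_morI)
  let ?h = "\<lambda>x. tensor_map T (sp (src f) x) (sp (src g) x) (sp (tgt f) x) (sp (tgt g) x) (at_vert f x) (at_vert g x)"
  let ?S = "\<lambda>x. tspace T (sp (src f) x) (sp (src g) x)" and ?T = "\<lambda>x. tspace T (sp (tgt f) x) (sp (tgt g) x)"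
  note fd = fd_sp[OF arrD(1)[OF f]] fd_sp[OF arrD(1)[OF g]] fd_sp[OF arrD(2)[OF f]] fd_sp[OF arrD(2)[OF g]]
  have h: "?h x \<in> lin_maps (?S x) (?T x)" if x: "x \<in> verts Q" for x
    by (rule tensor_map_spec(1)[OF fd[OF x] arr_lin[OF f x] arr_lin[OF g x]])
  then show "?h x \<in> lin_maps (sp (tens (src f) (src g)) x) (sp (tens (tgt f) (tgt g)) x)"
    if x: "x \<in> verts Q" for x using that by simp
  fix a v assume a: "a \<in> arcs Q" and v: "v \<in> carrier (sp (tens (src f) (src g)) (tail Q a))"
  let ?t = "tail Q a" and ?d = "head Q a"
  note t = tail_in_verts[OF a] and d = head_in_verts[OF a]
  note s1 = arrD(1)[OF f] and s2 = arrD(1)[OF g] and t1 = arrD(2)[OF f] and t2 = arrD(2)[OF g]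
  note A = tensor_map_spec[OF fd(1,2)[OF t] fd(1,2)[OF d] act_lin[OF s1 a] act_lin[OF s2 a]]
  note B = tensor_map_spec[OF fd(3,4)[OF t] fd(3,4)[OF d] act_lin[OF t1 a] act_lin[OF t2 a]]
  note ht = tensor_map_spec(2)[OF fd[OF t] arr_lin[OF f t] arr_lin[OF g t]]
  note hd = tensor_map_spec(2)[OF fd[OF d] arr_lin[OF f d] arr_lin[OF g d]]
  have v': "v \<in> carrier (?S ?t)" using v t by simp
  have "?h ?d (tensor_map T (sp (src f) ?t) (sp (src g) ?t) (sp (src f) ?d) (sp (src g) ?d) (act (src f) a) (act (src g) a) v)
    = tensor_map T (sp (tgt f) ?t) (sp (tgt g) ?t) (sp (tgt f) ?d) (sp (tgt g) ?d) (act (tgt f) a) (act (tgt g) a) (?h ?t v)"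
    by (rule tensor_ext[OF fd(1,2)[OF t] vs_tspace[OF fd(3,4)[OF d]]
          module_hom_comp[OF A(1)[THEN lin_maps_hom] h[OF d, THEN lin_maps_hom]]
          module_hom_comp[OF h[OF t, THEN lin_maps_hom] B(1)[THEN lin_maps_hom]] _ v'])
      (simp add: A(2) B(2) ht hd arr_act[OF f a] arr_act[OF g a] act_closed[OF s1 a] act_closed[OF s2 a]
        arr_closed[OF f t] arr_closed[OF g t])
  then show "?h ?d (act (tens (src f) (src g)) a v) = act (tens (tgt f) (tgt g)) a (?h ?t v)"
    using a by simp
qed (use f g in simp_all)

lemma tensor_comp:
  assumes "arr f" "arr g" "arr f'" "arr g'" "src f' = tgt f" "src g' = tgt g"
  shows "(f' \<boxtimes> g') ** (f \<boxtimes> g) = (f' ** f) \<boxtimes> (g' ** g)"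
proof (rule arr_ext)
  fix x v assume x: "x \<in> verts Q" and v: "v \<in> carrier (sp (src ((f' \<boxtimes> g') ** (f \<boxtimes> g))) x)"
  have eq: "at_vert (f' ** f) x = compose (carrier (sp (src f) x)) (at_vert f' x) (at_vert f x)"
      "at_vert (g' ** g) x = compose (carrier (sp (src g) x)) (at_vert g' x) (at_vert g x)"
    using x by (simp_all add: comp_D_mor)
  have "compose (carrier (tspace T (sp (src f) x) (sp (src g) x)))
      (tensor_map T (sp (tgt f) x) (sp (tgt g) x) (sp (tgt f') x) (sp (tgt g') x) (at_vert f' x) (at_vert g' x))
      (tensor_map T (sp (src f) x) (sp (src g) x) (sp (tgt f) x) (sp (tgt g) x) (at_vert f x) (at_vert g x))
    = tensor_map T (sp (src f) x) (sp (src g) x) (sp (tgt f') x) (sp (tgt g') x)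
       (at_vert (f' ** f) x) (at_vert (g' ** g) x)"
    unfolding eq using assms x arr_lin[of f x] arr_lin[of g x] arr_lin[of f' x] arr_lin[of g' x]
    by (intro tensor_map_comp fd_sp) simp_all
  from fun_cong[OF this, of v]
  show "at_vert ((f' \<boxtimes> g') ** (f \<boxtimes> g)) x v = at_vert ((f' ** f) \<boxtimes> (g' ** g)) x v"
    using x v assms by (simp add: compose_eq)
qed (use assms in simp_all)

lemma tensor_Id [simp]:
  assumes "V \<in> reps Q" "W \<in> reps Q"
  shows "Id D V \<boxtimes> Id D W = Id D (tens V W)"
proof (rule arr_ext)
  fix x v assume x: "x \<in> verts Q" and v: "v \<in> carrier (sp (src (Id D V \<boxtimes> Id D W)) x)"
  have "at_vert (Id D U) x = (\<lambda>v\<in>carrier (sp U x). v)" for U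
    using x by (simp only: Id_D_mor mor_simps)
  then show "at_vert (Id D V \<boxtimes> Id D W) x v = at_vert (Id D (tens V W)) x v"
    using x v tensor_map_id[OF fd_sp[OF assms(1) x] fd_sp[OF assms(2) x]] by simp
qed (use assms in simp_all)

lemma Assoc_D_mor: "Assoc D X Y Z = mor (tens X (tens Y Z))
    (tens (tens X Y) Z) (\<lambda>x. assoc_map T (sp X x) (sp Y x) (sp Z x))"
  by (simp add: rep_cat_def mor_def)

lemma Braid_D_mor: "Braid D X Y = mor (tens X Y) (tens Y X)
    (\<lambda>x. braid_map T (sp X x) (sp Y x))"
  by (simp add: rep_cat_def mor_def)

lemma Assoc_simps [simp]:
  "src (Assoc D X Y Z) = tens X (tens Y Z)"
  "tgt (Assoc D X Y Z) = tens (tens X Y) Z"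
  "x \<in> verts Q \<Longrightarrow> at_vert (Assoc D X Y Z) x = assoc_map T (sp X x) (sp Y x) (sp Z x)"
  by (simp_all add: Assoc_D_mor)

lemma Braid_simps [simp]:
  "src (Braid D X Y) = tens X Y" "tgt (Braid D X Y) = tens Y X"
  "x \<in> verts Q \<Longrightarrow> at_vert (Braid D X Y) x = braid_map T (sp X x) (sp Y x)"
  by (simp_all add: Braid_D_mor)

lemma arr_Assoc [simp]:
  assumes "X \<in> reps Q" "Y \<in> reps Q" "Z \<in> reps Q"
  shows "arr (Assoc D X Y Z)"
  unfolding Assoc_D_mor
proof (rule arr_morI)
  fix a v assume a: "a \<in> arcs Q" and v: "v \<in> carrier (sp (tens X (tens Y Z)) (tail Q a))"
  then show "assoc_map T (sp X (head Q a)) (sp Y (head Q a)) (sp Z (head Q a)) (act (tens X (tens Y Z)) a v) =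
      act (tens (tens X Y) Z) a (assoc_map T (sp X (tail Q a)) (sp Y (tail Q a)) (sp Z (tail Q a)) v)"
    using tail_in_verts[OF a] head_in_verts[OF a]
    by (simp add: assoc_map_natural fd_sp assms act_lin)
qed (use assms in \<open>simp_all add: assoc_spec fd_sp\<close>)

lemma arr_Braid [simp]:
  assumes "X \<in> reps Q" "Y \<in> reps Q"
  shows "arr (Braid D X Y)"
  unfolding Braid_D_mor
proof (rule arr_morI)
  fix a v assume a: "a \<in> arcs Q" and v: "v \<in> carrier (sp (tens X Y) (tail Q a))"
  then show "braid_map T (sp X (head Q a)) (sp Y (head Q a)) (act (tens X Y) a v) =
      act (tens Y X) a (braid_map T (sp X (tail Q a)) (sp Y (tail Q a)) v)"
    using tail_in_verts[OF a] head_in_verts[OF a]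
    by (simp add: braid_map_natural fd_sp assms act_lin)
qed (use assms in \<open>simp_all add: braid_spec fd_sp\<close>)

lemma Assoc_natural:
  assumes "arr f" "arr g" "arr h"
  shows "Assoc D (tgt f) (tgt g) (tgt h) ** (f \<boxtimes> g \<boxtimes> h) =
    ((f \<boxtimes> g) \<boxtimes> h) ** Assoc D (src f) (src g) (src h)"
  by (rule arr_ext) (use assms in \<open>simp_all add: assoc_map_natural fd_sp arr_lin\<close>)

text \<open>An arrow that is bijective at each vertex is invertible.\<close>

lemma invertible_if_pointwise:
  assumes f: "arr f"
    and inv: "\<And>x. x \<in> verts Q \<Longrightarrow> \<exists>k\<in>lin_maps (sp (tgt f) x) (sp (src f) x).
      (\<forall>v\<in>carrier (sp (src f) x). k (at_vert f x v) = v) \<and>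
      (\<forall>w\<in>carrier (sp (tgt f) x). at_vert f x (k w) = w)"
  obtains g where "arr g" "src g = tgt f" "tgt g = src f" "g ** f = Id D (src f)" "f ** g = Id D (tgt f)"
proof -
  obtain k where k: "\<And>x. x \<in> verts Q \<Longrightarrow> k x \<in> lin_maps (sp (tgt f) x) (sp (src f) x)"
    and kl: "\<And>x v. x \<in> verts Q \<Longrightarrow> v \<in> carrier (sp (src f) x) \<Longrightarrow> k x (at_vert f x v) = v"
    and kr: "\<And>x w. x \<in> verts Q \<Longrightarrow> w \<in> carrier (sp (tgt f) x) \<Longrightarrow> at_vert f x (k x w) = w"
    using inv by metis
  have kc: "k x w \<in> carrier (sp (src f) x)" if "x \<in> verts Q" "w \<in> carrier (sp (tgt f) x)" for x w
    using lin_maps_closed[OF k] that .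
  let ?g = "mor (tgt f) (src f) k"
  have g: "arr ?g"
  proof (rule arr_morI)
    fix a w assume a: "a \<in> arcs Q" and w: "w \<in> carrier (sp (tgt f) (tail Q a))"
    note t = tail_in_verts[OF a] and h = head_in_verts[OF a]
    have "k (head Q a) (act (tgt f) a w) = k (head Q a) (act (tgt f) a (at_vert f (tail Q a) (k (tail Q a) w)))"
      by (simp add: kr t w)
    also have "\<dots> = k (head Q a) (at_vert f (head Q a) (act (src f) a (k (tail Q a) w)))"
      by (simp add: arr_act f a kc t w)
    also have "\<dots> = act (src f) a (k (tail Q a) w)"
      by (rule kl[OF h act_closed[OF _ a kc[OF t w]]]) (simp add: f)
    finally show "k (head Q a) (act (tgt f) a w) = act (src f) a (k (tail Q a) w)" .
  qed (simp_all add: f k)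
  show ?thesis
  proof (rule that[OF g])
    show "?g ** f = Id D (src f)" by (rule arr_ext) (simp_all add: f g kl)
    show "f ** ?g = Id D (tgt f)" by (rule arr_ext) (simp_all add: f g kr)
  qed simp_all
qed

lemma Assoc_inverse:
  assumes "X \<in> reps Q" "Y \<in> reps Q" "Z \<in> reps Q"
  obtains k where "arr k" "src k = tgt (Assoc D X Y Z)" "tgt k = src (Assoc D X Y Z)"
    "k ** Assoc D X Y Z = Id D (src (Assoc D X Y Z))" "Assoc D X Y Z ** k = Id D (tgt (Assoc D X Y Z))"
proof (rule invertible_if_pointwise[OF arr_Assoc[OF assms]])
  fix x assume x: "x \<in> verts Q"
  show "\<exists>k\<in>lin_maps (sp (tgt (Assoc D X Y Z)) x) (sp (src (Assoc D X Y Z)) x).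
      (\<forall>v\<in>carrier (sp (src (Assoc D X Y Z)) x). k (at_vert (Assoc D X Y Z) x v) = v) \<and>
      (\<forall>w\<in>carrier (sp (tgt (Assoc D X Y Z)) x). at_vert (Assoc D X Y Z) x (k w) = w)"
    by (rule assoc_inverse[OF fd_sp[OF assms(1) x] fd_sp[OF assms(2) x] fd_sp[OF assms(3) x]])
      (intro bexI conjI ballI; simp add: x)
qed (rule that)

lemma Braid_Braid:
  assumes "X \<in> reps Q" "Y \<in> reps Q"
  shows "Braid D Y X ** Braid D X Y = Id D (tens X Y)"
  by (rule arr_ext) (use assms in \<open>simp_all add: braid_braid fd_sp\<close>)

end

section \<open>Tensor powers and Schur functors of representations\<close>

context quiver_reps
begin

lemma Unit_simps [simp]:
  "x \<in> verts Q \<Longrightarrow> sp (Unit D) x = line T"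
  "a \<in> arcs Q \<Longrightarrow> act (Unit D) a = (\<lambda>v\<in>carrier (line T). v)"
  by (simp_all add: rep_cat_def)

lemma Unit_reps [simp]: "Unit D \<in> reps Q"
proof -
  have "act (Unit D) a \<in> lin_maps (sp (Unit D) (tail Q a)) (sp (Unit D) (head Q a))" if "a \<in> arcs Q" for a
    unfolding Unit_simps(1)[OF tail_in_verts[OF that]] Unit_simps(1)[OF head_in_verts[OF that]]
      Unit_simps(2)[OF that]
    by (rule lin_maps_id[OF fd_vs[OF fd_line]])
  moreover have "sp (Unit D) \<in> extensional (verts Q)" "act (Unit D) \<in> extensional (arcs Q)"
    by (simp_all add: rep_cat_def)
  ultimately show ?thesis
    unfolding reps_def mem_Collect_eq by (intro conjI ballI) (simp_all only: Unit_simps(1) fd_line)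
qed

text \<open>Tensor powers of representations; they are the tensor powers of vector spaces at each vertex.\<close>

primrec rep_tpow :: "('v, 'e, 'k, 'u) qrep \<Rightarrow> nat \<Rightarrow> ('v, 'e, 'k, 'u) qrep" where
  "rep_tpow V 0 = Unit D"
| "rep_tpow V (Suc n) = tens (rep_tpow V n) V"

lemma rep_tpow_reps [simp]: "V \<in> reps Q \<Longrightarrow> rep_tpow V n \<in> reps Q"
  by (induction n) simp_all

lemma sp_rep_tpow [simp]: "x \<in> verts Q \<Longrightarrow> sp (rep_tpow V n) x = tpow T (sp V x) n"
  by (induction n) simp_all

lemma act_rep_tpow [simp]: "a \<in> arcs Q \<Longrightarrow>
    act (rep_tpow V n) a = tpow_map T (sp V (tail Q a)) (sp V (head Q a)) (act V a) n"
  by (induction n) (simp_all add: tail_in_verts head_in_verts)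

text \<open>The tensor powers of an arrow.\<close>

definition tpow_mor :: "('v, 'e, 'k, 'u) qmor \<Rightarrow> nat \<Rightarrow> ('v, 'e, 'k, 'u) qmor" where
  "tpow_mor f n = mor (rep_tpow (src f) n) (rep_tpow (tgt f) n)
     (\<lambda>x. tpow_map T (sp (src f) x) (sp (tgt f) x) (at_vert f x) n)"

lemma mor_cong: "(\<And>x. x \<in> verts Q \<Longrightarrow> h x = k x) \<Longrightarrow> mor V W h = mor V W k"
  unfolding mor_def by (auto simp: fun_eq_iff)

lemma tpow_mor_0: "tpow_mor f 0 = Id D (Unit D)"
  unfolding tpow_mor_def Id_D_mor rep_tpow.simps by (rule mor_cong) simp

lemma tpow_mor_Suc: "tpow_mor f (Suc n) = tpow_mor f n \<boxtimes> f"
  unfolding tpow_mor_def tensor_D_mor rep_tpow.simps mor_simps by (rule mor_cong) simp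

lemma tpow_mor_simps [simp]:
  "src (tpow_mor f n) = rep_tpow (src f) n" "tgt (tpow_mor f n) = rep_tpow (tgt f) n"
  "x \<in> verts Q \<Longrightarrow> at_vert (tpow_mor f n) x = tpow_map T (sp (src f) x) (sp (tgt f) x) (at_vert f x) n"
  by (simp_all add: tpow_mor_def)

lemma arr_tpow_mor [simp]: "arr f \<Longrightarrow> arr (tpow_mor f n)"
  by (induction n) (simp_all add: tpow_mor_0 tpow_mor_Suc)

subsection \<open>The group algebra acting on tensor powers\<close>

text \<open>The group algebra acts on tensor powers by arrows of representations; \<open>perm_mor\<close> below is the
  action of a single permutation.\<close>

definition alg_mor :: "('v, 'e, 'k, 'u) qrep \<Rightarrow> nat \<Rightarrow> ((nat \<Rightarrow> nat) \<Rightarrow> rat) \<Rightarrow> ('v, 'e, 'k, 'u) qmor" where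
  "alg_mor V n a = mor (rep_tpow V n) (rep_tpow V n) (\<lambda>x. alg_map T (sp V x) n a)"

lemma alg_mor_simps [simp]:
  "src (alg_mor V n a) = rep_tpow V n" "tgt (alg_mor V n a) = rep_tpow V n"
  "x \<in> verts Q \<Longrightarrow> at_vert (alg_mor V n a) x = alg_map T (sp V x) n a"
  by (simp_all add: alg_mor_def)

lemma arr_alg_mor [simp]:
  assumes V: "V \<in> reps Q"
  shows "arr (alg_mor V n a)"
  unfolding alg_mor_def
proof (rule arr_morI)
  fix b v assume b: "b \<in> arcs Q" and v: "v \<in> carrier (sp (rep_tpow V n) (tail Q b))"
  then show "alg_map T (sp V (head Q b)) n a (act (rep_tpow V n) b v) =
      act (rep_tpow V n) b (alg_map T (sp V (tail Q b)) n a v)"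
    using tail_in_verts[OF b] head_in_verts[OF b] by (simp add: alg_map_natural fd_sp V act_lin)
qed (simp_all add: V alg_map_lin fd_sp)

lemma alg_mor_comp:
  assumes V: "V \<in> reps Q"
  shows "alg_mor V n a ** alg_mor V n b = alg_mor V n (conv {..<n} b a)"
  by (rule arr_ext) (simp_all add: V alg_map_conv fd_sp)

lemma alg_mor_cong:
  assumes V: "V \<in> reps Q" and "\<And>\<sigma>. \<sigma> permutes {..<n} \<Longrightarrow> a \<sigma> = b \<sigma>"
  shows "alg_mor V n a = alg_mor V n b"
  unfolding alg_mor_def by (rule mor_cong, rule alg_map_cong[OF assms(2) fd_sp[OF V]])

lemma alg_mor_add:
  assumes V: "V \<in> reps Q"
  shows "alg_mor V n (\<lambda>\<sigma>. a \<sigma> + b \<sigma>) = Add D (alg_mor V n a) (alg_mor V n b)"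
  by (rule arr_ext) (simp_all add: V alg_map_add fd_sp)

lemma alg_mor_scale:
  assumes V: "V \<in> reps Q"
  shows "alg_mor V n (\<lambda>\<sigma>. r * a \<sigma>) = scale (of_rat r) (alg_mor V n a)"
  by (rule arr_ext) (simp_all add: V alg_map_scale fd_sp)

lemma alg_mor_natural:
  assumes f: "arr f" and n: "src f = V" "tgt f = W"
  shows "alg_mor W n a ** tpow_mor f n = tpow_mor f n ** alg_mor V n a"
proof (rule arr_ext)
  fix x v assume x: "x \<in> verts Q" and v: "v \<in> carrier (sp (src (alg_mor W n a ** tpow_mor f n)) x)"
  have "v \<in> carrier (tpow T (sp V x) n)" using x v n by simp
  then show "at_vert (alg_mor W n a ** tpow_mor f n) x v = at_vert (tpow_mor f n ** alg_mor V n a) x v"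
    using alg_map_natural[OF fd_sp[OF arrD(1)[OF f] x] fd_sp[OF arrD(2)[OF f] x] arr_lin[OF f x]] x n
    by simp
qed (use f in \<open>simp_all flip: n\<close>)

definition perm_mor :: "('v, 'e, 'k, 'u) qrep \<Rightarrow> nat \<Rightarrow> (nat \<Rightarrow> nat) \<Rightarrow> ('v, 'e, 'k, 'u) qmor" where
  "perm_mor V n \<sigma> = alg_mor V n (\<lambda>\<tau>. if \<tau> = \<sigma> then 1 else 0)"

lemma perm_mor_simps [simp]:
  "src (perm_mor V n a) = rep_tpow V n" "tgt (perm_mor V n a) = rep_tpow V n"
  by (simp_all add: perm_mor_def)

lemma at_perm_mor [simp]:
  assumes "V \<in> reps Q" "\<sigma> permutes {..<n}" "x \<in> verts Q"
  shows "at_vert (perm_mor V n \<sigma>) x = perm_map T (sp V x) n \<sigma>"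
  using alg_map_delta[OF fd_sp[OF assms(1,3)] assms(2)] assms(3) by (simp add: perm_mor_def)

lemma arr_perm_mor [simp]: "V \<in> reps Q \<Longrightarrow> arr (perm_mor V n \<sigma>)"
  by (simp add: perm_mor_def)

lemma perm_mor_id:
  assumes V: "V \<in> reps Q"
  shows "perm_mor V n id = Id D (rep_tpow V n)"
  by (rule arr_ext) (simp_all add: V permutes_id perm_map_id fd_sp)

lemma perm_mor_comp:
  assumes V: "V \<in> reps Q" and s: "\<sigma> permutes {..<n}" and t: "\<tau> permutes {..<n}"
  shows "perm_mor V n \<sigma> ** perm_mor V n \<tau> = perm_mor V n (\<tau> \<circ> \<sigma>)"
  by (rule arr_ext) (simp_all add: V s t permutes_compose[OF s t] perm_map_compose[OF _ s t] fd_sp del: o_apply)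

lemma perm_mor_lower:
  assumes V: "V \<in> reps Q" and i: "Suc i < n"
  shows "perm_mor V (Suc n) (adj i) =
    perm_mor V n (adj i) \<boxtimes> Id D V"
proof (rule arr_ext)
  let ?s = "adj i"
  have s: "?s permutes {..<n}" "?s permutes {..<Suc n}" using i by (auto intro!: permutes_swap_id)
  fix x v assume x: "x \<in> verts Q"
  have "at_vert (Id D V) x = (\<lambda>v\<in>carrier (sp V x). v)" using x by (simp only: Id_D_mor mor_simps)
  then show "at_vert (perm_mor V (Suc n) ?s) x v = at_vert (perm_mor V n ?s \<boxtimes> Id D V) x v"
    using x by (simp only: at_perm_mor[OF V s(1)] at_perm_mor[OF V s(2)] perm_map_lower[OF fd_sp[OF V x] i]
        tensor_simps Id_simps perm_mor_simps sp_rep_tpow)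
qed (simp_all add: V)

lemma perm_mor_top:
  assumes V: "V \<in> reps Q"
  shows "perm_mor V (Suc (Suc n)) (adj n) ** Assoc D (rep_tpow V n) V V =
    Assoc D (rep_tpow V n) V V ** (Id D (rep_tpow V n) \<boxtimes> Braid D V V)"
proof (rule arr_ext)
  let ?s = "adj n"
  have s: "?s permutes {..<Suc (Suc n)}" by (auto intro!: permutes_swap_id)
  fix x v assume x: "x \<in> verts Q"
    and v: "v \<in> carrier (sp (src (perm_mor V (Suc (Suc n)) ?s ** Assoc D (rep_tpow V n) V V)) x)"
  have v': "v \<in> carrier (tspace T (tpow T (sp V x) n) (tspace T (sp V x) (sp V x)))" using x v by simp
  have "at_vert (Id D U) x = (\<lambda>v\<in>carrier (sp U x). v)" for U using x by (simp only: Id_D_mor mor_simps)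
  then show "at_vert (perm_mor V (Suc (Suc n)) ?s ** Assoc D (rep_tpow V n) V V) x v =
      at_vert (Assoc D (rep_tpow V n) V V ** (Id D (rep_tpow V n) \<boxtimes> Braid D V V)) x v"
    using perm_map_top[OF fd_sp[OF V x] v'] x v'
    by (simp add: at_perm_mor[OF V s x] del: tpow.simps restrict_apply)
qed (simp_all add: V)

subsection \<open>Schur functors\<close>

abbreviation schur_mor :: "nat list \<Rightarrow> ('v, 'e, 'k, 'u) qmor \<Rightarrow> ('v, 'e, 'k, 'u) qmor" where
  "schur_mor \<mu> \<equiv> on_arr (schur_functor Q T \<mu>)"

lemma on_obj_schur [simp]: "on_obj (schur_functor Q T \<mu>) = schur_rep Q T \<mu>"
  by (simp add: schur_functor_def)

lemma schur_rep_simps [simp]: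
  "x \<in> verts Q \<Longrightarrow> sp (schur_rep Q T \<mu> V) x = schur_space T \<mu> (sp V x)"
  "a \<in> arcs Q \<Longrightarrow> act (schur_rep Q T \<mu> V) a =
     schur_map T \<mu> (sp V (tail Q a)) (sp V (head Q a)) (act V a)"
  by (simp_all add: schur_rep_def)

lemma schur_rep_reps [simp]:
  assumes V: "V \<in> reps Q"
  shows "schur_rep Q T \<mu> V \<in> reps Q"
proof -
  have "fd_space (sp (schur_rep Q T \<mu> V) x)" if x: "x \<in> verts Q" for x
    using fd_schur_space[OF fd_sp[OF V x]] x by simp
  moreover have "act (schur_rep Q T \<mu> V) a \<in>
      lin_maps (sp (schur_rep Q T \<mu> V) (tail Q a)) (sp (schur_rep Q T \<mu> V) (head Q a))"
    if a: "a \<in> arcs Q" for a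
    using schur_map_lin[OF fd_sp[OF V tail_in_verts[OF a]] fd_sp[OF V head_in_verts[OF a]] act_lin[OF V a]]
      a tail_in_verts[OF a] head_in_verts[OF a] by simp
  moreover have "sp (schur_rep Q T \<mu> V) \<in> extensional (verts Q)"
    "act (schur_rep Q T \<mu> V) \<in> extensional (arcs Q)" by (simp_all add: schur_rep_def)
  ultimately show ?thesis unfolding reps_def mem_Collect_eq by blast
qed

lemma schur_mor_mor: "schur_mor \<mu> f = mor (schur_rep Q T \<mu> (src f)) (schur_rep Q T \<mu> (tgt f))
    (\<lambda>x. schur_map T \<mu> (sp (src f) x) (sp (tgt f) x) (at_vert f x))"
  by (simp add: schur_functor_def mor_def)

lemma schur_mor_simps [simp]:
  "src (schur_mor \<mu> f) = schur_rep Q T \<mu> (src f)" "tgt (schur_mor \<mu> f) = schur_rep Q T \<mu> (tgt f)"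
  "x \<in> verts Q \<Longrightarrow> v \<in> carrier (schur_space T \<mu> (sp (src f) x)) \<Longrightarrow>
     at_vert (schur_mor \<mu> f) x v = at_vert (tpow_mor f (sum_list \<mu>)) x v"
  by (simp_all add: schur_mor_mor schur_map_def)

text \<open>The Young symmetrizer acts on the tensor power of \<open>V\<close> as the map \<open>proj\<close> onto the Schur functor
  followed by the inclusion \<open>incl\<close>.\<close>

definition incl :: "nat list \<Rightarrow> ('v, 'e, 'k, 'u) qrep \<Rightarrow> ('v, 'e, 'k, 'u) qmor" where
  "incl \<mu> V = mor (schur_rep Q T \<mu> V) (rep_tpow V (sum_list \<mu>))
     (\<lambda>x. \<lambda>v\<in>carrier (schur_space T \<mu> (sp V x)). v)"

definition proj :: "nat list \<Rightarrow> ('v, 'e, 'k, 'u) qrep \<Rightarrow> ('v, 'e, 'k, 'u) qmor" where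
  "proj \<mu> V = mor (rep_tpow V (sum_list \<mu>)) (schur_rep Q T \<mu> V)
     (\<lambda>x. alg_map T (sp V x) (sum_list \<mu>) (young_element \<mu>))"

lemma incl_simps [simp]:
  "src (incl \<mu> V) = schur_rep Q T \<mu> V" "tgt (incl \<mu> V) = rep_tpow V (sum_list \<mu>)"
  "x \<in> verts Q \<Longrightarrow> v \<in> carrier (schur_space T \<mu> (sp V x)) \<Longrightarrow> at_vert (incl \<mu> V) x v = v"
  by (simp_all add: incl_def)

lemma proj_simps [simp]:
  "src (proj \<mu> V) = rep_tpow V (sum_list \<mu>)" "tgt (proj \<mu> V) = schur_rep Q T \<mu> V"
  "x \<in> verts Q \<Longrightarrow> at_vert (proj \<mu> V) x = alg_map T (sp V x) (sum_list \<mu>) (young_element \<mu>)"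
  by (simp_all add: proj_def)

lemma schur_space_sub: "V \<in> reps Q \<Longrightarrow> x \<in> verts Q \<Longrightarrow> v \<in> carrier (schur_space T \<mu> (sp V x)) \<Longrightarrow>
    v \<in> carrier (tpow T (sp V x) (sum_list \<mu>))"
  using schur_space_subset[OF fd_sp] by blast

lemma schur_map_eq:
  "v \<in> carrier (schur_space T \<mu> U) \<Longrightarrow> schur_map T \<mu> U V f v = tpow_map T U V f (sum_list \<mu>) v"
  by (simp add: schur_map_def)

lemma arr_incl [simp]:
  assumes V: "V \<in> reps Q"
  shows "arr (incl \<mu> V)"
  unfolding incl_def
proof (rule arr_morI)
  fix a v assume a: "a \<in> arcs Q" and v: "v \<in> carrier (sp (schur_rep Q T \<mu> V) (tail Q a))"
  note t = tail_in_verts[OF a] and h = head_in_verts[OF a]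
  have "act (schur_rep Q T \<mu> V) a v \<in> carrier (schur_space T \<mu> (sp V (head Q a)))"
    using act_closed[OF schur_rep_reps[OF V] a v] h by simp
  then show "(\<lambda>v\<in>carrier (schur_space T \<mu> (sp V (head Q a))). v) (act (schur_rep Q T \<mu> V) a v) =
      act (rep_tpow V (sum_list \<mu>)) a ((\<lambda>v\<in>carrier (schur_space T \<mu> (sp V (tail Q a))). v) v)"
    using v t a by (simp add: schur_map_eq)
qed (simp_all add: V schur_inclusion_lin fd_sp del: restrict_apply)

lemma arr_proj [simp]:
  assumes V: "V \<in> reps Q"
  shows "arr (proj \<mu> V)"
  unfolding proj_def
proof (rule arr_morI)
  fix a v assume a: "a \<in> arcs Q" and v: "v \<in> carrier (sp (rep_tpow V (sum_list \<mu>)) (tail Q a))"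
  note t = tail_in_verts[OF a] and h = head_in_verts[OF a]
  have "alg_map T (sp V (tail Q a)) (sum_list \<mu>) (young_element \<mu>) v \<in>
      carrier (schur_space T \<mu> (sp V (tail Q a)))"
    using v t by (simp add: carrier_schur_space fd_sp V)
  then show "alg_map T (sp V (head Q a)) (sum_list \<mu>) (young_element \<mu>) (act (rep_tpow V (sum_list \<mu>)) a v) =
      act (schur_rep Q T \<mu> V) a (alg_map T (sp V (tail Q a)) (sum_list \<mu>) (young_element \<mu>) v)"
    using v t h a by (simp add: schur_map_eq alg_map_natural fd_sp V act_lin)
qed (simp_all add: V schur_projection_lin fd_sp)

lemma arr_schur_mor [simp]:
  assumes f: "arr f"
  shows "arr (schur_mor \<mu> f)"
  unfolding schur_mor_mor
proof (rule arr_morI)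
  fix a v assume a: "a \<in> arcs Q" and v: "v \<in> carrier (sp (schur_rep Q T \<mu> (src f)) (tail Q a))"
  let ?n = "sum_list \<mu>" and ?t = "tail Q a" and ?h = "head Q a"
  note t = tail_in_verts[OF a] and h = head_in_verts[OF a] and s = arrD(1)[OF f]
  have vS: "v \<in> carrier (schur_space T \<mu> (sp (src f) ?t))" using v t by simp
  have vt: "v \<in> carrier (sp (rep_tpow (src f) ?n) ?t)" using schur_space_sub[OF s t vS] t by simp
  have 1: "schur_map T \<mu> (sp (src f) ?t) (sp (src f) ?h) (act (src f) a) v \<in> carrier (schur_space T \<mu> (sp (src f) ?h))"
    using act_closed[OF schur_rep_reps[OF s] a v] h a by simp
  have 2: "schur_map T \<mu> (sp (src f) ?t) (sp (tgt f) ?t) (at_vert f ?t) v \<in> carrier (schur_space T \<mu> (sp (tgt f) ?t))"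
    by (rule lin_maps_closed[OF schur_map_lin[OF fd_sp[OF s t] fd_sp[OF arrD(2)[OF f] t] arr_lin[OF f t]] vS])
  show "schur_map T \<mu> (sp (src f) ?h) (sp (tgt f) ?h) (at_vert f ?h) (act (schur_rep Q T \<mu> (src f)) a v) =
      act (schur_rep Q T \<mu> (tgt f)) a (schur_map T \<mu> (sp (src f) ?t) (sp (tgt f) ?t) (at_vert f ?t) v)"
    using arr_act[OF arr_tpow_mor[OF f, of ?n] a, of v] vt a t h schur_map_eq[OF 1] schur_map_eq[OF 2]
      schur_map_eq[OF vS] by simp
qed (simp_all add: f schur_map_lin fd_sp arr_lin)

lemma incl_proj:
  assumes V: "V \<in> reps Q"
  shows "incl \<mu> V ** proj \<mu> V = alg_mor V (sum_list \<mu>) (young_element \<mu>)"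
  by (rule arr_ext) (simp_all add: V carrier_schur_space fd_sp)

lemma incl_natural:
  assumes f: "arr f"
  shows "incl \<mu> (tgt f) ** schur_mor \<mu> f = tpow_mor f (sum_list \<mu>) ** incl \<mu> (src f)"
proof (rule arr_ext)
  fix x v assume x: "x \<in> verts Q" and v: "v \<in> carrier (sp (src (incl \<mu> (tgt f) ** schur_mor \<mu> f)) x)"
  have v': "v \<in> carrier (schur_space T \<mu> (sp (src f) x))" using v x by simp
  have "at_vert (schur_mor \<mu> f) x v \<in> carrier (schur_space T \<mu> (sp (tgt f) x))"
    using arr_closed[OF arr_schur_mor[OF f, of \<mu>] x, of v] v' x by simp
  then show "at_vert (incl \<mu> (tgt f) ** schur_mor \<mu> f) x v = at_vert (tpow_mor f (sum_list \<mu>) ** incl \<mu> (src f)) x v"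
    using x v' by simp
qed (simp_all add: f)

lemma proj_natural:
  assumes f: "arr f"
  shows "proj \<mu> (tgt f) ** tpow_mor f (sum_list \<mu>) = schur_mor \<mu> f ** proj \<mu> (src f)"
proof (rule arr_ext)
  fix x v assume x: "x \<in> verts Q" and v: "v \<in> carrier (sp (src (proj \<mu> (tgt f) ** tpow_mor f (sum_list \<mu>))) x)"
  have v': "v \<in> carrier (tpow T (sp (src f) x) (sum_list \<mu>))" using v x by simp
  have "alg_map T (sp (src f) x) (sum_list \<mu>) (young_element \<mu>) v \<in> carrier (schur_space T \<mu> (sp (src f) x))"
    using v' by (simp add: carrier_schur_space fd_sp f x)
  then show "at_vert (proj \<mu> (tgt f) ** tpow_mor f (sum_list \<mu>)) x v = at_vert (schur_mor \<mu> f ** proj \<mu> (src f)) x v"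
    using x v' by (simp add: alg_map_natural fd_sp f arr_lin)
qed (simp_all add: f)

lemma incl_mono:
  assumes "arr f" "arr g" "src f = src g" "tgt f = schur_rep Q T \<mu> V" "tgt g = schur_rep Q T \<mu> V"
    and V: "V \<in> reps Q" and eq: "incl \<mu> V ** f = incl \<mu> V ** g"
  shows "f = g"
proof (rule arr_ext)
  fix x v assume x: "x \<in> verts Q" and v: "v \<in> carrier (sp (src f) x)"
  have "at_vert f x v \<in> carrier (schur_space T \<mu> (sp V x))" "at_vert g x v \<in> carrier (schur_space T \<mu> (sp V x))"
    using arr_closed[of f x v] arr_closed[of g x v] assms x v by simp_all
  then have "at_vert f x v = at_vert (incl \<mu> V ** f) x v" "at_vert g x v = at_vert (incl \<mu> V ** g) x v"
    using x v assms(3) by simp_all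
  then show "at_vert f x v = at_vert g x v" using eq by simp
qed (use assms in simp_all)

lemma proj_epi:
  assumes "arr f" "arr g" "tgt f = tgt g" "src f = schur_rep Q T \<mu> V" "src g = schur_rep Q T \<mu> V"
    and V: "V \<in> reps Q" and eq: "f ** proj \<mu> V = g ** proj \<mu> V"
  shows "f = g"
proof (rule arr_ext)
  fix x v assume x: "x \<in> verts Q" and v: "v \<in> carrier (sp (src f) x)"
  then obtain t where t: "t \<in> carrier (tpow T (sp V x) (sum_list \<mu>))" "v = at_vert (proj \<mu> V) x t"
    using assms(4) by (auto simp: carrier_schur_space fd_sp V)
  have "at_vert (f ** proj \<mu> V) x t = at_vert f x v" "at_vert (g ** proj \<mu> V) x t = at_vert g x v"
    using x t by simp_all
  then show "at_vert f x v = at_vert g x v" using eq by simp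
qed (use assms in simp_all)

lemma schur_mor_Id:
  assumes V: "V \<in> reps Q"
  shows "schur_mor \<mu> (Id D V) = Id D (schur_rep Q T \<mu> V)"
proof -
  have id: "tpow_mor (Id D V) n = Id D (rep_tpow V n)" for n
    by (induction n) (simp_all add: tpow_mor_0 tpow_mor_Suc V)
  show ?thesis
    by (rule incl_mono[where \<mu> = \<mu> and V = V]) (use incl_natural[of "Id D V" \<mu>] in \<open>simp_all add: V id\<close>)
qed

lemma tpow_mor_comp:
  assumes "arr f" "arr g" "src g = tgt f"
  shows "tpow_mor (g ** f) n = tpow_mor g n ** tpow_mor f n"
  by (induction n) (simp_all add: tpow_mor_0 tpow_mor_Suc tensor_comp assms)

lemma schur_mor_comp:
  assumes f: "arr f" and g: "arr g" and s: "src g = tgt f"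
  shows "schur_mor \<mu> (g ** f) = schur_mor \<mu> g ** schur_mor \<mu> f"
proof (rule incl_mono[where \<mu> = \<mu> and V = "tgt g"])
  let ?n = "sum_list \<mu>"
  have "incl \<mu> (tgt g) ** schur_mor \<mu> (g ** f) = (tpow_mor g ?n ** tpow_mor f ?n) ** incl \<mu> (src f)"
    using incl_natural[of "g ** f" \<mu>] by (simp add: f g s tpow_mor_comp)
  also have "\<dots> = tpow_mor g ?n ** incl \<mu> (src g) ** schur_mor \<mu> f"
    using incl_natural[OF f, of \<mu>] by (simp add: f g s comp_assoc)
  also have "\<dots> = (tpow_mor g ?n ** incl \<mu> (src g)) ** schur_mor \<mu> f"
    by (simp add: f g s comp_assoc)
  also have "\<dots> = (incl \<mu> (tgt g) ** schur_mor \<mu> g) ** schur_mor \<mu> f"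
    by (simp only: incl_natural[OF g])
  also have "\<dots> = incl \<mu> (tgt g) ** schur_mor \<mu> g ** schur_mor \<mu> f"
    by (rule comp_assoc) (simp_all add: f g s)
  finally show "incl \<mu> (tgt g) ** schur_mor \<mu> (g ** f) = incl \<mu> (tgt g) ** schur_mor \<mu> g ** schur_mor \<mu> f" .
qed (simp_all add: f g s)

end

section \<open>Tensor functors and tensor powers\<close>

context quiver_reps
begin

abbreviation inverses :: "('v, 'e, 'k, 'u) qmor \<Rightarrow> ('v, 'e, 'k, 'u) qmor \<Rightarrow> bool" where
  "inverses f g \<equiv> arr f \<and> arr g \<and> src g = tgt f \<and> tgt g = src f \<and>
     g ** f = Id D (src f) \<and> f ** g = Id D (tgt f)"

lemma inverse_pair_D: "A \<in> reps Q \<Longrightarrow> B \<in> reps Q \<Longrightarrow>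
    inverse_pair D A B f g \<longleftrightarrow> inverses f g \<and> src f = A \<and> tgt f = B"
  unfolding inverse_pair_def by (auto simp: Hom_D)

lemma Hom_opposite_D: "A \<in> reps Q \<Longrightarrow> B \<in> reps Q \<Longrightarrow>
    f \<in> Hom (opposite D) A B \<longleftrightarrow> arr f \<and> src f = B \<and> tgt f = A"
  by (auto simp: opposite_def Hom_D)

lemma Comp_opposite_D: "Comp (opposite D) g f = f ** g"
  by (simp add: opposite_def)

text \<open>Rewriting with an equation \<open>g ** f = k\<close> inside a composite associated to the right.\<close>

lemma comp_reassoc:
  assumes "g ** f = k" "arr x" "arr f" "arr g" "src f = tgt x" "src g = tgt f"
  shows "g ** f ** x = k ** x"
  using comp_assoc[of x f g] assms by simp

lemma inverses_unique:
  assumes "inverses f g" "inverses f h"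
  shows "g = h"
proof -
  have "g ** f ** h = Id D (src f) ** h"
    by (rule comp_reassoc) (use assms in simp_all)
  then show ?thesis using assms by simp
qed

lemma inverse_arrow_D:
  assumes "A \<in> reps Q" "B \<in> reps Q" "inverses f g" "src f = A" "tgt f = B"
  shows "inverse_arrow D A B f = g"
  unfolding inverse_arrow_def inverse_pair_D[OF assms(1,2)]
  using assms inverses_unique by (intro the_equality) blast+

lemma inverses_comp:
  assumes f: "inverses f g" and f': "inverses f' g'" and s: "src f' = tgt f"
  shows "inverses (f' ** f) (g ** g')"
proof -
  have "g' ** f' ** f = Id D (src f') ** f"
    by (rule comp_reassoc) (use assms in simp_all)
  moreover have "f ** g ** g' = Id D (tgt f) ** g'"
    by (rule comp_reassoc) (use assms in simp_all)
  ultimately show ?thesis using assms by (simp add: comp_assoc)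
qed

lemma inverses_tensor:
  assumes "inverses f g" "inverses f' g'"
  shows "inverses (f \<boxtimes> f') (g \<boxtimes> g')"
  using assms by (simp add: tensor_comp)

lemma inverses_Id: "V \<in> reps Q \<Longrightarrow> inverses (Id D V) (Id D V)"
  by simp

lemma cancel_right_inverses:
  assumes "inverses k l" "arr f" "arr g" "src f = tgt k" "src g = tgt k" "tgt f = tgt g"
    and eq: "f ** k = g ** k"
  shows "f = g"
proof -
  have "f ** k ** l = (f ** k) ** l"
    by (rule comp_assoc[symmetric]) (use assms(1-4) in simp_all)
  moreover have "g ** k ** l = (g ** k) ** l"
    by (rule comp_assoc[symmetric]) (use assms(1,3,5) in simp_all)
  ultimately have "f ** Id D (tgt k) = g ** Id D (tgt k)" using assms(1) eq by simp
  then show ?thesis using assms by simp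
qed

lemma scale_zero_eq:
  assumes "arr f" "arr g" "src f = src g" "tgt f = tgt g"
  shows "scale 0 f = scale 0 g"
proof (rule arr_ext)
  fix x v assume x: "x \<in> verts Q" and v: "v \<in> carrier (sp (src (scale 0 f)) x)"
  have "at_vert f x v \<in> carrier (sp (tgt g) x)" "at_vert g x v \<in> carrier (sp (tgt g) x)"
    using arr_closed[of f x v] arr_closed[of g x v] assms x v by simp_all
  then show "at_vert (scale 0 f) x v = at_vert (scale 0 g) x v"
    using x v assms by (simp add: vs_ac(5)[OF vs_sp])
qed (use assms in simp_all)

lemma add_eq_zero:
  assumes f: "arr f" and g: "arr g" and s: "src g = src f" "tgt g = tgt f"
    and eq: "Add D f g = scale 0 f"
  shows "g = scale (- 1) f"
proof (rule arr_ext)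
  fix x v assume x: "x \<in> verts Q" and v: "v \<in> carrier (sp (src g) x)"
  let ?W = "sp (tgt f) x" and ?f = "at_vert f x v" and ?g = "at_vert g x v"
  note vs = vs_sp[OF arrD(2)[OF f] x]
  interpret W: Module.module class_ring ?W by (rule module_class[OF vs])
  have cf: "?f \<in> carrier ?W" using arr_closed[OF f x] v s by simp
  have cg: "?g \<in> carrier ?W" using arr_closed[OF g x] v s by simp
  note cm = vs_closed(2)[OF vs cf, of "- 1"]
  have "at_vert (Add D f g) x v = at_vert (scale 0 f) x v" using eq by simp
  then have "?f \<oplus>\<^bsub>?W\<^esub> ?g = \<zero>\<^bsub>?W\<^esub>" using x v s by (simp add: vs_ac(5)[OF vs cf])
  moreover have "?f \<oplus>\<^bsub>?W\<^esub> ((- 1) \<odot>\<^bsub>?W\<^esub> ?f) = \<zero>\<^bsub>?W\<^esub>"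
    using vs_ac(3)[OF vs cf, of 1 "- 1"] by (simp add: vs_ac(4,5)[OF vs cf])
  ultimately have "?g = (- 1) \<odot>\<^bsub>?W\<^esub> ?f"
    using W.minus_equality[OF _ cf cg] W.minus_equality[OF _ cf cm] W.a_comm[OF cf cg] W.a_comm[OF cf cm]
    by simp
  then show "at_vert g x v = at_vert (scale (- 1) f) x v" using x v s by simp
qed (use assms in simp_all)

end

text \<open>A tensor functor \<open>F\<close> on the representations of \<open>Q\<close>, covariant if \<open>C\<close> is \<open>D\<close> and
  contravariant if \<open>C\<close> is its opposite.\<close>

locale rep_tensor_functor = quiver_reps T Q
  for T :: "('k::field_char_0, 'u) tensor_data" and Q :: "('v, 'e) pre_digraph" +
  fixes C :: "(('v, 'e, 'k, 'u) qrep, ('v, 'e, 'k, 'u) qmor) tensor_cat"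
    and F :: "(('v, 'e, 'k, 'u) qrep, ('v, 'e, 'k, 'u) qmor,
               ('v, 'e, 'k, 'u) qrep, ('v, 'e, 'k, 'u) qmor) functor_data"
    and c :: "('v, 'e, 'k, 'u) qrep \<Rightarrow> ('v, 'e, 'k, 'u) qrep \<Rightarrow> ('v, 'e, 'k, 'u) qmor"
  assumes variance: "C = rep_cat Q T \<or> C = opposite (rep_cat Q T)"
    and tensor_functor: "tensor_functor C (rep_cat Q T) F c"
begin

lemma C_simps [simp]:
  "Obj C = reps Q" "TObj C = tens" "TMor C = TMor D" "Id C = Id D" "Add C = Add D"
  "Unit C = Unit D"
  using variance by (auto simp: opposite_def)

lemma Hom_C_cases:
  assumes "f \<in> Hom C A B" "A \<in> reps Q" "B \<in> reps Q"
  obtains "C = D" "arr f" "src f = A" "tgt f = B"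
  | "C = opposite D" "arr f" "src f = B" "tgt f = A"
  using variance assms by (auto simp: Hom_opposite_D Hom_D)

lemma Hom_C_arr: "f \<in> Hom C A B \<Longrightarrow> A \<in> reps Q \<Longrightarrow> B \<in> reps Q \<Longrightarrow> arr f"
  by (erule Hom_C_cases)

lemma Hom_C_endo: "A \<in> reps Q \<Longrightarrow> arr f \<Longrightarrow> src f = A \<Longrightarrow> tgt f = A \<Longrightarrow> f \<in> Hom C A A"
  using variance by (auto simp: Hom_D Hom_opposite_D)

lemma Hom_C_Id: "A \<in> reps Q \<Longrightarrow> Id D A \<in> Hom C A A"
  by (intro Hom_C_endo) simp_all

lemma Hom_C_comp:
  assumes "f \<in> Hom C A B" "g \<in> Hom C B B'" "A \<in> reps Q" "B \<in> reps Q" "B' \<in> reps Q"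
  shows "Comp C g f \<in> Hom C A B'"
  using assms variance by (auto simp: Hom_D Hom_opposite_D Comp_opposite_D)

lemma Hom_C_tensor:
  assumes "f \<in> Hom C A B" "g \<in> Hom C A' B'" "A \<in> reps Q" "B \<in> reps Q" "A' \<in> reps Q" "B' \<in> reps Q"
  shows "f \<boxtimes> g \<in> Hom C (tens A A') (tens B B')"
  using assms variance by (auto simp: Hom_D Hom_opposite_D)

lemma Hom_C_tpow:
  assumes "f \<in> Hom C A B" "A \<in> reps Q" "B \<in> reps Q"
  shows "tpow_mor f n \<in> Hom C (rep_tpow A n) (rep_tpow B n)"
  using assms variance by (auto simp: Hom_D Hom_opposite_D)

lemma Hom_C_schur:
  assumes "f \<in> Hom C A B" "A \<in> reps Q" "B \<in> reps Q"
  shows "schur_mor \<mu> f \<in> Hom C (schur_rep Q T \<mu> A) (schur_rep Q T \<mu> B)"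
  using assms variance by (auto simp: Hom_D Hom_opposite_D)

lemma Hom_C_scale: "f \<in> Hom C A B \<Longrightarrow> A \<in> reps Q \<Longrightarrow> B \<in> reps Q \<Longrightarrow> scale r f \<in> Hom C A B"
  using variance by (auto simp: Hom_D Hom_opposite_D)

text \<open>The constraints of \<open>C\<close>, related by the transposition of the last two tensor factors.\<close>

lemma
  assumes V: "V \<in> reps Q"
  shows Hom_C_Braid: "Braid C V V \<in> Hom C (tens V V) (tens V V)"
    and Hom_C_Assoc: "Assoc C (rep_tpow V n) V V \<in>
      Hom C (tens (rep_tpow V n) (tens V V)) (rep_tpow V (Suc (Suc n)))"
    and perm_mor_top_C:
      "Comp C (perm_mor V (Suc (Suc n)) (adj n)) (Assoc C (rep_tpow V n) V V) =
       Comp C (Assoc C (rep_tpow V n) V V) (Id D (rep_tpow V n) \<boxtimes> Braid C V V)"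
proof -
  let ?X = "rep_tpow V n" and ?s = "perm_mor V (Suc (Suc n)) (adj n)"
  let ?A = "Assoc D ?X V V" and ?B = "Braid D V V"
  obtain k where k: "inverses ?A k"
    using Assoc_inverse[OF rep_tpow_reps[OF V] V V, of n] arr_Assoc[OF rep_tpow_reps[OF V] V V] by metis
  have B: "inverses ?B ?B" using V by (simp add: Braid_Braid)
  have inv: "Assoc C ?X V V = k" "Braid C V V = ?B" if "C = opposite D"
    using inverse_arrow_D[OF _ _ k] inverse_arrow_D[OF _ _ B] V that by (simp_all add: opposite_def)
  show "Braid C V V \<in> Hom C (tens V V) (tens V V)"
    using variance
  proof
    assume "C = opposite D"
    with inv V show ?thesis by (simp add: Hom_opposite_D)
  qed (simp add: Hom_D V)
  show "Assoc C ?X V V \<in> Hom C (tens ?X (tens V V)) (rep_tpow V (Suc (Suc n)))"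
    using variance
  proof
    assume "C = opposite D"
    with inv V k show ?thesis by (simp add: Hom_opposite_D)
  qed (simp add: Hom_D V)
  note top = perm_mor_top[OF V, of n]
  show "Comp C ?s (Assoc C ?X V V) = Comp C (Assoc C ?X V V) (Id D ?X \<boxtimes> Braid C V V)"
    using variance
  proof
    assume C: "C = opposite D"
    have "k ** ?s = (Id D ?X \<boxtimes> ?B) ** k"
    proof (rule cancel_right_inverses[OF k])
      have "(k ** ?s) ** ?A = k ** ?A ** (Id D ?X \<boxtimes> ?B)"
        using top k V by (simp add: comp_assoc)
      also have "\<dots> = Id D ?X \<boxtimes> ?B"
        using k V comp_reassoc[of k ?A "Id D (src ?A)" "Id D ?X \<boxtimes> ?B"] by simp
      also have "\<dots> = ((Id D ?X \<boxtimes> ?B) ** k) ** ?A" using k V by (simp add: comp_assoc)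
      finally show "(k ** ?s) ** ?A = ((Id D ?X \<boxtimes> ?B) ** k) ** ?A" .
    qed (use k V in simp_all)
    then show ?thesis using C inv[OF C] by (simp add: Comp_opposite_D)
  qed (simp add: top)
qed

abbreviation FO where "FO \<equiv> on_obj F"
abbreviation FA where "FA \<equiv> on_arr F"

lemma is_functor_F: "is_functor C D F"
  using tensor_functor by (simp add: tensor_functor_def)

lemma FO_reps [simp]: "V \<in> reps Q \<Longrightarrow> FO V \<in> reps Q"
  using is_functor_F by (simp add: is_functor_def)

lemma FA_arr:
  assumes "f \<in> Hom C A B" "A \<in> reps Q" "B \<in> reps Q"
  shows "arr (FA f)" "src (FA f) = FO A" "tgt (FA f) = FO B"
proof -
  have "FA f \<in> Hom D (FO A) (FO B)" using is_functor_F assms by (simp add: is_functor_def)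
  then show "arr (FA f)" "src (FA f) = FO A" "tgt (FA f) = FO B"
    using assms by (simp_all add: Hom_D)
qed

lemma FA_Id: "V \<in> reps Q \<Longrightarrow> FA (Id D V) = Id D (FO V)"
  using is_functor_F by (simp add: is_functor_def)

lemma FA_comp:
  assumes "f \<in> Hom C A B" "g \<in> Hom C B B'" "A \<in> reps Q" "B \<in> reps Q" "B' \<in> reps Q"
  shows "FA (Comp C g f) = FA g ** FA f"
  using is_functor_F assms unfolding is_functor_def by auto

lemma FA_add:
  assumes "f \<in> Hom C A B" "g \<in> Hom C A B" "A \<in> reps Q" "B \<in> reps Q"
  shows "FA (Add D f g) = Add D (FA f) (FA g)"
  using tensor_functor assms unfolding tensor_functor_def is_additive_def by auto

lemma c_inverses:
  assumes "X \<in> reps Q" "Y \<in> reps Q"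
  obtains d where "inverses (c X Y) d" "src (c X Y) = tens (FO X) (FO Y)"
    "tgt (c X Y) = FO (tens X Y)"
proof -
  have "is_iso D (tens (FO X) (FO Y)) (FO (tens X Y)) (c X Y)"
    using tensor_functor assms by (simp add: tensor_functor_def)
  then show ?thesis using that assms by (auto simp: is_iso_def inverse_pair_D)
qed

lemma c_simps [simp]:
  assumes "X \<in> reps Q" "Y \<in> reps Q"
  shows "arr (c X Y)" "src (c X Y) = tens (FO X) (FO Y)"
    "tgt (c X Y) = FO (tens X Y)"
  using c_inverses[OF assms] by metis+

lemma c_natural:
  assumes "f \<in> Hom C X X'" "g \<in> Hom C Y Y'" "X \<in> reps Q" "X' \<in> reps Q" "Y \<in> reps Q" "Y' \<in> reps Q"
  shows "c X' Y' ** (FA f \<boxtimes> FA g) = FA (f \<boxtimes> g) ** c X Y"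
  using tensor_functor assms by (simp add: tensor_functor_def)

lemma c_Assoc:
  assumes "X \<in> reps Q" "Y \<in> reps Q" "Z \<in> reps Q"
  shows "FA (Assoc C X Y Z) ** c X (tens Y Z) ** (Id D (FO X) \<boxtimes> c Y Z) =
    c (tens X Y) Z ** (c X Y \<boxtimes> Id D (FO Z)) ** Assoc D (FO X) (FO Y) (FO Z)"
  using tensor_functor assms by (simp add: tensor_functor_def)

lemma c_Braid:
  assumes "X \<in> reps Q" "Y \<in> reps Q"
  shows "c Y X ** Braid D (FO X) (FO Y) = FA (Braid C X Y) ** c X Y"
  using tensor_functor assms by (simp add: tensor_functor_def)

text \<open>A chosen isomorphism from the unit representation to its image under \<open>F\<close>.\<close>

definition unit_arrow :: "('v, 'e, 'k, 'u) qmor" where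
  "unit_arrow = (SOME u. src u = Unit D \<and> tgt u = FO (Unit D) \<and> (\<exists>g. inverses u g))"

lemma unit_arrow:
  "src unit_arrow = Unit D" "tgt unit_arrow = FO (Unit D)" "\<exists>g. inverses unit_arrow g"
proof -
  obtain u where "is_iso D (FO (Unit D)) (Unit D) u"
    using tensor_functor by (auto simp: tensor_functor_def)
  then obtain g where "inverses u g" "src u = FO (Unit D)" "tgt u = Unit D"
    by (auto simp: is_iso_def inverse_pair_D)
  then have "src g = Unit D \<and> tgt g = FO (Unit D) \<and> inverses g u" by simp
  then have "\<exists>u. src u = Unit D \<and> tgt u = FO (Unit D) \<and> (\<exists>g. inverses u g)" by blast
  from someI_ex[OF this, folded unit_arrow_def]
  show "src unit_arrow = Unit D" "tgt unit_arrow = FO (Unit D)" "\<exists>g. inverses unit_arrow g"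
    by blast+
qed

text \<open>The isomorphism from the tensor power of \<open>F V\<close> to \<open>F\<close> of the tensor power of \<open>V\<close>. In both
  variances it is an arrow of the target category \<open>D\<close> in this direction.\<close>

primrec eta :: "nat \<Rightarrow> ('v, 'e, 'k, 'u) qrep \<Rightarrow> ('v, 'e, 'k, 'u) qmor" where
  "eta 0 V = unit_arrow"
| "eta (Suc n) V = c (rep_tpow V n) V ** (eta n V \<boxtimes> Id D (FO V))"

lemma eta_inverses:
  assumes V: "V \<in> reps Q"
  shows "src (eta n V) = rep_tpow (FO V) n \<and> tgt (eta n V) = FO (rep_tpow V n) \<and>
    (\<exists>g. inverses (eta n V) g)"
proof (induction n)
  case 0
  then show ?case using unit_arrow by simp
next
  case (Suc n)
  then obtain g where g: "inverses (eta n V) g" by blast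
  obtain d where d: "inverses (c (rep_tpow V n) V) d" using c_inverses[of "rep_tpow V n" V] V by auto
  have "src (c (rep_tpow V n) V) = tgt (eta n V \<boxtimes> Id D (FO V))" using V Suc by simp
  from inverses_comp[OF inverses_tensor[OF g inverses_Id[OF FO_reps[OF V]]] d this]
  have "\<exists>g. inverses (eta (Suc n) V) g" unfolding eta.simps by blast
  moreover have "src (eta (Suc n) V) = rep_tpow (FO V) (Suc n)" "tgt (eta (Suc n) V) = FO (rep_tpow V (Suc n))"
    using V Suc by simp_all
  ultimately show ?case by blast
qed

lemma eta_simps [simp]:
  assumes "V \<in> reps Q"
  shows "arr (eta n V)" "src (eta n V) = rep_tpow (FO V) n" "tgt (eta n V) = FO (rep_tpow V n)"
  using eta_inverses[OF assms, of n] by auto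

lemma eta_natural:
  assumes f: "f \<in> Hom C V W" and V: "V \<in> reps Q" and W: "W \<in> reps Q"
  shows "FA (tpow_mor f n) ** eta n V = eta n W ** tpow_mor (FA f) n"
proof (induction n)
  case 0
  have "arr unit_arrow" using unit_arrow(3) by blast
  then show ?case using unit_arrow by (simp add: tpow_mor_0 FA_Id)
next
  case (Suc n)
  note [simp] = FA_arr[OF f V W] V W
  have fn: "tpow_mor f n \<in> Hom C (rep_tpow V n) (rep_tpow W n)" by (rule Hom_C_tpow[OF f V W])
  note [simp] = FA_arr[OF fn]
  have ft: "tpow_mor f n \<boxtimes> f \<in> Hom C (rep_tpow V (Suc n)) (rep_tpow W (Suc n))"
    using Hom_C_tensor[OF fn f] by simp
  note [simp] = FA_arr[OF ft, simplified]
  have "FA (tpow_mor f (Suc n)) ** eta (Suc n) V =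
      FA (tpow_mor f n \<boxtimes> f) ** c (rep_tpow V n) V ** (eta n V \<boxtimes> Id D (FO V))"
    by (simp add: tpow_mor_Suc)
  also have "\<dots> = (FA (tpow_mor f n \<boxtimes> f) ** c (rep_tpow V n) V) ** (eta n V \<boxtimes> Id D (FO V))"
    by (subst comp_assoc) simp_all
  also have "\<dots> = (c (rep_tpow W n) W ** (FA (tpow_mor f n) \<boxtimes> FA f)) ** (eta n V \<boxtimes> Id D (FO V))"
    using c_natural[OF fn f] by simp
  also have "\<dots> = c (rep_tpow W n) W ** ((FA (tpow_mor f n) ** eta n V) \<boxtimes> FA f)"
    by (simp add: comp_assoc tensor_comp)
  also have "\<dots> = c (rep_tpow W n) W ** (eta n W \<boxtimes> Id D (FO W)) ** (tpow_mor (FA f) n \<boxtimes> FA f)"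
    by (simp add: Suc tensor_comp)
  also have "\<dots> = eta (Suc n) W ** tpow_mor (FA f) (Suc n)"
    by (simp add: tpow_mor_Suc comp_assoc)
  finally show ?case .
qed

subsection \<open>Compatibility with the group algebra\<close>

lemma Hom_C_perm: "V \<in> reps Q \<Longrightarrow> perm_mor V n \<sigma> \<in> Hom C (rep_tpow V n) (rep_tpow V n)"
  by (rule Hom_C_endo) simp_all

lemma Hom_C_alg: "V \<in> reps Q \<Longrightarrow> alg_mor V n a \<in> Hom C (rep_tpow V n) (rep_tpow V n)"
  by (rule Hom_C_endo) simp_all

text \<open>Two factors may be merged by \<open>c\<close> before being tensored to the remaining ones: this is
  compatibility with associativity.\<close>

lemma eta_assoc:
  assumes V: "V \<in> reps Q"
  shows "eta (Suc (Suc n)) V ** Assoc D (rep_tpow (FO V) n) (FO V) (FO V) =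
    FA (Assoc C (rep_tpow V n) V V) ** c (rep_tpow V n) (tens V V) ** (eta n V \<boxtimes> c V V)"
proof -
  let ?X = "rep_tpow V n" and ?W = "FO V"
  let ?i = "Id D ?W" and ?e = "eta n V" and ?W2 = "tens (FO V) (FO V)"
  note [simp] = V FA_arr[OF Hom_C_Assoc[OF V, of n], simplified]
  have "eta (Suc (Suc n)) V = c (rep_tpow V (Suc n)) V ** (c ?X V \<boxtimes> ?i) ** ((?e \<boxtimes> ?i) \<boxtimes> ?i)"
    by (simp add: tensor_comp)
  then have "eta (Suc (Suc n)) V ** Assoc D (rep_tpow ?W n) ?W ?W =
      c (rep_tpow V (Suc n)) V ** (c ?X V \<boxtimes> ?i) ** ((?e \<boxtimes> ?i) \<boxtimes> ?i) ** Assoc D (rep_tpow ?W n) ?W ?W"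
    by (simp add: comp_assoc del: eta.simps)
  also have "((?e \<boxtimes> ?i) \<boxtimes> ?i) ** Assoc D (rep_tpow ?W n) ?W ?W = Assoc D (FO ?X) ?W ?W ** (?e \<boxtimes> Id D ?W2)"
    using Assoc_natural[of ?e ?i ?i] by simp
  also have "c (rep_tpow V (Suc n)) V ** (c ?X V \<boxtimes> ?i) ** Assoc D (FO ?X) ?W ?W ** (?e \<boxtimes> Id D ?W2) =
      (c (rep_tpow V (Suc n)) V ** (c ?X V \<boxtimes> ?i) ** Assoc D (FO ?X) ?W ?W) ** (?e \<boxtimes> Id D ?W2)"
    by (simp add: comp_assoc)
  also have "\<dots> = (FA (Assoc C ?X V V) ** c ?X (tens V V) ** (Id D (FO ?X) \<boxtimes> c V V)) ** (?e \<boxtimes> Id D ?W2)"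
    using c_Assoc[of ?X V V] by simp
  also have "\<dots> = FA (Assoc C ?X V V) ** c ?X (tens V V) ** (?e \<boxtimes> c V V)"
    by (simp add: comp_assoc tensor_comp)
  finally show ?thesis .
qed

text \<open>By \<open>perm_mor_top_C\<close> the transposition of the last two factors is the commutativity isomorphism
  conjugated by associativity; \<open>c_Braid\<close> and \<open>eta_assoc\<close> carry it through \<open>F\<close>.\<close>

lemma eta_transpose_top:
  fixes n :: nat
  assumes V: "V \<in> reps Q"
  defines "s \<equiv> adj n"
  shows "FA (perm_mor V (Suc (Suc n)) s) ** eta (Suc (Suc n)) V =
    eta (Suc (Suc n)) V ** perm_mor (FO V) (Suc (Suc n)) s"
proof -
  let ?X = "rep_tpow V n" and ?W = "FO V" and ?N = "Suc (Suc n)" and ?V2 = "tens V V"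
  let ?Y = "rep_tpow ?W n"
  let ?e = "eta n V" and ?A = "Assoc C ?X V V" and ?AW = "Assoc D ?Y ?W ?W"
  let ?b = "Braid C V V" and ?bW = "Braid D ?W ?W"
  note homA = Hom_C_Assoc[OF V, of n] and homb = Hom_C_Braid[OF V] and homs = Hom_C_perm[OF V, of ?N s]
  have homX: "Id D ?X \<in> Hom C ?X ?X" by (rule Hom_C_Id) (simp add: V)
  have homXb: "Id D ?X \<boxtimes> ?b \<in> Hom C (tens ?X ?V2) (tens ?X ?V2)"
    by (rule Hom_C_tensor[OF homX homb]) (simp_all add: V)
  note [simp] = V FA_arr[OF homA, simplified] FA_arr[OF homb, simplified] FA_arr[OF homs, simplified]
    FA_arr[OF homXb, simplified]
  obtain k where k: "inverses ?AW k"
    using Assoc_inverse[of ?Y ?W ?W] arr_Assoc[of ?Y ?W ?W] by (metis FO_reps V rep_tpow_reps)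
  have XA: "FA (perm_mor V ?N s) ** FA ?A = FA ?A ** FA (Id D ?X \<boxtimes> ?b)"
    using FA_comp[OF homA homs] FA_comp[OF homXb homA] perm_mor_top_C[OF V, of n] by (simp add: s_def)
  have cb: "FA (Id D ?X \<boxtimes> ?b) ** c ?X ?V2 = c ?X ?V2 ** (Id D (FO ?X) \<boxtimes> FA ?b)"
    using c_natural[OF homX homb] by (simp add: FA_Id)
  have "(FA (perm_mor V ?N s) ** eta ?N V) ** ?AW = FA (perm_mor V ?N s) ** eta ?N V ** ?AW"
    by (rule comp_assoc) (simp_all del: eta.simps)
  also have "\<dots> = FA (perm_mor V ?N s) ** FA ?A ** c ?X ?V2 ** (?e \<boxtimes> c V V)"
    by (simp only: eta_assoc[OF V])
  also have "\<dots> = (FA ?A ** FA (Id D ?X \<boxtimes> ?b)) ** c ?X ?V2 ** (?e \<boxtimes> c V V)"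
    by (rule comp_reassoc[OF XA]) simp_all
  also have "\<dots> = FA ?A ** FA (Id D ?X \<boxtimes> ?b) ** c ?X ?V2 ** (?e \<boxtimes> c V V)"
    by (rule comp_assoc) simp_all
  also have "FA (Id D ?X \<boxtimes> ?b) ** c ?X ?V2 ** (?e \<boxtimes> c V V) =
      (c ?X ?V2 ** (Id D (FO ?X) \<boxtimes> FA ?b)) ** (?e \<boxtimes> c V V)"
    by (rule comp_reassoc[OF cb]) simp_all
  also have "\<dots> = c ?X ?V2 ** (?e \<boxtimes> (c V V ** ?bW))"
    using c_Braid[OF V V] by (simp add: comp_assoc tensor_comp)
  also have "?e \<boxtimes> (c V V ** ?bW) = (?e \<boxtimes> c V V) ** (Id D ?Y \<boxtimes> ?bW)"
    by (simp add: tensor_comp)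
  also have "FA ?A ** c ?X ?V2 ** (?e \<boxtimes> c V V) ** (Id D ?Y \<boxtimes> ?bW) =
      (FA ?A ** c ?X ?V2 ** (?e \<boxtimes> c V V)) ** (Id D ?Y \<boxtimes> ?bW)"
    by (simp add: comp_assoc)
  also have "\<dots> = (eta ?N V ** ?AW) ** (Id D ?Y \<boxtimes> ?bW)"
    by (simp only: eta_assoc[OF V])
  also have "\<dots> = eta ?N V ** ?AW ** (Id D ?Y \<boxtimes> ?bW)"
    by (rule comp_assoc) (simp_all del: eta.simps)
  also have "?AW ** (Id D ?Y \<boxtimes> ?bW) = perm_mor ?W ?N s ** ?AW"
    using perm_mor_top[of ?W n] by (simp add: s_def)
  also have "eta ?N V ** perm_mor ?W ?N s ** ?AW = (eta ?N V ** perm_mor ?W ?N s) ** ?AW"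
    by (rule comp_assoc[symmetric]) (simp_all del: eta.simps)
  finally have eq: "(FA (perm_mor V ?N s) ** eta ?N V) ** ?AW = (eta ?N V ** perm_mor ?W ?N s) ** ?AW" .
  show ?thesis
    by (rule cancel_right_inverses[OF k _ _ _ _ _ eq]) (simp_all del: eta.simps)
qed

lemma eta_transpose:
  assumes V: "V \<in> reps Q" and i: "Suc i < n"
  defines "s \<equiv> adj i"
  shows "FA (perm_mor V n s) ** eta n V = eta n V ** perm_mor (FO V) n s"
  using i
proof (induction n)
  case (Suc n)
  show ?case
  proof (cases "Suc i < n")
    case True
    let ?c = "c (rep_tpow V n) V" and ?p = "perm_mor V n s" and ?i = "Id D V"
    note homp = Hom_C_perm[OF V, of n s] and homV = Hom_C_Id[OF V]
    have hompi: "?p \<boxtimes> ?i \<in> Hom C (rep_tpow V (Suc n)) (rep_tpow V (Suc n))"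
      using Hom_C_tensor[OF homp homV] V by simp
    note [simp] = V FA_arr[OF homp, simplified] FA_arr[OF hompi, simplified]
    have nat: "FA (?p \<boxtimes> ?i) ** ?c = ?c ** (FA ?p \<boxtimes> Id D (FO V))"
      using c_natural[OF homp homV] by (simp add: FA_Id)
    have "FA (perm_mor V (Suc n) s) ** eta (Suc n) V = FA (?p \<boxtimes> ?i) ** ?c ** (eta n V \<boxtimes> Id D (FO V))"
      using perm_mor_lower[OF V True] by (simp add: s_def)
    also have "\<dots> = (?c ** (FA ?p \<boxtimes> Id D (FO V))) ** (eta n V \<boxtimes> Id D (FO V))"
      by (rule comp_reassoc[OF nat]) simp_all
    also have "\<dots> = ?c ** ((eta n V ** perm_mor (FO V) n s) \<boxtimes> Id D (FO V))"
      using Suc.IH[OF True] by (simp add: comp_assoc tensor_comp)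
    also have "\<dots> = ?c ** (eta n V \<boxtimes> Id D (FO V)) ** (perm_mor (FO V) n s \<boxtimes> Id D (FO V))"
      by (simp add: tensor_comp)
    also have "\<dots> = eta (Suc n) V ** perm_mor (FO V) (Suc n) s"
      using perm_mor_lower[OF FO_reps[OF V] True] by (simp add: comp_assoc s_def)
    finally show ?thesis .
  next
    case False
    with Suc.prems have "n = Suc i" by simp
    then show ?thesis unfolding s_def using eta_transpose_top[OF V] by blast
  qed
qed simp

lemma eta_perm_covariant:
  assumes C: "C = D" and V: "V \<in> reps Q" and \<sigma>: "\<sigma> permutes {..<n}"
  shows "FA (perm_mor V n \<sigma>) ** eta n V = eta n V ** perm_mor (FO V) n \<sigma>"
  using \<sigma>
proof (induction rule: permutes_adjacent_induct)
  case id
  show ?case unfolding perm_mor_id[OF V] perm_mor_id[OF FO_reps[OF V]] inv_id using V by (simp add: FA_Id)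
next
  case (adj i p)
  let ?s = "adj i"
  have s: "?s permutes {..<n}" using adj(1) by (auto intro!: permutes_swap_id)
  note hp = Hom_C_perm[OF V, of n p] and hs = Hom_C_perm[OF V, of n ?s]
  note [simp] = V FA_arr[OF hp, simplified] FA_arr[OF hs, simplified]
  have "FA (perm_mor V n (?s \<circ> p)) ** eta n V = (FA (perm_mor V n p) ** FA (perm_mor V n ?s)) ** eta n V"
    using FA_comp[OF hs hp] C perm_mor_comp[OF V adj(2) s] by simp
  also have "\<dots> = FA (perm_mor V n p) ** eta n V ** perm_mor (FO V) n ?s"
    using eta_transpose[OF V adj(1)] by (simp add: comp_assoc)
  also have "\<dots> = (eta n V ** perm_mor (FO V) n p) ** perm_mor (FO V) n ?s"
    by (rule comp_reassoc[OF adj(3)]) simp_all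
  also have "\<dots> = eta n V ** perm_mor (FO V) n (?s \<circ> p)"
    by (simp add: comp_assoc perm_mor_comp[OF _ adj(2) s] del: o_apply)
  finally show ?case .
qed

lemma eta_perm_contravariant:
  assumes C: "C = opposite D" and V: "V \<in> reps Q" and \<sigma>: "\<sigma> permutes {..<n}"
  shows "FA (perm_mor V n \<sigma>) ** eta n V = eta n V ** perm_mor (FO V) n (pinv \<sigma>)"
  using \<sigma>
proof (induction rule: permutes_adjacent_induct)
  case id
  show ?case unfolding perm_mor_id[OF V] perm_mor_id[OF FO_reps[OF V]] inv_id using V by (simp add: FA_Id)
next
  case (adj i p)
  let ?s = "adj i"
  have s: "?s permutes {..<n}" using adj(1) by (auto intro!: permutes_swap_id)
  have ip: "pinv p permutes {..<n}" by (rule permutes_inv[OF adj(2)])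
  have isp: "pinv (?s \<circ> p) = pinv p \<circ> ?s"
    using pinv_compose[OF s adj(2)] by simp
  note hp = Hom_C_perm[OF V, of n p] and hs = Hom_C_perm[OF V, of n ?s]
  note [simp] = V FA_arr[OF hp, simplified] FA_arr[OF hs, simplified]
  have "FA (perm_mor V n (?s \<circ> p)) ** eta n V = (FA (perm_mor V n ?s) ** FA (perm_mor V n p)) ** eta n V"
    using FA_comp[OF hp hs] perm_mor_comp[OF V adj(2) s] by (simp add: C Comp_opposite_D)
  also have "\<dots> = FA (perm_mor V n ?s) ** eta n V ** perm_mor (FO V) n (pinv p)"
    using adj(3) by (simp add: comp_assoc)
  also have "\<dots> = (eta n V ** perm_mor (FO V) n ?s) ** perm_mor (FO V) n (pinv p)"
    by (rule comp_reassoc[OF eta_transpose[OF V adj(1)]]) simp_all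
  also have "\<dots> = eta n V ** perm_mor (FO V) n (pinv (?s \<circ> p))"
    unfolding isp by (simp add: comp_assoc perm_mor_comp[OF _ s ip] del: o_apply)
  finally show ?case .
qed

text \<open>Being additive, \<open>F\<close> is linear over the rational numbers, though not over \<open>'k\<close> in general.\<close>

lemma FA_scale_rat:
  assumes f: "f \<in> Hom C A B" and A: "A \<in> reps Q" and B: "B \<in> reps Q"
  shows "FA (scale (of_rat r) f) = scale (of_rat r) (FA f)"
proof -
  note hs = Hom_C_scale[OF f A B]
  have af: "arr f" by (rule Hom_C_arr[OF f A B])
  note [simp] = af A B FA_arr[OF f A B] FA_arr[OF hs A B]
  have zero: "FA (scale 0 f) = scale 0 (FA f)"
  proof -
    have "Add D (scale 0 f) (scale 0 f) = scale 0 f" using scale_add_left[OF af, of 0 0] by simp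
    then have "Add D (FA (scale 0 f)) (FA (scale 0 f)) = FA (scale 0 f)"
      using FA_add[OF hs[of 0] hs[of 0]] by simp
    then have "FA (scale 0 f) = scale 0 (FA (scale 0 f))" by (intro add_cancel) simp_all
    also have "\<dots> = scale 0 (FA f)" by (rule scale_zero_eq) simp_all
    finally show ?thesis .
  qed
  have nat: "FA (scale (of_nat n) g) = scale (of_nat n) (FA g)"
    if g: "g = scale t f" for n g and t
  proof (induction n)
    case 0
    have "FA (scale 0 g) = FA (scale 0 f)"
      unfolding g by (rule arg_cong[where f = FA], rule scale_zero_eq) simp_all
    also have "\<dots> = scale 0 (FA g)"
      unfolding zero by (rule scale_zero_eq) (simp_all add: g)
    finally show ?case by simp
  next
    case (Suc n)
    have hg: "g \<in> Hom C A B" "scale (of_nat n) g \<in> Hom C A B" unfolding g by (auto intro: hs Hom_C_scale A B)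
    note [simp] = FA_arr[OF hg(1) A B] Hom_C_arr[OF hg(1) A B]
    have "scale (of_nat (Suc n)) g = Add D g (scale (of_nat n) g)"
      using scale_add_left[of g 1 "of_nat n"] by (simp add: scale_one)
    then show ?case
      using FA_add[OF hg A B] Suc scale_add_left[of "FA g" 1 "of_nat n"] by (simp add: scale_one)
  qed
  have neg: "FA (scale (- 1) f) = scale (- 1) (FA f)"
  proof (rule add_eq_zero)
    have "Add D f (scale (- 1) f) = scale 0 f"
      using scale_add_left[OF af, of 1 "- 1"] by (simp add: scale_one)
    then show "Add D (FA f) (FA (scale (- 1) f)) = scale 0 (FA f)"
      using FA_add[OF f hs[of "- 1"] A B] zero by simp
  qed simp_all
  have int: "FA (scale (of_int k) f) = scale (of_int k) (FA f)" for k
  proof (cases "k \<ge> 0")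
    case True
    then show ?thesis using nat[of f 1 "nat k"] scale_one[OF af] by simp
  next
    case False
    then have k: "of_int k = (of_nat (nat (- k)) * (- 1) :: 'k)" by simp
    have "FA (scale (of_int k) f) = FA (scale (of_nat (nat (- k))) (scale (- 1) f))"
      unfolding k by (simp only: scale_scale[OF af])
    also have "\<dots> = scale (of_nat (nat (- k))) (FA (scale (- 1) f))" by (rule nat) (rule refl)
    also have "\<dots> = scale (of_int k) (FA f)" unfolding neg k by (simp only: scale_scale[OF FA_arr(1)[OF f A B]])
    finally show ?thesis .
  qed
  obtain p q where pq: "r = of_int p / of_int q" "q > 0"
    using quotient_of_div[of r "fst (quotient_of r)" "snd (quotient_of r)"]
      quotient_of_denom_pos[of r "fst (quotient_of r)" "snd (quotient_of r)"] by auto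
  let ?n = "nat q" and ?r = "of_rat r :: 'k"
  have n: "(of_nat ?n :: 'k) \<noteq> 0" "of_nat ?n * ?r = of_int p"
    using pq by (simp_all add: of_rat_divide)
  have "scale (of_nat ?n) (FA (scale ?r f)) = FA (scale (of_nat ?n) (scale ?r f))"
    using nat[of "scale ?r f" ?r ?n] by simp
  also have "\<dots> = scale (of_int p) (FA f)" unfolding scale_scale[OF af] n(2) by (rule int)
  finally have "scale (inverse (of_nat ?n)) (scale (of_nat ?n) (FA (scale ?r f))) =
      scale (inverse (of_nat ?n)) (scale (of_int p) (FA f))" by simp
  moreover have "inverse (of_nat ?n) * of_int p = ?r" using n by (simp add: field_simps flip: n(2))
  ultimately show ?thesis using n(1) by (simp add: scale_scale scale_one)
qed

text \<open>Here \<open>tw\<close> is the identity in the covariant and the inversion in the contravariant case.\<close>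

lemma eta_alg:
  assumes V: "V \<in> reps Q"
    and tw: "\<And>\<sigma>. \<sigma> permutes {..<n} \<Longrightarrow> tw \<sigma> permutes {..<n} \<and> tw (tw \<sigma>) = \<sigma>"
    and perm: "\<And>\<sigma>. \<sigma> permutes {..<n} \<Longrightarrow>
      FA (perm_mor V n \<sigma>) ** eta n V = eta n V ** perm_mor (FO V) n (tw \<sigma>)"
  shows "FA (alg_mor V n a) ** eta n V = eta n V ** alg_mor (FO V) n (\<lambda>\<sigma>. a (tw \<sigma>))"
proof -
  let ?P = "\<lambda>a. FA (alg_mor V n a) ** eta n V = eta n V ** alg_mor (FO V) n (\<lambda>\<sigma>. a (tw \<sigma>))"
  note h = Hom_C_alg[OF V, of n]
  note [simp] = V FA_arr[OF h, simplified]
  have fin: "finite {\<sigma>. \<sigma> permutes {..<n}}" by (rule finite_permutations) simp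
  obtain b where b: "?P b" "\<And>\<tau>. \<tau> \<in> {\<sigma>. \<sigma> permutes {..<n}} \<Longrightarrow> b \<tau> = a \<tau>"
  proof (rule group_algebra_induct[where P = ?P and a = a, OF fin])
    fix \<sigma> assume "\<sigma> \<in> {\<sigma>. \<sigma> permutes {..<n}}"
    then have s: "\<sigma> permutes {..<n}" by simp
    have "alg_mor (FO V) n (\<lambda>\<tau>. if tw \<tau> = \<sigma> then 1 else 0) = perm_mor (FO V) n (tw \<sigma>)"
      unfolding perm_mor_def using tw s by (intro alg_mor_cong) auto
    then show "?P (\<lambda>\<tau>. if \<tau> = \<sigma> then 1 else 0)" using perm[OF s] by (simp add: perm_mor_def)
  next
    fix a b assume "?P a" "?P b"
    then show "?P (\<lambda>\<tau>. a \<tau> + b \<tau>)"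
      using FA_add[OF h[of a] h[of b]] by (simp add: alg_mor_add add_comp comp_add)
  next
    fix r a assume "?P a"
    then show "?P (\<lambda>\<tau>. r * a \<tau>)"
      using FA_scale_rat[OF h[of a], of r] by (simp add: alg_mor_scale scale_comp comp_scale)
  next
    show "{\<sigma>. \<sigma> permutes {..<n}} \<noteq> {}" using permutes_id by blast
  qed (rule that, assumption, simp)
  have "alg_mor V n b = alg_mor V n a" using b(2) by (intro alg_mor_cong) simp_all
  moreover have "alg_mor (FO V) n (\<lambda>\<sigma>. b (tw \<sigma>)) = alg_mor (FO V) n (\<lambda>\<sigma>. a (tw \<sigma>))"
    using b(2) tw by (intro alg_mor_cong) simp_all
  ultimately show ?thesis using b(1) by simp
qed

lemma eta_alg_covariant:
  assumes "C = D" "V \<in> reps Q"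
  shows "FA (alg_mor V n a) ** eta n V = eta n V ** alg_mor (FO V) n a"
  using eta_alg[of V n "\<lambda>\<sigma>. \<sigma>" a] eta_perm_covariant[OF assms] assms(2) by simp

lemma eta_alg_contravariant:
  assumes "C = opposite D" "V \<in> reps Q"
  shows "FA (alg_mor V n a) ** eta n V = eta n V ** alg_mor (FO V) n (star a)"
  using eta_alg[of V n "\<lambda>\<sigma>. pinv \<sigma>" a] eta_perm_contravariant[OF assms] assms(2)
  by (simp add: permutes_inv permutes_inv_inv star_def[abs_def])

end

section \<open>Schur functors commute with tensor functors\<close>

context quiver_reps
begin

lemma schur_endo_eq_Id:
  assumes V: "V \<in> reps Q" and h: "arr h" "src h = schur_rep Q T \<mu> V" "tgt h = schur_rep Q T \<mu> V"
    and eq: "incl \<mu> V ** h ** proj \<mu> V = incl \<mu> V ** proj \<mu> V"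
  shows "h = Id D (schur_rep Q T \<mu> V)"
proof (rule proj_epi[where \<mu> = \<mu> and V = V])
  show "h ** proj \<mu> V = Id D (schur_rep Q T \<mu> V) ** proj \<mu> V"
    by (rule incl_mono[where \<mu> = \<mu> and V = V]) (use V h eq in simp_all)
qed (use V h in simp_all)

end

context rep_tensor_functor
begin

lemma schur_mor_comp_C:
  assumes "f \<in> Hom C A B" "g \<in> Hom C B B'" "A \<in> reps Q" "B \<in> reps Q" "B' \<in> reps Q"
  shows "schur_mor \<mu> (Comp C g f) = Comp C (schur_mor \<mu> g) (schur_mor \<mu> f)"
  using assms variance by (auto simp: Hom_D Hom_opposite_D Comp_opposite_D schur_mor_comp)

text \<open>If the Schur functor splits, on the side of \<open>C\<close>, an element \<open>e\<close> of the group algebra with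
  quasi-inverse \<open>y\<close>, and, on the side of \<open>D\<close>, the elements \<open>e'\<close> and \<open>y'\<close> by which \<open>F\<close> lets
  \<open>e\<close> and \<open>y\<close> act, then \<open>F\<close> commutes with the Schur functor: both composites split the
  same endomorphism of the tensor power of \<open>F V\<close>.\<close>

lemma naturally_isomorphic_if_split:
  fixes \<mu> j q j' q' e y e' y'
  defines "n \<equiv> sum_list \<mu>"
  assumes j: "\<And>V. V \<in> reps Q \<Longrightarrow> j V \<in> Hom C (schur_rep Q T \<mu> V) (rep_tpow V n)"
    and q: "\<And>V. V \<in> reps Q \<Longrightarrow> q V \<in> Hom C (rep_tpow V n) (schur_rep Q T \<mu> V)"
    and jq: "\<And>V. V \<in> reps Q \<Longrightarrow> Comp C (j V) (q V) = alg_mor V n e"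
    and qyj: "\<And>V. V \<in> reps Q \<Longrightarrow>
      Comp C (q V) (Comp C (alg_mor V n y) (j V)) = Id D (schur_rep Q T \<mu> V)"
    and nat_j: "\<And>V W f. V \<in> reps Q \<Longrightarrow> W \<in> reps Q \<Longrightarrow> f \<in> Hom C V W \<Longrightarrow>
      Comp C (j W) (schur_mor \<mu> f) = Comp C (tpow_mor f n) (j V)"
    and j': "\<And>W. W \<in> reps Q \<Longrightarrow> arr (j' W) \<and> src (j' W) = schur_rep Q T \<mu> W \<and> tgt (j' W) = rep_tpow W n"
    and q': "\<And>W. W \<in> reps Q \<Longrightarrow> arr (q' W) \<and> src (q' W) = rep_tpow W n \<and> tgt (q' W) = schur_rep Q T \<mu> W"
    and j'q': "\<And>W. W \<in> reps Q \<Longrightarrow> j' W ** q' W = alg_mor W n e'"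
    and q'y'j': "\<And>W. W \<in> reps Q \<Longrightarrow> q' W ** alg_mor W n y' ** j' W = Id D (schur_rep Q T \<mu> W)"
    and nat_q': "\<And>f. arr f \<Longrightarrow> q' (tgt f) ** tpow_mor f n = schur_mor \<mu> f ** q' (src f)"
    and Fe: "\<And>V. V \<in> reps Q \<Longrightarrow> FA (alg_mor V n e) ** eta n V = eta n V ** alg_mor (FO V) n e'"
    and Fy: "\<And>V. V \<in> reps Q \<Longrightarrow> FA (alg_mor V n y) ** eta n V = eta n V ** alg_mor (FO V) n y'"
  shows "naturally_isomorphic C D (functor_comp F (schur_functor Q T \<mu>))
    (functor_comp (schur_functor Q T \<mu>) F)"
proof -
  let ?S = "schur_rep Q T \<mu>" and ?P = "\<lambda>V. rep_tpow V n"
  note FAS = FA_arr[OF Hom_C_schur]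
  have "\<exists>g. inverses (eta n V) g" if "V \<in> reps Q" for V using eta_inverses[OF that] by blast
  then obtain inve where inve: "\<And>V. V \<in> reps Q \<Longrightarrow> inverses (eta n V) (inve V)" by metis
  have inve_simps [simp]: "arr (inve V)" "src (inve V) = FO (?P V)" "tgt (inve V) = ?P (FO V)"
    if "V \<in> reps Q" for V using inve[OF that] that by simp_all
  note [simp] = FA_arr[OF j, simplified] FA_arr[OF q, simplified] FA_arr[OF Hom_C_alg, simplified]
  have j'_simps [simp]: "arr (j' W)" "src (j' W) = ?S W" "tgt (j' W) = ?P W" if "W \<in> reps Q" for W
    using j'[OF that] by simp_all
  have q'_simps [simp]: "arr (q' W)" "src (q' W) = ?P W" "tgt (q' W) = ?S W" if "W \<in> reps Q" for W
    using q'[OF that] by simp_all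
  define \<theta> where "\<theta> V = q' (FO V) ** alg_mor (FO V) n y' ** inve V ** FA (j V)" for V
  define \<theta>' where "\<theta>' V = FA (q V) ** FA (alg_mor V n y) ** eta n V ** j' (FO V)" for V
  have \<theta>: "arr (\<theta> V)" "src (\<theta> V) = FO (?S V)" "tgt (\<theta> V) = ?S (FO V)" if "V \<in> reps Q" for V
    using that by (simp_all add: \<theta>_def)
  have \<theta>': "arr (\<theta>' V)" "src (\<theta>' V) = ?S (FO V)" "tgt (\<theta>' V) = FO (?S V)" if "V \<in> reps Q" for V
    using that by (simp_all add: \<theta>'_def)
  have iso: "inverses (\<theta> V) (\<theta>' V)" if V: "V \<in> reps Q" for V
  proof -
    note [simp] = V
    let ?W = "FO V" and ?e = "alg_mor V n e" and ?y = "alg_mor V n y"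
    let ?e' = "alg_mor (FO V) n e'" and ?y' = "alg_mor (FO V) n y'"
    have inve1: "inve V ** eta n V = Id D (?P ?W)" and inve2: "eta n V ** inve V = Id D (FO (?P V))"
      using inve[OF V] by simp_all
    have Fjq: "FA (j V) ** FA (q V) = FA ?e"
      using FA_comp[OF q[OF V] j[OF V]] by (simp add: jq)
    have yj: "Comp C ?y (j V) \<in> Hom C (?S V) (?P V)"
      by (rule Hom_C_comp[OF j[OF V] Hom_C_alg]) simp_all
    have "FA (q V) ** FA (Comp C ?y (j V)) = Id D (FO (?S V))"
      using FA_comp[OF yj q[OF V]] by (simp add: qyj FA_Id)
    moreover have "FA (Comp C ?y (j V)) = FA ?y ** FA (j V)"
      by (rule FA_comp[OF j[OF V] Hom_C_alg]) simp_all
    ultimately have Fqyj: "FA (q V) ** FA ?y ** FA (j V) = Id D (FO (?S V))" by simp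
    have "\<theta> V ** \<theta>' V = q' ?W ** ?y' ** inve V ** (FA (j V) ** FA (q V)) ** FA ?y ** eta n V ** j' ?W"
      by (simp add: \<theta>_def \<theta>'_def comp_assoc)
    also have "\<dots> = q' ?W ** ?y' ** inve V ** FA ?e ** (FA ?y ** eta n V) ** j' ?W"
      by (simp add: Fjq comp_assoc)
    also have "\<dots> = q' ?W ** ?y' ** inve V ** (FA ?e ** eta n V) ** ?y' ** j' ?W"
      by (simp add: Fy comp_assoc)
    also have "\<dots> = q' ?W ** ?y' ** (inve V ** eta n V) ** ?e' ** ?y' ** j' ?W"
      by (simp add: Fe comp_assoc)
    also have "\<dots> = q' ?W ** ?y' ** (j' ?W ** q' ?W) ** ?y' ** j' ?W"
      by (simp add: inve1 j'q')
    also have "\<dots> = (q' ?W ** ?y' ** j' ?W) ** q' ?W ** ?y' ** j' ?W"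
      by (simp add: comp_assoc)
    also have "\<dots> = Id D (?S ?W)" by (simp add: q'y'j')
    finally have 1: "\<theta> V ** \<theta>' V = Id D (?S ?W)" .
    have "\<theta>' V ** \<theta> V = FA (q V) ** FA ?y ** eta n V ** (j' ?W ** q' ?W) ** ?y' ** inve V ** FA (j V)"
      by (simp add: \<theta>_def \<theta>'_def comp_assoc)
    also have "\<dots> = FA (q V) ** FA ?y ** (eta n V ** ?e') ** ?y' ** inve V ** FA (j V)"
      by (simp add: j'q' comp_assoc)
    also have "\<dots> = FA (q V) ** FA ?y ** FA ?e ** (eta n V ** ?y') ** inve V ** FA (j V)"
      by (simp add: comp_assoc flip: Fe)
    also have "\<dots> = FA (q V) ** FA ?y ** FA ?e ** FA ?y ** (eta n V ** inve V) ** FA (j V)"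
      by (simp add: comp_assoc flip: Fy)
    also have "\<dots> = FA (q V) ** FA ?y ** (FA (j V) ** FA (q V)) ** FA ?y ** FA (j V)"
      by (simp add: inve2 Fjq)
    also have "\<dots> = (FA (q V) ** FA ?y ** FA (j V)) ** FA (q V) ** FA ?y ** FA (j V)"
      by (simp add: comp_assoc)
    also have "\<dots> = Id D (FO (?S V))" by (simp add: Fqyj)
    finally show ?thesis using 1 by (simp add: \<theta> \<theta>')
  qed
  have natural: "\<theta> W ** FA (schur_mor \<mu> f) = schur_mor \<mu> (FA f) ** \<theta> V"
    if V: "V \<in> reps Q" and W: "W \<in> reps Q" and f: "f \<in> Hom C V W" for V W f
  proof -
    note [simp] = V W FA_arr[OF f V W] FA_arr[OF Hom_C_schur[OF f V W], of \<mu>, simplified]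
      FA_arr[OF Hom_C_tpow[OF f V W], of n, simplified]
    let ?yV = "alg_mor (FO V) n y'" and ?yW = "alg_mor (FO W) n y'"
    have Fj: "FA (j W) ** FA (schur_mor \<mu> f) = FA (tpow_mor f n) ** FA (j V)"
      using FA_comp[OF Hom_C_schur[OF f V W] j[OF W]] FA_comp[OF j[OF V] Hom_C_tpow[OF f V W]] nat_j[OF V W f]
      by simp
    have inv_nat: "inve W ** FA (tpow_mor f n) = tpow_mor (FA f) n ** inve V"
    proof (rule cancel_right_inverses[OF inve[OF V]])
      have "(inve W ** FA (tpow_mor f n)) ** eta n V = inve W ** FA (tpow_mor f n) ** eta n V"
        by (simp add: comp_assoc)
      also have "\<dots> = (inve W ** eta n W) ** tpow_mor (FA f) n"
        using eta_natural[OF f V W, of n] by (simp add: comp_assoc)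
      also have "\<dots> = tpow_mor (FA f) n ** inve V ** eta n V"
        using inve[OF V] inve[OF W] by simp
      also have "\<dots> = (tpow_mor (FA f) n ** inve V) ** eta n V" by (simp add: comp_assoc)
      finally show "(inve W ** FA (tpow_mor f n)) ** eta n V = (tpow_mor (FA f) n ** inve V) ** eta n V" .
    qed simp_all
    have "\<theta> W ** FA (schur_mor \<mu> f) = q' (FO W) ** ?yW ** inve W ** FA (j W) ** FA (schur_mor \<mu> f)"
      by (simp add: \<theta>_def comp_assoc)
    also have "\<dots> = q' (FO W) ** ?yW ** (inve W ** FA (tpow_mor f n)) ** FA (j V)"
      by (simp add: Fj comp_assoc)
    also have "\<dots> = q' (FO W) ** (?yW ** tpow_mor (FA f) n) ** inve V ** FA (j V)"
      by (simp add: inv_nat comp_assoc)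
    also have "?yW ** tpow_mor (FA f) n = tpow_mor (FA f) n ** ?yV"
      by (rule alg_mor_natural) simp_all
    also have "q' (FO W) ** (tpow_mor (FA f) n ** ?yV) ** inve V ** FA (j V) =
        (q' (FO W) ** tpow_mor (FA f) n) ** ?yV ** inve V ** FA (j V)"
      by (simp add: comp_assoc)
    also have "\<dots> = schur_mor \<mu> (FA f) ** \<theta> V"
      using nat_q'[of "FA f"] by (simp add: \<theta>_def comp_assoc)
    finally show ?thesis .
  qed
  let ?G = "functor_comp F (schur_functor Q T \<mu>)" and ?H = "functor_comp (schur_functor Q T \<mu>) F"
  have GH: "on_obj ?G V = FO (?S V)" "on_obj ?H V = ?S (FO V)"
      "on_arr ?G f = FA (schur_mor \<mu> f)" "on_arr ?H f = schur_mor \<mu> (FA f)" for V f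
    by (simp_all add: functor_comp_def)
  have "is_functor C D ?G"
    unfolding is_functor_def GH C_simps Obj_D
  proof (intro conjI ballI)
    fix A B f assume a: "A \<in> reps Q" "B \<in> reps Q" "f \<in> Hom C A B"
    show "FA (schur_mor \<mu> f) \<in> Hom D (FO (?S A)) (FO (?S B))"
      using FAS[OF a(3,1,2), of \<mu>] a by (simp add: Hom_D)
    fix B' g assume b: "B' \<in> reps Q" "g \<in> Hom C B B'"
    show "FA (schur_mor \<mu> (Comp C g f)) = FA (schur_mor \<mu> g) ** FA (schur_mor \<mu> f)"
      unfolding schur_mor_comp_C[OF a(3) b(2) a(1,2) b(1)]
      by (rule FA_comp[OF Hom_C_schur[OF a(3,1,2)] Hom_C_schur[OF b(2) a(2) b(1)]]) (simp_all add: a b)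
  qed (simp_all add: schur_mor_Id FA_Id)
  moreover have "is_functor C D ?H"
    unfolding is_functor_def GH C_simps Obj_D
  proof (intro conjI ballI)
    fix A B f assume a: "A \<in> reps Q" "B \<in> reps Q" "f \<in> Hom C A B"
    note [simp] = a(1,2) FA_arr[OF a(3,1,2)]
    show "schur_mor \<mu> (FA f) \<in> Hom D (?S (FO A)) (?S (FO B))" by (simp add: Hom_D)
    fix B' g assume b: "B' \<in> reps Q" "g \<in> Hom C B B'"
    show "schur_mor \<mu> (FA (Comp C g f)) = schur_mor \<mu> (FA g) ** schur_mor \<mu> (FA f)"
      unfolding FA_comp[OF a(3) b(2) a(1,2) b(1)]
      using b FA_arr[OF b(2) a(2) b(1)] by (intro schur_mor_comp) simp_all
  qed (simp_all add: schur_mor_Id FA_Id)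
  moreover have "is_iso D (FO (?S V)) (?S (FO V)) (\<theta> V)" if V: "V \<in> reps Q" for V
    unfolding is_iso_def using iso[OF V] \<theta>[OF V] V
    by (intro exI[of _ "\<theta>' V"] inverse_pair_D[THEN iffD2]) simp_all
  ultimately show ?thesis
    unfolding naturally_isomorphic_def GH C_simps using natural by blast
qed

text \<open>In the contravariant case \<open>F\<close> exchanges the roles of inclusion and projection and turns
  \<open>e\<close> into \<open>star e\<close>, whose image is identified with that of \<open>e\<close> by the action of \<open>e\<close>.\<close>

theorem schur_functor_commutes:
  "naturally_isomorphic C D (functor_comp F (schur_functor Q T \<mu>))
    (functor_comp (schur_functor Q T \<mu>) F)"
proof -
  let ?S = "schur_rep Q T \<mu>" and ?n = "sum_list \<mu>" and ?e = "young_element \<mu>"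
  obtain y where y: "\<And>\<sigma>. \<sigma> permutes {..<?n} \<Longrightarrow> conv {..<?n} (star ?e) (conv {..<?n} ?e y) \<sigma> = star ?e \<sigma>"
    "\<And>\<sigma>. \<sigma> permutes {..<?n} \<Longrightarrow> conv {..<?n} (conv {..<?n} (star y) (star ?e)) ?e \<sigma> = ?e \<sigma>"
    "\<And>\<sigma>. \<sigma> permutes {..<?n} \<Longrightarrow> conv {..<?n} ?e (conv {..<?n} y ?e) \<sigma> = ?e \<sigma>"
    by (rule group_algebra_regular[OF finite_lessThan, of ?n ?e]) blast
  let ?A = "\<lambda>V a. alg_mor V ?n a"
  have eye: "?A V ?e ** ?A V y ** ?A V ?e = ?A V ?e" if V: "V \<in> reps Q" for V
    using y(3) by (simp add: alg_mor_comp V conv_assoc alg_mor_cong[OF V, of ?n "conv {..<?n} (conv {..<?n} ?e y) ?e" ?e])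
  have se: "?A V y ** ?A V ?e ** ?A V (star ?e) = ?A V (star ?e)" if V: "V \<in> reps Q" for V
    using y(1) by (simp add: alg_mor_comp V conv_assoc
        alg_mor_cong[OF V, of ?n "conv {..<?n} (conv {..<?n} (star ?e) ?e) y" "star ?e"])
  have es: "?A V ?e ** ?A V (star ?e) ** ?A V (star y) = ?A V ?e" if V: "V \<in> reps Q" for V
    using y(2) by (simp add: alg_mor_comp V alg_mor_cong[OF V, of ?n "conv {..<?n} (conv {..<?n} (star y) (star ?e)) ?e" ?e])
  have pyi: "proj \<mu> V ** ?A V y ** incl \<mu> V = Id D (?S V)" if V: "V \<in> reps Q" for V
  proof (rule schur_endo_eq_Id[OF V])
    have "incl \<mu> V ** (proj \<mu> V ** ?A V y ** incl \<mu> V) ** proj \<mu> V =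
        (incl \<mu> V ** proj \<mu> V) ** ?A V y ** incl \<mu> V ** proj \<mu> V"
      by (simp add: V comp_assoc)
    then show "incl \<mu> V ** (proj \<mu> V ** ?A V y ** incl \<mu> V) ** proj \<mu> V = incl \<mu> V ** proj \<mu> V"
      by (simp only: incl_proj[OF V] eye[OF V])
  qed (simp_all add: V)
  from variance show ?thesis
  proof
    assume C: "C = D"
    show ?thesis
    proof (rule naturally_isomorphic_if_split[where j = "incl \<mu>" and q = "proj \<mu>" and j' = "incl \<mu>"
          and q' = "proj \<mu>" and e = ?e and e' = ?e and y = y and y' = y])
      show "Comp C (incl \<mu> W) (schur_mor \<mu> f) = Comp C (tpow_mor f ?n) (incl \<mu> V)"
        if "V \<in> reps Q" "W \<in> reps Q" "f \<in> Hom C V W" for V W f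
        using incl_natural[of f \<mu>] that by (simp add: C Hom_D)
    qed (simp_all add: C Hom_D incl_proj pyi proj_natural eta_alg_covariant)
  next
    assume C: "C = opposite D"
    show ?thesis
    proof (rule naturally_isomorphic_if_split[where j = "proj \<mu>" and q = "incl \<mu>"
          and j' = "\<lambda>W. ?A W y ** incl \<mu> W" and q' = "\<lambda>W. proj \<mu> W ** ?A W (star ?e)"
          and e = ?e and e' = "star ?e" and y = y and y' = "star y"])
      fix V :: "('v, 'e, 'k, 'u) qrep" assume V: "V \<in> reps Q"
      show "Comp C (incl \<mu> V) (Comp C (?A V y) (proj \<mu> V)) = Id D (?S V)"
        using pyi[OF V] V by (simp add: C Comp_opposite_D comp_assoc)
      have "(?A V y ** incl \<mu> V) ** proj \<mu> V ** ?A V (star ?e) =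
          ?A V y ** (incl \<mu> V ** proj \<mu> V) ** ?A V (star ?e)"
        by (simp add: V comp_assoc)
      then show "(?A V y ** incl \<mu> V) ** proj \<mu> V ** ?A V (star ?e) = ?A V (star ?e)"
        by (simp only: incl_proj[OF V] se[OF V])
      show "(proj \<mu> V ** ?A V (star ?e)) ** ?A V (star y) ** ?A V y ** incl \<mu> V = Id D (?S V)"
      proof (rule schur_endo_eq_Id[OF V])
        have "incl \<mu> V ** ((proj \<mu> V ** ?A V (star ?e)) ** ?A V (star y) ** ?A V y ** incl \<mu> V) ** proj \<mu> V =
            ((incl \<mu> V ** proj \<mu> V) ** ?A V (star ?e) ** ?A V (star y)) ** ?A V y ** incl \<mu> V ** proj \<mu> V"
          by (simp add: V comp_assoc)
        then show "incl \<mu> V ** ((proj \<mu> V ** ?A V (star ?e)) ** ?A V (star y) ** ?A V y ** incl \<mu> V) ** proj \<mu> V =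
            incl \<mu> V ** proj \<mu> V"
          by (simp only: incl_proj[OF V] es[OF V] eye[OF V])
      qed (simp_all add: V)
      show "FA (?A V ?e) ** eta ?n V = eta ?n V ** ?A (FO V) (star ?e)"
        by (rule eta_alg_contravariant[OF C V])
      show "FA (?A V y) ** eta ?n V = eta ?n V ** ?A (FO V) (star y)"
        by (rule eta_alg_contravariant[OF C V])
    next
      fix V W :: "('v, 'e, 'k, 'u) qrep" and f assume V: "V \<in> reps Q" and W: "W \<in> reps Q" and f: "f \<in> Hom C V W"
      show "Comp C (proj \<mu> W) (schur_mor \<mu> f) = Comp C (tpow_mor f ?n) (proj \<mu> V)"
        using proj_natural[of f \<mu>] V W f by (simp add: C Comp_opposite_D Hom_opposite_D)
    next
      fix f :: "('v, 'e, 'k, 'u) qmor" assume f: "arr f"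
      have "(proj \<mu> (tgt f) ** ?A (tgt f) (star ?e)) ** tpow_mor f ?n =
          proj \<mu> (tgt f) ** ?A (tgt f) (star ?e) ** tpow_mor f ?n"
        by (simp add: f comp_assoc)
      also have "\<dots> = (proj \<mu> (tgt f) ** tpow_mor f ?n) ** ?A (src f) (star ?e)"
        by (simp add: f comp_assoc alg_mor_natural)
      also have "\<dots> = schur_mor \<mu> f ** proj \<mu> (src f) ** ?A (src f) (star ?e)"
        by (simp add: f comp_assoc proj_natural)
      finally show "(proj \<mu> (tgt f) ** ?A (tgt f) (star ?e)) ** tpow_mor f ?n =
          schur_mor \<mu> f ** proj \<mu> (src f) ** ?A (src f) (star ?e)" .
    qed (simp_all add: C Hom_opposite_D Comp_opposite_D incl_proj)
  qed
qed

end

theorem mainTheorem2: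
  fixes Q :: "('v, 'e) pre_digraph"
    and T :: "('k::field_char_0, 'u) tensor_data"
    and C :: "(('v, 'e, 'k, 'u) qrep, ('v, 'e, 'k, 'u) qmor) tensor_cat"
    and F :: "(('v, 'e, 'k, 'u) qrep, ('v, 'e, 'k, 'u) qmor,
               ('v, 'e, 'k, 'u) qrep, ('v, 'e, 'k, 'u) qmor) functor_data"
    and c :: "('v, 'e, 'k, 'u) qrep \<Rightarrow> ('v, 'e, 'k, 'u) qrep \<Rightarrow> ('v, 'e, 'k, 'u) qmor"
    and \<mu> :: "nat list"
  assumes quiver: "fin_digraph Q" "connected Q"
    and tensor_choice: "tensor_choice T"
    and variance: "C = rep_cat Q T \<or> C = opposite (rep_cat Q T)"
    and tensor_functor: "tensor_functor C (rep_cat Q T) F c"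
    and partition: "is_partition \<mu>"
  shows "naturally_isomorphic C (rep_cat Q T)
           (functor_comp F (schur_functor Q T \<mu>))
           (functor_comp (schur_functor Q T \<mu>) F)"
proof -
  interpret rep_tensor_functor T Q C F c
    using quiver(1) tensor_choice variance tensor_functor
    by (intro rep_tensor_functor.intro quiver_reps.intro tensor_choice_0.intro
        rep_tensor_functor_axioms.intro fin_digraph.axioms(1))
  show ?thesis by (rule schur_functor_commutes)
qed

end
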